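(* Let $\lambda_1\ge\lambda_2\ge\cdots$ be an infinite sequence of positive real numbers with $\sum_{j=1}^\infty\lambda_j^2=\infty$. For each $d'\ge1$ put $\tau_{d'}^2=2\sum_{j=1}^{d'}\left(3\lambda_j^4+2\lambda_j^2\right)$, and let $T_{n,d'}$ be the random variable defined in the context from $\lambda_1,\dots,\lambda_{d'}$. If $n=n(d')\to\infty$ and $d'\to\infty$ in such a way that $\frac{\log n\,\log d'}{\tau_{d'}^2}\to 0$, then $$\frac{\tau_{d'}}{\sqrt{2\log n}}\,E\left(T_{n,d'}\right)\to 1.$$
   Context: Let $V_j,\varepsilon'_j$ ($1\le j\le d'$) and $V_{ij}$ ($1\le i\le n$, $1\le j\le d'$) be independent $N(0,1)$ random variables. Set $\mu_j=V_j+\varepsilon'_j/\lambda_j$ and $W_{ij}=\mu_j-V_{ij}$, so that, conditionally on $(\mu_1,\dots,\mu_{d'})$, the $W_{ij}$ are independent with $W_{ij}\sim N(\mu_j,1)$. Define $$S_i=\frac{\sum_{j=1}^{d'}\lambda_j^2\left(W_{ij}^2-(1+\mu_j^2)\right)}{\left(2\sum_{j=1}^{d'}\lambda_j^4(1+2\mu_j^2)\right)^{1/2}},\qquad i=1,\dots,n,$$ let $S_{(1)}\le\cdots\le S_{(n)}$ be the ordered values of $S_1,\dots,S_n$, let $\sigma_{d'}^2=\frac{2}{d'}\sum_{j=1}^{d'}\lambda_j^4(1+2\mu_j^2)$, and $$T_{n,d'}=\sum_{\ell=2}^n e^{-\sigma_{d'}\sqrt{d'}\,(S_{(\ell)}-S_{(1)})}.$$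 (These arise from a Gaussian particle filter $Y=HX+\varepsilon$ in which $\lambda_1^2,\dots,\lambda_{d'}^2$ are the nonzero singular values of $\mathrm{cov}(HX)$.) *)

theory Defs
  imports "HOL-Probability.Probability"
begin

text \<open>
  Throughout, sequences are used from index 1 on; \<open>lam 0\<close> and the other index-0 entries are
  irrelevant. The families \<open>V j\<close>, \<open>e j\<close>, \<open>U i j\<close> stand for $V_j$, $\varepsilon'_j$, $V_{ij}$.
\<close>

text \<open>Joint independence of the three families together, hence one family over a sum type.\<close>

definition indep_std_normals ::
  "'a measure \<Rightarrow> nat \<Rightarrow> nat \<Rightarrow> (nat \<Rightarrow> 'a \<Rightarrow> real) \<Rightarrow> (nat \<Rightarrow> 'a \<Rightarrow> real)
    \<Rightarrow> (nat \<Rightarrow> nat \<Rightarrow> 'a \<Rightarrow> real) \<Rightarrow> bool" where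
  "indep_std_normals M n d V e U \<longleftrightarrow>
     prob_space M \<and>
     prob_space.indep_vars M (\<lambda>_. borel) (case_sum V (case_sum e (case_prod U)))
       ({1..d} <+> ({1..d} <+> {1..n} \<times> {1..d})) \<and>
     (\<forall>j\<in>{1..d}. distributed M lborel (V j) std_normal_density) \<and>
     (\<forall>j\<in>{1..d}. distributed M lborel (e j) std_normal_density) \<and>
     (\<forall>i\<in>{1..n}. \<forall>j\<in>{1..d}. distributed M lborel (U i j) std_normal_density)"

definition mu :: "(nat \<Rightarrow> real) \<Rightarrow> (nat \<Rightarrow> 'a \<Rightarrow> real) \<Rightarrow> (nat \<Rightarrow> 'a \<Rightarrow> real) \<Rightarrow> nat \<Rightarrow> 'a \<Rightarrow> real" where
  "mu lam V e j \<omega> = V j \<omega> + e j \<omega> / lam j"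

definition W :: "(nat \<Rightarrow> real) \<Rightarrow> (nat \<Rightarrow> 'a \<Rightarrow> real) \<Rightarrow> (nat \<Rightarrow> 'a \<Rightarrow> real)
    \<Rightarrow> (nat \<Rightarrow> nat \<Rightarrow> 'a \<Rightarrow> real) \<Rightarrow> nat \<Rightarrow> nat \<Rightarrow> 'a \<Rightarrow> real" where
  "W lam V e U i j \<omega> = mu lam V e j \<omega> - U i j \<omega>"

definition S :: "(nat \<Rightarrow> real) \<Rightarrow> nat \<Rightarrow> (nat \<Rightarrow> 'a \<Rightarrow> real) \<Rightarrow> (nat \<Rightarrow> 'a \<Rightarrow> real)
    \<Rightarrow> (nat \<Rightarrow> nat \<Rightarrow> 'a \<Rightarrow> real) \<Rightarrow> nat \<Rightarrow> 'a \<Rightarrow> real" where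
  "S lam d V e U i \<omega> =
     (\<Sum>j=1..d. (lam j)\<^sup>2 * ((W lam V e U i j \<omega>)\<^sup>2 - (1 + (mu lam V e j \<omega>)\<^sup>2))) /
     sqrt (2 * (\<Sum>j=1..d. (lam j)^4 * (1 + 2 * (mu lam V e j \<omega>)\<^sup>2)))"

text \<open>The \<open>k\<close>-th smallest (\<open>1 \<le> k \<le> n\<close>) of \<open>x 1, \<dots>, x n\<close>, counted with multiplicity.\<close>

definition order_stat :: "nat \<Rightarrow> (nat \<Rightarrow> real) \<Rightarrow> nat \<Rightarrow> real" where
  "order_stat n x k = sort (map x [1..<Suc n]) ! (k - 1)"

definition sigma :: "(nat \<Rightarrow> real) \<Rightarrow> nat \<Rightarrow> (nat \<Rightarrow> 'a \<Rightarrow> real) \<Rightarrow> (nat \<Rightarrow> 'a \<Rightarrow> real) \<Rightarrow> 'a \<Rightarrow> real" where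
  "sigma lam d V e \<omega> =
     sqrt (2 / real d * (\<Sum>j=1..d. (lam j)^4 * (1 + 2 * (mu lam V e j \<omega>)\<^sup>2)))"

definition T :: "(nat \<Rightarrow> real) \<Rightarrow> nat \<Rightarrow> nat \<Rightarrow> (nat \<Rightarrow> 'a \<Rightarrow> real) \<Rightarrow> (nat \<Rightarrow> 'a \<Rightarrow> real)
    \<Rightarrow> (nat \<Rightarrow> nat \<Rightarrow> 'a \<Rightarrow> real) \<Rightarrow> 'a \<Rightarrow> real" where
  "T lam n d V e U \<omega> =
     (\<Sum>l=2..n. exp (- (sigma lam d V e \<omega> * sqrt (real d) *
        (order_stat n (\<lambda>i. S lam d V e U i \<omega>) l - order_stat n (\<lambda>i. S lam d V e U i \<omega>) 1))))"

definition tau :: "(nat \<Rightarrow> real) \<Rightarrow> nat \<Rightarrow> real" where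
  "tau lam d = sqrt (2 * (\<Sum>j=1..d. 3 * (lam j)^4 + 2 * (lam j)\<^sup>2))"

end

theory Submission imports Defs
begin

text \<open>
  Fix the hidden variables and write \<open>m\<^sub>j\<close> for the value of \<open>mu\<close> at \<open>j\<close>. Multiplying the statistics \<open>S\<close> by
  \<open>s = sigma * sqrt d\<close> gives \<open>X\<^sub>i = \<Sum>\<^sub>j lam\<^sub>j\<^sup>2 (U\<^sub>i\<^sub>j\<^sup>2 - 1 - 2 m\<^sub>j U\<^sub>i\<^sub>j)\<close>, which are i.i.d. in \<open>i\<close> with
  mean 0 and variance \<open>s\<^sup>2\<close>, and \<open>T\<close> becomes \<open>\<Sum>\<^sub>i exp (- (X\<^sub>i - min X)) - 1\<close>. Thus \<open>T\<close> measures how many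
  sample points lie within distance of order 1 of the minimum.

  Let \<open>F\<close> be the common distribution function and \<open>M\<^sub>i\<close> the minimum of the sample without its \<open>i\<close>-th
  member. Since \<open>X\<^sub>i\<close> and \<open>M\<^sub>i\<close> are independent, \<open>E T = \<Sum>\<^sub>i E h(M\<^sub>i)\<close>, where
  \<open>h m = \<integral>\<^sub>0\<^sup>\<infinity> exp (- u) (F (m + u) - F m) du\<close>. If \<open>ln F\<close> has slope \<open>k\<close> near \<open>m\<close>, with \<open>k\<close> small, then
  \<open>h m\<close> is close to \<open>k F m\<close>; and \<open>\<Sum>\<^sub>i E F(M\<^sub>i) = 1\<close>, because exactly one sample point is the minimum.
  Hence \<open>E T\<close> is close to the slope of \<open>ln F\<close> at the typical position of the minimum, which is
  \<open>- s \<theta>\<close> with \<open>\<theta> = sqrt (2 ln n)\<close>.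

  For a Gaussian of variance \<open>s\<^sup>2\<close> this slope is about \<open>\<theta> / s\<close>. Here it is found without a local limit
  theorem. The Laplace transform of \<open>X\<^sub>i\<close> is explicit and gives \<open>ln F(- y)\<close> as \<open>- y\<^sup>2 / (2 s\<^sup>2)\<close> up to a factor
  close to 1 for \<open>s \<lless> y \<lless> s\<^sup>2\<close> (\<open>left_tail_le\<close>, \<open>left_tail_ge\<close>). Moreover \<open>F\<close> is log-concave, being the
  Gaussian measure of the sublevel sets of a convex function (\<open>log_concave_cdf_convex_sum\<close>, from the
  Prekopa-Leindler inequality). An asymptotic formula for a concave function may be differentiated,
  so the slope of \<open>ln F\<close> at \<open>- y\<close> is about \<open>y / s\<^sup>2\<close> (\<open>slope_le\<close>, \<open>slope_ge\<close>). All estimates depend on the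
  hidden variables only through \<open>s\<close>, which yields the uniform statement \<open>softmin_excess_asymptotics\<close>:
  the conditional expectation of \<open>T\<close> times \<open>s / \<theta>\<close> tends to 1 as \<open>n\<close> and \<open>s\<close> tend to infinity with
  \<open>\<theta> / s\<close> tending to 0.

  It remains to replace \<open>s\<close> by \<open>tau\<close>. One has \<open>E s\<^sup>2 = tau\<^sup>2\<close>, and \<open>s\<^sup>2\<close> deviates from \<open>tau\<^sup>2\<close> by a fixed
  proportion only with probability exponentially small in \<open>tau\<^sup>2\<close> (\<open>cond_variance_concentration\<close>).
  On that exceptional event the bound \<open>T \<le> n\<close> suffices, since \<open>ln n\<close> is of smaller order than \<open>tau\<^sup>2\<close>.
\<close>

section \<open>Log-concavity and the Prekopa-Leindler inequality on the line\<close>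

text \<open>
  The weighted geometric mean is written with \<open>powr\<close>, for which \<open>0 powr a = 0\<close>; so the inequality is void
  wherever \<open>f\<close> vanishes, and distribution functions of laws bounded below are admitted.
\<close>

definition log_concave :: "(real \<Rightarrow> real) \<Rightarrow> bool" where
  "log_concave f \<longleftrightarrow> (\<forall>x. 0 \<le> f x) \<and>
     (\<forall>x y t. 0 < t \<longrightarrow> t < 1 \<longrightarrow> f x powr (1 - t) * f y powr t \<le> f ((1 - t) * x + t * y))"

lemma log_concave_superlevel_convex:
  assumes "log_concave f" "0 \<le> c"
  shows "convex {x. c < f x}"
proof (rule convexI)
  fix x y u v :: real
  assume x: "x \<in> {x. c < f x}" and y: "y \<in> {x. c < f x}" and uv: "0 \<le> u" "0 \<le> v" "u + v = 1"
  consider "v = 0" | "v = 1" | "0 < v" "v < 1" using uv by linarith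
  then have "c < f (u * x + v * y)"
  proof cases
    case 3
    have "c = c powr (1 - v) * c powr v"
      using \<open>0 \<le> c\<close> by (simp add: powr_add[symmetric])
    also have "\<dots> < f x powr (1 - v) * f y powr v"
    proof (rule mult_strict_mono')
      show "c powr (1 - v) < f x powr (1 - v)" "c powr v < f y powr v"
        using x y 3 assms(2) by (auto intro!: powr_less_mono2)
    qed auto
    also have "\<dots> \<le> f ((1 - v) * x + v * y)"
      using assms(1) 3 by (auto simp: log_concave_def)
    also have "1 - v = u" using uv by simp
    finally show ?thesis .
  qed (use x y uv in auto)
  then show "u *\<^sub>R x + v *\<^sub>R y \<in> {x. c < f x}" by simp
qed

lemma emeasure_le_of_diff_le:
  fixes A :: "real set"
  assumes "A \<noteq> {}" and le: "\<And>a a'. a \<in> A \<Longrightarrow> a' \<in> A \<Longrightarrow> a' - a \<le> k"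
  shows "emeasure lborel A \<le> ennreal k"
proof -
  obtain a0 where a0: "a0 \<in> A" using assms by auto
  have bdd: "bdd_above A" "bdd_below A"
    using le[OF a0] le[OF _ a0] by (force intro!: bdd_aboveI[where M = "a0 + k"] bdd_belowI[where m = "a0 - k"])+
  have "Sup A \<le> a + k" if "a \<in> A" for a
    using assms le[OF that] by (intro cSup_least) (auto simp: algebra_simps)
  then have "Sup A - k \<le> Inf A"
    using assms by (intro cInf_greatest) (auto simp: algebra_simps)
  have "A \<subseteq> {Inf A..Sup A}"
    using bdd by (auto intro: cInf_lower cSup_upper)
  then have "emeasure lborel A \<le> emeasure lborel {Inf A..Sup A}"
    by (intro emeasure_mono) auto
  also have "emeasure lborel {Inf A..Sup A} = ennreal (Sup A - Inf A)"
    using a0 bdd by (subst emeasure_lborel_Icc) (auto intro: cInf_lower2 cSup_upper)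
  finally show ?thesis
    using \<open>Sup A - k \<le> Inf A\<close> by (auto elim!: order_trans intro!: ennreal_leI)
qed

text \<open>
  On the line the inequality is about lengths of intervals: the measure of \<open>A\<close> is at most the
  supremum of the distances of its points, likewise for \<open>B\<close>, and a convex \<open>C\<close> that contains the combinations of two
  pairs of points contains the whole interval between them.
\<close>

lemma brunn_minkowski_real:
  fixes A B C :: "real set"
  assumes "0 < t" "t < 1" and ne: "A \<noteq> {}" "B \<noteq> {}" and "convex C"
    and meas: "C \<in> sets borel"
    and sub: "\<And>a b. a \<in> A \<Longrightarrow> b \<in> B \<Longrightarrow> (1 - t) * a + t * b \<in> C"
  shows "ennreal (1 - t) * emeasure lborel A + ennreal t * emeasure lborel B \<le> emeasure lborel C"
proof (cases "emeasure lborel C = \<infinity>")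
  case False
  define K where "K = measure lborel C"
  have K: "emeasure lborel C = ennreal K"
    unfolding K_def using False by (simp add: emeasure_eq_ennreal_measure)
  have "0 \<le> K" by (simp add: K_def)
  have aux: "(1 - t) * (a' - a) + t * (b' - b) \<le> K"
    if "a \<in> A" "a' \<in> A" "b \<in> B" "b' \<in> B" for a a' b b'
  proof (rule ccontr)
    assume neg: "\<not> ?thesis"
    let ?x = "(1 - t) * a + t * b" and ?y = "(1 - t) * a' + t * b'"
    have "{?x..?y} \<subseteq> C"
      using closed_segment_subset[OF sub[OF that(1,3)] sub[OF that(2,4)] \<open>convex C\<close>]
      by (auto simp: closed_segment_eq_real_ivl split: if_splits)
    then have "emeasure lborel {?x..?y} \<le> emeasure lborel C"
      using meas by (intro emeasure_mono) auto
    moreover have "?y - ?x = (1 - t) * (a' - a) + t * (b' - b)" by (simp add: algebra_simps)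
    ultimately have "ennreal (?y - ?x) \<le> ennreal K"
      using neg \<open>0 \<le> K\<close> by (simp add: K)
    then show False
      using neg \<open>0 \<le> K\<close> \<open>?y - ?x = _\<close> by (simp add: ennreal_le_iff)
  qed
  define \<alpha> where "\<alpha> = measure lborel A"
  obtain b0 where b0: "b0 \<in> B" using ne by auto
  obtain a0 where a0: "a0 \<in> A" using ne by auto
  have A: "emeasure lborel A \<le> ennreal ((K - t * (b' - b)) / (1 - t))" if "b \<in> B" "b' \<in> B" for b b'
    using aux that assms(1,2) by (intro emeasure_le_of_diff_le ne) (simp add: field_simps)
  have "emeasure lborel A < \<infinity>" using A[OF b0 b0] by (simp add: le_less_trans)
  then have \<alpha>: "emeasure lborel A = ennreal \<alpha>" "0 \<le> \<alpha>"
    unfolding \<alpha>_def by (simp_all add: emeasure_eq_ennreal_measure)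
  have nn: "0 \<le> K - t * (b' - b)" if "b \<in> B" "b' \<in> B" for b b'
    using aux[OF a0 a0 that] by simp
  have B: "b' - b \<le> (K - (1 - t) * \<alpha>) / t" if "b \<in> B" "b' \<in> B" for b b'
  proof -
    have "\<alpha> \<le> (K - t * (b' - b)) / (1 - t)"
      using A[OF that] nn[OF that] \<alpha> assms by (subst (asm) \<alpha>) (simp add: ennreal_le_iff)
    then show ?thesis using assms by (simp add: field_simps)
  qed
  have 0: "0 \<le> (K - (1 - t) * \<alpha>) / t" using B[OF b0 b0] by simp
  have "emeasure lborel B \<le> ennreal ((K - (1 - t) * \<alpha>) / t)"
    by (rule emeasure_le_of_diff_le[OF ne(2) B])
  then have "ennreal t * emeasure lborel B \<le> ennreal t * ennreal ((K - (1 - t) * \<alpha>) / t)"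
    by (intro mult_left_mono) auto
  also have "\<dots> = ennreal (K - (1 - t) * \<alpha>)"
    using assms 0 by (subst ennreal_mult[symmetric]) auto
  finally have "ennreal (1 - t) * emeasure lborel A + ennreal t * emeasure lborel B
      \<le> ennreal ((1 - t) * \<alpha>) + ennreal (K - (1 - t) * \<alpha>)"
    using assms \<alpha> by (intro add_mono) (auto simp: ennreal_mult)
  also have "\<dots> = ennreal K"
    using assms \<alpha> 0 by (subst ennreal_plus[symmetric]) (auto simp: zero_le_divide_iff)
  finally show ?thesis using K by simp
qed simp

lemma nn_integral_layer_cake:
  fixes f :: "real \<Rightarrow> real"
  assumes [measurable]: "f \<in> borel_measurable borel" and "\<And>x. 0 \<le> f x"
  shows "(\<integral>\<^sup>+x. ennreal (f x) \<partial>lborel) =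
    (\<integral>\<^sup>+c. indicator {0..} c * emeasure lborel {x. c < f x} \<partial>lborel)"
proof -
  have "(\<integral>\<^sup>+x. ennreal (f x) \<partial>lborel) =
      (\<integral>\<^sup>+x. (\<integral>\<^sup>+c. indicator {0..} c * indicator {x. c < f x} x \<partial>lborel) \<partial>lborel)"
  proof (rule nn_integral_cong)
    fix x
    have "(\<integral>\<^sup>+c. indicator {0..} c * indicator {x. c < f x} x \<partial>lborel)
        = (\<integral>\<^sup>+c. indicator {0..<f x} c \<partial>lborel)"
      by (intro nn_integral_cong) (auto split: split_indicator)
    also have "\<dots> = ennreal (f x)" using assms by simp
    finally show "ennreal (f x) = (\<integral>\<^sup>+c. indicator {0..} c * indicator {x. c < f x} x \<partial>lborel)" ..
  qed
  also have "\<dots> = (\<integral>\<^sup>+c. (\<integral>\<^sup>+x. indicator {0..} c * indicator {x. c < f x} x \<partial>lborel) \<partial>lborel)"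
    by (rule lborel_pair.Fubini') measurable
  also have "\<dots> = (\<integral>\<^sup>+c. indicator {0..} c * emeasure lborel {x. c < f x} \<partial>lborel)"
    by (intro nn_integral_cong) (subst nn_integral_cmult; simp)
  finally show ?thesis .
qed

text \<open>
  The superlevel sets of \<open>f\<close>, \<open>g\<close> and \<open>h\<close> at equal height satisfy the hypothesis of the Brunn-Minkowski
  inequality, and integrating over the height gives the claim. That inequality fails for empty sets;
  normalising both suprema to 1 makes the superlevel sets of \<open>f\<close> and \<open>g\<close> become empty at the same height.
\<close>

lemma prekopa_leindler_normalized:
  fixes f g h :: "real \<Rightarrow> real"
  assumes t: "0 < t" "t < 1"
    and meas [measurable]: "f \<in> borel_measurable borel" "g \<in> borel_measurable borel" "h \<in> borel_measurable borel"
    and nonneg: "\<And>x. 0 \<le> f x" "\<And>x. 0 \<le> g x" and lc: "log_concave h"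
    and le1: "\<And>x. f x \<le> 1" "\<And>x. g x \<le> 1"
    and sup: "\<And>c. c < 1 \<Longrightarrow> \<exists>x. c < f x" "\<And>c. c < 1 \<Longrightarrow> \<exists>x. c < g x"
    and fgh: "\<And>x y. f x powr (1 - t) * g y powr t \<le> h ((1 - t) * x + t * y)"
  shows "ennreal (1 - t) * (\<integral>\<^sup>+x. f x \<partial>lborel) + ennreal t * (\<integral>\<^sup>+x. g x \<partial>lborel) \<le> (\<integral>\<^sup>+x. h x \<partial>lborel)"
proof -
  have h0: "0 \<le> h x" for x using lc by (auto simp: log_concave_def)
  have mset [measurable]: "(\<lambda>c. emeasure lborel {x. c < k x}) \<in> borel_measurable borel"
    if [measurable]: "k \<in> borel_measurable borel" for k :: "real \<Rightarrow> real"
  proof -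
    have "(\<lambda>c. emeasure lborel {x. c < k x}) = (\<lambda>c. \<integral>\<^sup>+x. indicator {x. c < k x} x \<partial>lborel)" by simp
    also have "\<dots> \<in> borel_measurable borel" by measurable
    finally show ?thesis .
  qed
  have "ennreal (1 - t) * (\<integral>\<^sup>+x. f x \<partial>lborel) + ennreal t * (\<integral>\<^sup>+x. g x \<partial>lborel) =
     (\<integral>\<^sup>+c. ennreal (1 - t) * (indicator {0..} c * emeasure lborel {x. c < f x}) +
        ennreal t * (indicator {0..} c * emeasure lborel {x. c < g x}) \<partial>lborel)"
    using nonneg by (simp add: nn_integral_layer_cake nn_integral_add nn_integral_cmult)
  also have "\<dots> \<le> (\<integral>\<^sup>+c. indicator {0..} c * emeasure lborel {x. c < h x} \<partial>lborel)"
  proof (rule nn_integral_mono)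
    fix c :: real
    consider "c < 0" | "1 \<le> c" | "0 \<le> c" "c < 1" by linarith
    then show "ennreal (1 - t) * (indicator {0..} c * emeasure lborel {x. c < f x}) +
        ennreal t * (indicator {0..} c * emeasure lborel {x. c < g x})
        \<le> indicator {0..} c * emeasure lborel {x. c < h x}"
    proof cases
      case 2
      then have "{x. c < f x} = {}" "{x. c < g x} = {}"
        using le1 by (auto simp: not_less intro: order_trans)
      then show ?thesis by simp
    next
      case 3
      have "ennreal (1 - t) * emeasure lborel {x. c < f x} + ennreal t * emeasure lborel {x. c < g x}
          \<le> emeasure lborel {x. c < h x}"
      proof (rule brunn_minkowski_real)
        show "{x. c < f x} \<noteq> {}" "{x. c < g x} \<noteq> {}" using sup 3 by auto
        show "convex {x. c < h x}" using lc 3 by (intro log_concave_superlevel_convex)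
        fix a b assume ab: "a \<in> {x. c < f x}" "b \<in> {x. c < g x}"
        have "c = c powr (1 - t) * c powr t" using 3 by (simp add: powr_add[symmetric])
        also have "\<dots> < f a powr (1 - t) * g b powr t"
          using ab 3 t by (intro mult_strict_mono') (auto intro!: powr_less_mono2)
        also have "\<dots> \<le> h ((1 - t) * a + t * b)" by (rule fgh)
        finally show "(1 - t) * a + t * b \<in> {x. c < h x}" by simp
      qed (use t in auto)
      then show ?thesis using 3 by simp
    qed auto
  qed
  also have "\<dots> = (\<integral>\<^sup>+x. h x \<partial>lborel)" using h0 by (simp add: nn_integral_layer_cake)
  finally show ?thesis .
qed

lemma weighted_am_gm:
  fixes a b :: real
  assumes "0 < t" "t < 1" "0 \<le> a" "0 \<le> b"
  shows "a powr (1 - t) * b powr t \<le> (1 - t) * a + t * b"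
  using Youngs_inequality_0[of "1 - t" t a b] assms by (cases "a = 0 \<or> b = 0") auto

text \<open>
  Dividing \<open>f\<close> and \<open>g\<close> by their suprema, and \<open>h\<close> by the corresponding weighted geometric mean, reduces the
  claim to the normalised case; there even the weighted arithmetic mean is a lower bound.
\<close>

lemma prekopa_leindler:
  fixes f g h :: "real \<Rightarrow> real"
  assumes t: "0 < t" "t < 1"
    and int: "integrable lborel f" "integrable lborel g" "integrable lborel h"
    and nonneg: "\<And>x. 0 \<le> f x" "\<And>x. 0 \<le> g x" and lc: "log_concave h"
    and bdd: "\<And>x. f x \<le> C" "\<And>x. g x \<le> C"
    and fgh: "\<And>x y. f x powr (1 - t) * g y powr t \<le> h ((1 - t) * x + t * y)"
  shows "(\<integral>x. f x \<partial>lborel) powr (1 - t) * (\<integral>x. g x \<partial>lborel) powr t \<le> (\<integral>x. h x \<partial>lborel)"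
proof -
  have meas [measurable]: "f \<in> borel_measurable borel" "g \<in> borel_measurable borel" "h \<in> borel_measurable borel"
    using int[THEN borel_measurable_integrable] by auto
  have h0: "0 \<le> h x" for x using lc by (auto simp: log_concave_def)
  define a where "a = Sup (range f)"
  define b where "b = Sup (range g)"
  have bd: "bdd_above (range f)" "bdd_above (range g)" using bdd by (auto intro!: bdd_aboveI[where M = C])
  have fa: "f x \<le> a" and gb: "g x \<le> b" for x
    unfolding a_def b_def using bd by (auto intro: cSup_upper)
  have I: "0 \<le> (\<integral>x. h x \<partial>lborel)" using h0 by simp
  show ?thesis
  proof (cases "a \<le> 0 \<or> b \<le> 0")
    case True
    then have "f = (\<lambda>_. 0) \<or> g = (\<lambda>_. 0)"
      using fa gb nonneg by (metis dual_order.antisym order_trans ext)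
    then show ?thesis using I by auto
  next
    case False
    then have ab: "0 < a" "0 < b" by auto
    define m where "m = a powr (1 - t) * b powr t"
    have m: "0 < m" using ab by (simp add: m_def)
    define F where "F = (\<integral>x. f x \<partial>lborel)"
    define G where "G = (\<integral>x. g x \<partial>lborel)"
    define H where "H = (\<integral>x. h x \<partial>lborel)"
    have FGH: "0 \<le> F" "0 \<le> G" "0 \<le> H" unfolding F_def G_def H_def using nonneg h0 by auto
    have "ennreal (1 - t) * (\<integral>\<^sup>+x. f x / a \<partial>lborel) + ennreal t * (\<integral>\<^sup>+x. g x / b \<partial>lborel)
        \<le> (\<integral>\<^sup>+x. h x / m \<partial>lborel)"
    proof (rule prekopa_leindler_normalized)
      show "log_concave (\<lambda>x. h x / m)"
        unfolding log_concave_def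
      proof (intro conjI allI impI)
        fix x y u :: real assume u: "0 < u" "u < 1"
        have "m powr (1 - u) * m powr u = m" using m by (simp add: powr_add[symmetric])
        then have "(h x / m) powr (1 - u) * (h y / m) powr u = (h x powr (1 - u) * h y powr u) / m"
          using h0 m by (simp add: powr_divide)
        also have "\<dots> \<le> h ((1 - u) * x + u * y) / m"
          using lc u m by (intro divide_right_mono) (auto simp: log_concave_def)
        finally show "(h x / m) powr (1 - u) * (h y / m) powr u \<le> h ((1 - u) * x + u * y) / m" .
      qed (use h0 m in auto)
      fix c :: real assume "c < 1"
      then have "c * a < Sup (range f)" "c * b < Sup (range g)" using ab by (auto simp: a_def[symmetric] b_def[symmetric])
      then obtain x y where "c * a < f x" "c * b < g y"
        using bd by (auto simp: less_cSup_iff)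
      then show "\<exists>x. c < f x / a" "\<exists>x. c < g x / b"
        using ab by (auto simp: field_simps intro: exI[of _ x] exI[of _ y])
    next
      fix x y
      have "(f x / a) powr (1 - t) * (g y / b) powr t = (f x powr (1 - t) * g y powr t) / m"
        using nonneg ab by (simp add: powr_divide m_def)
      also have "\<dots> \<le> h ((1 - t) * x + t * y) / m" using fgh m by (intro divide_right_mono) auto
      finally show "(f x / a) powr (1 - t) * (g y / b) powr t \<le> h ((1 - t) * x + t * y) / m" .
    qed (use t ab fa gb nonneg in auto)
    also have "(\<integral>\<^sup>+x. f x / a \<partial>lborel) = ennreal (F / a)"
      unfolding F_def using int ab nonneg by (subst nn_integral_eq_integral) auto
    also have "(\<integral>\<^sup>+x. g x / b \<partial>lborel) = ennreal (G / b)"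
      unfolding G_def using int ab nonneg by (subst nn_integral_eq_integral) auto
    also have "(\<integral>\<^sup>+x. h x / m \<partial>lborel) = ennreal (H / m)"
      unfolding H_def using int m h0 by (subst nn_integral_eq_integral) auto
    finally have "ennreal ((1 - t) * (F / a) + t * (G / b)) \<le> ennreal (H / m)"
      using t ab FGH
      by (simp add: ennreal_mult'[symmetric] ennreal_plus[symmetric] del: ennreal_plus times_divide_eq_right)
    then have "(1 - t) * (F / a) + t * (G / b) \<le> H / m"
      using FGH m by (simp add: ennreal_le_iff)
    moreover have "(F / a) powr (1 - t) * (G / b) powr t \<le> (1 - t) * (F / a) + t * (G / b)"
      using t ab FGH by (intro weighted_am_gm) auto
    moreover have "(F / a) powr (1 - t) * (G / b) powr t = (F powr (1 - t) * G powr t) / m"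
      using ab FGH by (simp add: powr_divide m_def)
    ultimately have "(F powr (1 - t) * G powr t) / m \<le> H / m" by linarith
    then show ?thesis using m by (simp add: F_def G_def H_def divide_le_cancel)
  qed
qed

lemma log_concave_std_normal_density: "log_concave std_normal_density"
  unfolding log_concave_def
proof (intro conjI allI impI)
  fix x y t :: real assume t: "0 < t" "t < 1"
  define c where "c = 1 / sqrt (2 * pi)"
  have c: "0 < c" by (simp add: c_def)
  have \<phi>: "std_normal_density z = c * exp (- z\<^sup>2 / 2)" for z
    by (simp add: std_normal_density_def c_def)
  have "std_normal_density x powr (1 - t) * std_normal_density y powr t
      = (c powr (1 - t) * c powr t) * exp ((1 - t) * (- x\<^sup>2 / 2) + t * (- y\<^sup>2 / 2))"
    unfolding \<phi> using c by (simp only: powr_mult exp_powr_real exp_add) (simp add: mult_ac)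
  also have "c powr (1 - t) * c powr t = c" using c by (simp add: powr_add[symmetric])
  also have "c * exp ((1 - t) * (- x\<^sup>2 / 2) + t * (- y\<^sup>2 / 2)) \<le> c * exp (- ((1 - t) * x + t * y)\<^sup>2 / 2)"
  proof -
    have "(1 - t) * x\<^sup>2 + t * y\<^sup>2 - ((1 - t) * x + t * y)\<^sup>2 = t * (1 - t) * (x - y)\<^sup>2"
      by (simp add: power2_eq_square algebra_simps)
    moreover have "0 \<le> t * (1 - t) * (x - y)\<^sup>2" using t by simp
    ultimately have "(1 - t) * (- x\<^sup>2 / 2) + t * (- y\<^sup>2 / 2) \<le> - ((1 - t) * x + t * y)\<^sup>2 / 2"
      by (simp add: field_simps)
    then show ?thesis using c by simp
  qed
  finally show "std_normal_density x powr (1 - t) * std_normal_density y powr t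
      \<le> std_normal_density ((1 - t) * x + t * y)"
    by (simp add: \<phi>)
qed simp

lemma std_normal_density_le: "std_normal_density x \<le> 1 / sqrt (2 * pi)"
  by (simp add: std_normal_density_def divide_right_mono)

lemma integrable_bounded_mult_std_normal:
  fixes f :: "real \<Rightarrow> real"
  assumes [measurable]: "f \<in> borel_measurable borel" and "\<And>x. \<bar>f x\<bar> \<le> B"
  shows "integrable lborel (\<lambda>x. f x * std_normal_density x)"
proof (rule Bochner_Integration.integrable_bound)
  show "integrable lborel (\<lambda>x. B * std_normal_density x)" by simp
  have "norm (f x * std_normal_density x) \<le> norm (B * std_normal_density x)" for x
    using assms(2)[of x] by (auto simp: abs_mult intro!: mult_right_mono)
  then show "AE x in lborel. norm (f x * std_normal_density x) \<le> norm (B * std_normal_density x)" by simp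
qed measurable

text \<open>
  The integrand is log-concave jointly in \<open>x\<close> and \<open>w\<close>: since \<open>x - q w\<close> is concave and \<open>\<Phi>\<close> is increasing and
  log-concave, \<open>\<Phi> (x - q w)\<close> is log-concave, and the Gaussian density is as well. The Prekopa-Leindler
  inequality says that integrating out \<open>w\<close> preserves this.
\<close>

lemma log_concave_gaussian_shift:
  fixes q :: "real \<Rightarrow> real"
  assumes \<Phi>: "mono \<Phi>" "log_concave \<Phi>" "\<And>x. \<Phi> x \<le> 1"
    and q: "convex_on UNIV q" "q \<in> borel_measurable borel"
  shows "log_concave (\<lambda>x. \<integral>w. \<Phi> (x - q w) * std_normal_density w \<partial>lborel)"
  unfolding log_concave_def
proof (intro conjI allI impI)
  have pos: "0 \<le> \<Phi> x" for x using \<Phi>(2) by (simp add: log_concave_def)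
  have [measurable]: "\<Phi> \<in> borel_measurable borel" "q \<in> borel_measurable borel"
    using \<Phi>(1) q(2) by (auto intro: borel_measurable_mono)
  have int: "integrable lborel (\<lambda>w. \<Phi> (x - q w) * std_normal_density w)" for x
    using \<Phi>(3) pos by (intro integrable_bounded_mult_std_normal[where B = 1]) auto
  have key: "(\<Phi> (x - q w) * std_normal_density w) powr (1 - t) * (\<Phi> (y - q v) * std_normal_density v) powr t
      \<le> \<Phi> ((1 - t) * x + t * y - q ((1 - t) * w + t * v)) * std_normal_density ((1 - t) * w + t * v)"
    if t: "0 < t" "t < 1" for x y w v t
  proof -
    have "(\<Phi> (x - q w) * std_normal_density w) powr (1 - t) * (\<Phi> (y - q v) * std_normal_density v) powr t
       = (\<Phi> (x - q w) powr (1 - t) * \<Phi> (y - q v) powr t) *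
         (std_normal_density w powr (1 - t) * std_normal_density v powr t)"
      using pos by (simp add: powr_mult mult_ac)
    also have "\<dots> \<le> \<Phi> ((1 - t) * (x - q w) + t * (y - q v)) * std_normal_density ((1 - t) * w + t * v)"
      using \<Phi>(2) log_concave_std_normal_density t pos by (intro mult_mono) (auto simp: log_concave_def)
    also have "q ((1 - t) * w + t * v) \<le> (1 - t) * q w + t * q v"
      using convex_onD[OF q(1), of t w v] t by simp
    then have "(1 - t) * (x - q w) + t * (y - q v) \<le> (1 - t) * x + t * y - q ((1 - t) * w + t * v)"
      by (simp add: algebra_simps)
    then have "\<Phi> ((1 - t) * (x - q w) + t * (y - q v)) * std_normal_density ((1 - t) * w + t * v) \<le>
        \<Phi> ((1 - t) * x + t * y - q ((1 - t) * w + t * v)) * std_normal_density ((1 - t) * w + t * v)"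
      using monoD[OF \<Phi>(1)] by (intro mult_right_mono) auto
    finally show ?thesis .
  qed
  fix x y t :: real assume t: "0 < t" "t < 1"
  have bd: "\<Phi> (x - q w) * std_normal_density w \<le> 1 / sqrt (2 * pi)" for x w
    using mult_mono[OF \<Phi>(3) std_normal_density_le] pos by simp
  show "(\<integral>w. \<Phi> (x - q w) * std_normal_density w \<partial>lborel) powr (1 - t) *
      (\<integral>w. \<Phi> (y - q w) * std_normal_density w \<partial>lborel) powr t
      \<le> (\<integral>w. \<Phi> ((1 - t) * x + t * y - q w) * std_normal_density w \<partial>lborel)"
  proof (rule prekopa_leindler[OF t int int int _ _ _ bd bd key[OF t]])
    let ?z = "(1 - t) * x + t * y"
    have "(1 - u) * ?z + u * ?z = ?z" for u :: real by (simp add: algebra_simps)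
    then show "log_concave (\<lambda>w. \<Phi> (?z - q w) * std_normal_density w)"
      using key[of _ ?z _ ?z] pos unfolding log_concave_def by simp
  qed (use pos in auto)
next
  fix x show "0 \<le> (\<integral>w. \<Phi> (x - q w) * std_normal_density w \<partial>lborel)"
    using \<Phi>(2) by (simp add: log_concave_def)
qed


section \<open>Integrating out one of two independent variables\<close>

text \<open>
  Fubini for the joint law, stated with both integrals over \<open>M\<close>. In the inner expectation the random
  variable \<open>X\<close> is frozen at a point, so that statements about the law of \<open>Y\<close> alone apply to it: this is how
  conditioning on \<open>X\<close> is expressed below.
\<close>

lemma (in prob_space) expectation_indep_iterated:
  fixes f :: "'b \<times> 'b \<Rightarrow> real"
  assumes ind: "indep_var L X R Y" and f [measurable]: "f \<in> borel_measurable (L \<Otimes>\<^sub>M R)"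
    and bdd: "\<And>z. \<bar>f z\<bar> \<le> B"
  shows "expectation (\<lambda>\<omega>. f (X \<omega>, Y \<omega>)) = expectation (\<lambda>\<omega>. expectation (\<lambda>\<omega>'. f (X \<omega>, Y \<omega>')))"
    and "integrable M (\<lambda>\<omega>. expectation (\<lambda>\<omega>'. f (X \<omega>, Y \<omega>')))"
proof -
  have [measurable]: "random_variable L X" "random_variable R Y"
    and eq: "distr M L X \<Otimes>\<^sub>M distr M R Y = distr M (L \<Otimes>\<^sub>M R) (\<lambda>x. (X x, Y x))"
    using ind by (auto simp: indep_var_distribution_eq)
  interpret X: prob_space "distr M L X" by (rule prob_space_distr) simp
  interpret Y: prob_space "distr M R Y" by (rule prob_space_distr) simp
  interpret XY: pair_prob_space "distr M L X" "distr M R Y" ..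
  have int: "integrable (distr M L X \<Otimes>\<^sub>M distr M R Y) f"
    using bdd by (intro XY.integrable_const_bound[where B = B]) auto
  have inner [measurable]: "(\<lambda>x. expectation (\<lambda>\<omega>'. f (x, Y \<omega>'))) \<in> borel_measurable L"
  proof -
    have "(\<lambda>x. \<integral>y. f (x, y) \<partial>distr M R Y) \<in> borel_measurable L" by measurable
    also have "?this \<longleftrightarrow> (\<lambda>x. expectation (\<lambda>\<omega>'. f (x, Y \<omega>'))) \<in> borel_measurable L"
      by (intro measurable_cong) (subst integral_distr; auto)
    finally show ?thesis .
  qed
  have "expectation (\<lambda>\<omega>. f (X \<omega>, Y \<omega>)) = (\<integral>z. f z \<partial>distr M (L \<Otimes>\<^sub>M R) (\<lambda>x. (X x, Y x)))"
    by (subst integral_distr) auto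
  also have "\<dots> = (\<integral>x. \<integral>y. f (x, y) \<partial>distr M R Y \<partial>distr M L X)"
    unfolding eq[symmetric] by (rule XY.integral_fst'[OF int, symmetric])
  also have "\<dots> = (\<integral>x. expectation (\<lambda>\<omega>'. f (x, Y \<omega>')) \<partial>distr M L X)"
    by (intro Bochner_Integration.integral_cong refl) (subst integral_distr; auto)
  also have "\<dots> = expectation (\<lambda>\<omega>. expectation (\<lambda>\<omega>'. f (X \<omega>, Y \<omega>')))"
    by (subst integral_distr) auto
  finally show "expectation (\<lambda>\<omega>. f (X \<omega>, Y \<omega>)) = expectation (\<lambda>\<omega>. expectation (\<lambda>\<omega>'. f (X \<omega>, Y \<omega>')))" .
  show "integrable M (\<lambda>\<omega>. expectation (\<lambda>\<omega>'. f (X \<omega>, Y \<omega>')))"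
  proof (rule integrable_const_bound[where B = B])
    have "\<bar>expectation (\<lambda>\<omega>'. f (X \<omega>, Y \<omega>'))\<bar> \<le> B" if [measurable]: "\<omega> \<in> space M" for \<omega>
    proof -
      have "X \<omega> \<in> space L" using that by (rule measurable_space[rotated]) measurable
      then have [measurable]: "(\<lambda>\<omega>'. f (X \<omega>, Y \<omega>')) \<in> borel_measurable M" by measurable
      have i: "integrable M (\<lambda>\<omega>'. f (X \<omega>, Y \<omega>'))" using bdd by (intro integrable_const_bound[where B = B]) auto
      have "\<bar>expectation (\<lambda>\<omega>'. f (X \<omega>, Y \<omega>'))\<bar> \<le> expectation (\<lambda>\<omega>'. \<bar>f (X \<omega>, Y \<omega>')\<bar>)"
        by (rule integral_abs_bound)
      also have "\<dots> \<le> expectation (\<lambda>_. B)" using i bdd by (intro integral_mono) auto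
      finally show ?thesis by (simp add: prob_space)
    qed
    then show "AE \<omega> in M. norm (expectation (\<lambda>\<omega>'. f (X \<omega>, Y \<omega>'))) \<le> B" by simp
  qed measurable
qed

lemma (in prob_space) prob_indep_iterated:
  assumes ind: "indep_var L X R Y" and P [measurable]: "Measurable.pred (L \<Otimes>\<^sub>M R) P"
  shows "prob {\<omega>\<in>space M. P (X \<omega>, Y \<omega>)} = expectation (\<lambda>\<omega>. prob {\<omega>'\<in>space M. P (X \<omega>, Y \<omega>')})"
proof -
  have [measurable]: "random_variable L X" "random_variable R Y"
    using ind by (auto simp: indep_var_distribution_eq)
  have "prob {\<omega>\<in>space M. P (X \<omega>, Y \<omega>)} = expectation (\<lambda>\<omega>. indicator {z. P z} (X \<omega>, Y \<omega>))"
    by (subst Bochner_Integration.integral_cong[OF refl, of _ _ "indicator {\<omega>\<in>space M. P (X \<omega>, Y \<omega>)}"])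
       (auto split: split_indicator)
  also have "\<dots> = expectation (\<lambda>\<omega>. expectation (\<lambda>\<omega>'. indicator {z. P z} (X \<omega>, Y \<omega>')))"
    by (rule expectation_indep_iterated(1)[OF ind, where B = 1]) (auto split: split_indicator)
  also have "\<dots> = expectation (\<lambda>\<omega>. prob {\<omega>'\<in>space M. P (X \<omega>, Y \<omega>')})"
  proof (intro Bochner_Integration.integral_cong refl)
    fix \<omega> assume [measurable]: "\<omega> \<in> space M"
    then have [measurable]: "X \<omega> \<in> space L" by (rule measurable_space[rotated]) measurable
    have "expectation (\<lambda>\<omega>'. indicator {z. P z} (X \<omega>, Y \<omega>'))
        = expectation (indicator {\<omega>'\<in>space M. P (X \<omega>, Y \<omega>')})"
      by (intro Bochner_Integration.integral_cong) (auto split: split_indicator)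
    also have "\<dots> = prob {\<omega>'\<in>space M. P (X \<omega>, Y \<omega>')}" by simp
    finally show "expectation (\<lambda>\<omega>'. indicator {z. P z} (X \<omega>, Y \<omega>')) = prob {\<omega>'\<in>space M. P (X \<omega>, Y \<omega>')}" .
  qed
  finally show ?thesis .
qed


section \<open>Distribution functions of convex functions of Gaussian variables\<close>

lemma (in prob_space) indep_var_sum_insert:
  fixes Z :: "'i \<Rightarrow> 'a \<Rightarrow> real"
  assumes I: "finite I" "i \<notin> I" and indep: "indep_vars (\<lambda>_. borel) Z (insert i I)"
    and q: "\<And>j. j \<in> I \<Longrightarrow> q j \<in> borel_measurable borel"
  shows "indep_var borel (Z i) borel (\<lambda>\<omega>. \<Sum>j\<in>I. q j (Z j \<omega>) :: real)"
proof -
  have "indep_var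
    borel ((\<lambda>f. f i) \<circ> (\<lambda>\<omega>. restrict (\<lambda>i. Z i \<omega>) {i}))
    borel ((\<lambda>f. \<Sum>j\<in>I. q j (f j)) \<circ> (\<lambda>\<omega>. restrict (\<lambda>i. Z i \<omega>) I))"
    using I q by (intro indep_var_compose[OF indep_var_restrict[OF indep]]) auto
  also have "((\<lambda>f. f i) \<circ> (\<lambda>\<omega>. restrict (\<lambda>i. Z i \<omega>) {i})) = Z i"
    by auto
  also have "((\<lambda>f. \<Sum>j\<in>I. q j (f j)) \<circ> (\<lambda>\<omega>. restrict (\<lambda>i. Z i \<omega>) I)) = (\<lambda>\<omega>. \<Sum>j\<in>I. q j (Z j \<omega>))"
    by (auto cong: rev_conj_cong)
  finally show ?thesis .
qed

text \<open>
  Adding a summand \<open>q i (Z i)\<close> turns the distribution function \<open>\<Phi>\<close> into the function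
  \<open>\<lambda>x. E \<Phi> (x - q i (Z i))\<close>, to which the previous lemma applies. The distribution function of the empty sum is
  the indicator of a half-line.
\<close>

lemma (in prob_space) log_concave_cdf_convex_sum:
  fixes Z :: "'i \<Rightarrow> 'a \<Rightarrow> real"
  assumes "finite I" "indep_vars (\<lambda>_. borel) Z I"
    and "\<And>i. i \<in> I \<Longrightarrow> distributed M lborel (Z i) std_normal_density"
    and "\<And>i. i \<in> I \<Longrightarrow> convex_on UNIV (q i)" "\<And>i. i \<in> I \<Longrightarrow> q i \<in> borel_measurable borel"
  shows "log_concave (\<lambda>x. prob {\<omega>\<in>space M. (\<Sum>i\<in>I. q i (Z i \<omega>) :: real) \<le> x})"
  using assms
proof (induction I rule: finite_induct)
  case empty
  have "prob {\<omega>\<in>space M. (\<Sum>i\<in>{}. q i (Z i \<omega>) :: real) \<le> x} = (if 0 \<le> x then 1 else 0)" for x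
    by (simp add: prob_space)
  then show ?case by (simp add: log_concave_def)
next
  case (insert i I)
  define \<Phi> where "\<Phi> x = prob {\<omega>\<in>space M. (\<Sum>i\<in>I. q i (Z i \<omega>)) \<le> x}" for x
  have [measurable]: "random_variable borel (Z j)" if "j \<in> insert i I" for j
    using insert.prems(1) that by (auto simp: indep_vars_def)
  have q [measurable]: "q j \<in> borel_measurable borel" if "j \<in> insert i I" for j
    using insert.prems(4) that by auto
  have S [measurable]: "(\<lambda>\<omega>. \<Sum>j\<in>I. q j (Z j \<omega>)) \<in> borel_measurable M" by measurable
  have lc: "log_concave \<Phi>"
    unfolding \<Phi>_def using insert.prems indep_vars_subset[OF insert.prems(1)]
    by (intro insert.IH) auto
  have mono: "mono \<Phi>"
    unfolding \<Phi>_def by (intro monoI finite_measure_mono) auto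
  have [measurable]: "\<Phi> \<in> borel_measurable borel" using mono by (rule borel_measurable_mono)
  have "prob {\<omega>\<in>space M. (\<Sum>j\<in>insert i I. q j (Z j \<omega>)) \<le> x} =
      (\<integral>w. \<Phi> (x - q i w) * std_normal_density w \<partial>lborel)" for x
  proof -
    have iv: "indep_var borel (Z i) borel (\<lambda>\<omega>. \<Sum>j\<in>I. q j (Z j \<omega>))"
      using insert q by (intro indep_var_sum_insert) auto
    have qi [measurable]: "q i \<in> borel_measurable borel" by (rule q) simp
    have "prob {\<omega>\<in>space M. (\<Sum>j\<in>insert i I. q j (Z j \<omega>)) \<le> x}
        = prob {\<omega>\<in>space M. (case (Z i \<omega>, \<Sum>j\<in>I. q j (Z j \<omega>)) of (z, s) \<Rightarrow> q i z + s \<le> x)}"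
      using insert.hyps by simp
    also have "\<dots> = expectation (\<lambda>\<omega>. prob {\<omega>'\<in>space M. (case (Z i \<omega>, \<Sum>j\<in>I. q j (Z j \<omega>')) of (z, s) \<Rightarrow> q i z + s \<le> x)})"
      by (rule prob_indep_iterated[OF iv]) measurable
    also have "\<dots> = expectation (\<lambda>\<omega>. \<Phi> (x - q i (Z i \<omega>)))"
      by (simp add: \<Phi>_def algebra_simps)
    also have "\<dots> = (\<integral>w. std_normal_density w * \<Phi> (x - q i w) \<partial>lborel)"
      using insert.prems(2)[of i] by (intro distributed_integral[symmetric]) auto
    finally show ?thesis by (simp add: mult.commute)
  qed
  then show ?case
    using log_concave_gaussian_shift[OF mono lc, of "q i"] insert.prems by (simp add: \<Phi>_def)
qed

section \<open>Points of an i.i.d. sample near its minimum\<close>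

text \<open>
  The left-hand side omits the smallest value, whose term is 1; with that term included, the sum does
  not depend on the order of the values.
\<close>

lemma sum_exp_order_stat:
  assumes "1 \<le> n"
  shows "(\<Sum>l=2..n. exp (- (c * (order_stat n x l - order_stat n x 1)))) =
    (\<Sum>i=1..n. exp (- (c * (x i - Min (x ` {1..n}))))) - 1"
proof -
  define xs where "xs = sort (map x [1..<Suc n])"
  define f where "f y = exp (- (c * (y - Min (x ` {1..n}))))" for y
  have len: "length xs = n" by (simp add: xs_def)
  have set: "set xs = x ` {1..n}" by (auto simp: xs_def)
  have ne: "xs \<noteq> []" using len assms by auto
  have "sorted xs" by (simp add: xs_def)
  then have "xs ! 0 = Min (set xs)"
    using ne by (intro Min_eqI[symmetric]) (auto simp: in_set_conv_nth sorted_nth_mono)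
  moreover have os: "order_stat n x l = xs ! (l - 1)" for l
    by (simp only: order_stat_def xs_def)
  ultimately have first: "order_stat n x 1 = Min (x ` {1..n})"
    by (simp add: set)
  have "(\<Sum>l=1..n. f (order_stat n x l)) = (\<Sum>l=0..<n. f (xs ! l))"
    by (rule sum.reindex_bij_witness[of _ Suc "\<lambda>l. l - 1"]) (auto simp: os)
  also have "\<dots> = sum_list (map f xs)"
    by (simp add: sum_list_sum_nth len)
  also have "\<dots> = sum_list (map f (map x [1..<Suc n]))"
    unfolding xs_def by (metis mset_map mset_sort sum_mset_sum_list)
  also have "\<dots> = (\<Sum>i=1..n. f (x i))"
    by (simp add: sum_list_distinct_conv_sum_set comp_def atLeastLessThanSuc_atLeastAtMost del: upt_Suc)
  finally have "(\<Sum>l=1..n. f (order_stat n x l)) = (\<Sum>i=1..n. f (x i))" .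
  moreover have "{1..n} = insert 1 {2..n}" using assms by auto
  then have "(\<Sum>l=1..n. f (order_stat n x l)) = f (order_stat n x 1) + (\<Sum>l=2..n. f (order_stat n x l))"
    by simp
  ultimately show ?thesis using first by (simp add: f_def)
qed

text \<open>
  Without ties, a point is at most the minimum of the others exactly if it is the minimum of the sample,
  and for all other points the minimum of the others is the minimum of the sample. The advantage of the
  right-hand side is that in every summand \<open>x i\<close> is compared with a quantity that does not involve \<open>x i\<close>.
\<close>

lemma sum_exp_gap_of_minimum:
  fixes x :: "'i \<Rightarrow> real"
  assumes I: "finite I" "2 \<le> card I" and inj: "inj_on x I"
  shows "(\<Sum>i\<in>I. exp (- (x i - Min (x ` I)))) - 1 =
      (\<Sum>i\<in>I. if Min (x ` (I - {i})) < x i then exp (- (x i - Min (x ` (I - {i})))) else 0)"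
    and "(\<Sum>i\<in>I. if x i \<le> Min (x ` (I - {i})) then 1 else 0 :: real) = 1"
proof -
  have "I \<noteq> {}" using I by auto
  then have "Min (x ` I) \<in> x ` I" using I by (intro Min_in) auto
  then obtain k where k: "k \<in> I" "x k = Min (x ` I)" by force
  have lt: "x k < x i" if "i \<in> I - {k}" for i
  proof -
    have "x k \<le> x i" using k(2) that I by simp
    moreover have "x k \<noteq> x i" using inj k(1) that by (auto simp: inj_on_def)
    ultimately show ?thesis by simp
  qed
  have ne: "I - {k} \<noteq> {}"
    using I k card_mono[of "{k}" I] by (auto dest!: subset_singletonD)
  have Mk: "x k < Min (x ` (I - {k}))"
    using I ne lt by (subst Min_gr_iff) auto
  have Mi: "Min (x ` (I - {i})) = x k" if "i \<in> I - {k}" for i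
  proof (rule Min_eqI)
    show "x k \<in> x ` (I - {i})" using k that by blast
    show "x k \<le> y" if "y \<in> x ` (I - {i})" for y
      using that I unfolding k(2) by auto
  qed (use I in auto)
  have split: "sum f I = f k + sum f (I - {k})" for f :: "'i \<Rightarrow> real"
    using I k by (intro sum.remove) auto
  show "(\<Sum>i\<in>I. exp (- (x i - Min (x ` I)))) - 1 =
      (\<Sum>i\<in>I. if Min (x ` (I - {i})) < x i then exp (- (x i - Min (x ` (I - {i})))) else 0)"
    unfolding split k(2)[symmetric] using Mk Mi lt by (auto intro!: sum.cong)
  have "(\<Sum>i\<in>I - {k}. if x i \<le> Min (x ` (I - {i})) then 1 else 0 :: real) = 0"
    using Mi lt by (intro sum.neutral) fastforce
  then show "(\<Sum>i\<in>I. if x i \<le> Min (x ` (I - {i})) then 1 else 0 :: real) = 1"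
    unfolding split using Mk by simp
qed

text \<open>
  If the minimum is attained once, this is the sum of \<open>exp (- gap)\<close> over the other points.
\<close>

definition softmin_excess :: "('i \<Rightarrow> real) \<Rightarrow> 'i set \<Rightarrow> real" where
  "softmin_excess x I = (\<Sum>i\<in>I. exp (- (x i - Min (x ` I)))) - 1"

text \<open>
  The expected contribution to the excess of a sample point of law \<open>\<nu>\<close> when the minimum of the other points
  is \<open>m\<close>.
\<close>

definition exceedance :: "real measure \<Rightarrow> real \<Rightarrow> real" where
  "exceedance \<nu> m = (\<integral>x. (if m < x then exp (- (x - m)) else 0) \<partial>\<nu>)"

locale iid_sample = prob_space M for M :: "'a measure" +
  fixes X :: "'i \<Rightarrow> 'a \<Rightarrow> real" and I :: "'i set" and \<nu> :: "real measure"
  assumes finI: "finite I" and card2: "2 \<le> card I"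
    and indep: "indep_vars (\<lambda>_. borel) X I"
    and law: "\<And>i. i \<in> I \<Longrightarrow> distr M borel (X i) = \<nu>"
    and no_atoms: "\<And>x. measure \<nu> {x} = 0"
begin

definition other_min :: "'i \<Rightarrow> 'a \<Rightarrow> real" where
  "other_min i \<omega> = Min ((\<lambda>k. X k \<omega>) ` (I - {i}))"

abbreviation excess :: "'a \<Rightarrow> real" where
  "excess \<equiv> \<lambda>\<omega>. softmin_excess (\<lambda>i. X i \<omega>) I"

lemma rvX [measurable]: "i \<in> I \<Longrightarrow> random_variable borel (X i)"
  using indep by (auto simp: indep_vars_def)

lemma I_ne: "I \<noteq> {}" using card2 by auto

lemma sets_law [measurable_cong]: "sets \<nu> = sets borel"
  using law I_ne by (metis ex_in_conv sets_distr)

lemma prob_space_law: "prob_space \<nu>"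
  using law I_ne rvX prob_space_distr by (metis ex_in_conv)

lemma others_ne: "i \<in> I \<Longrightarrow> I - {i} \<noteq> {}"
  using finI card2 by (auto dest!: subset_singletonD)

lemma rv_other_min [measurable]: "i \<in> I \<Longrightarrow> random_variable borel (other_min i)"
  unfolding other_min_def using finI by (intro borel_measurable_Min) auto

lemma indep_other_min:
  assumes "i \<in> I"
  shows "indep_var borel (other_min i) borel (X i)"
proof -
  have "indep_var borel ((\<lambda>f. Min (f ` (I - {i}))) \<circ> (\<lambda>\<omega>. restrict (\<lambda>i. X i \<omega>) (I - {i})))
      borel ((\<lambda>f. f i) \<circ> (\<lambda>\<omega>. restrict (\<lambda>i. X i \<omega>) {i}))"
    using assms finI by (intro indep_var_compose[OF indep_var_restrict[OF indep]]) auto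
  then show ?thesis by (simp add: comp_def other_min_def[abs_def])
qed

lemma indep_pair:
  assumes "i \<in> I" "k \<in> I" "i \<noteq> k"
  shows "indep_var borel (X i) borel (X k)"
proof -
  have "indep_var borel ((\<lambda>f. f i) \<circ> (\<lambda>\<omega>. restrict (\<lambda>i. X i \<omega>) {i}))
      borel ((\<lambda>f. f k) \<circ> (\<lambda>\<omega>. restrict (\<lambda>i. X i \<omega>) {k}))"
    using assms by (intro indep_var_compose[OF indep_var_restrict[OF indep]]) auto
  then show ?thesis by (simp add: comp_def)
qed

lemma expectation_law:
  fixes f :: "real \<Rightarrow> real"
  assumes "i \<in> I" "f \<in> borel_measurable borel"
  shows "expectation (\<lambda>\<omega>. f (X i \<omega>)) = (\<integral>x. f x \<partial>\<nu>)"
  using assms law[OF assms(1)] by (subst integral_distr[symmetric, of "X i" M borel f]) auto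

lemma prob_law:
  assumes "i \<in> I" and [measurable]: "A \<in> sets borel"
  shows "prob {\<omega>\<in>space M. X i \<omega> \<in> A} = measure \<nu> A"
proof -
  have [measurable]: "random_variable borel (X i)" using assms by simp
  show ?thesis unfolding law[OF assms(1), symmetric]
    by (subst measure_distr) (auto intro!: arg_cong[where f = prob])
qed

lemma AE_no_ties: "AE \<omega> in M. inj_on (\<lambda>i. X i \<omega>) I"
proof -
  have "AE \<omega> in M. X i \<omega> \<noteq> X k \<omega>" if ik: "i \<in> I" "k \<in> I" "i \<noteq> k" for i k
  proof -
    have [measurable]: "random_variable borel (X i)" "random_variable borel (X k)" using ik by auto
    have iv: "indep_var borel (X i) borel (X k)"
      using ik by (rule indep_pair)
    have "prob {\<omega>\<in>space M. fst (X i \<omega>, X k \<omega>) = snd (X i \<omega>, X k \<omega>)}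
        = expectation (\<lambda>\<omega>. prob {\<omega>'\<in>space M. fst (X i \<omega>, X k \<omega>') = snd (X i \<omega>, X k \<omega>')})"
      by (rule prob_indep_iterated[OF iv]) measurable
    also have "\<dots> = expectation (\<lambda>\<omega>. measure \<nu> {X i \<omega>})"
      using prob_law[OF ik(2)] by (intro Bochner_Integration.integral_cong) (auto simp: eq_commute)
    finally have "prob {\<omega>\<in>space M. X i \<omega> = X k \<omega>} = 0" by (simp add: no_atoms)
    then show ?thesis by (subst (asm) prob_eq_0) (auto simp: AE_conj_iff)
  qed
  then have "AE \<omega> in M. \<forall>i\<in>I. \<forall>k\<in>I. i \<noteq> k \<longrightarrow> X i \<omega> \<noteq> X k \<omega>"
    using finI by (intro AE_finite_allI) auto
  then show ?thesis by eventually_elim (auto simp: inj_on_def)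
qed

lemma expectation_softmin_excess:
  "expectation excess = (\<Sum>i\<in>I. expectation (\<lambda>\<omega>. exceedance \<nu> (other_min i \<omega>)))"
proof -
  let ?f = "\<lambda>(x, m). if m < x then exp (- (x - m)) else 0 :: real"
  have bd: "\<bar>?f z\<bar> \<le> 1" for z :: "real \<times> real" by (auto split: prod.split)
  have f [measurable]: "?f \<in> borel_measurable (borel \<Otimes>\<^sub>M borel)" by measurable
  have [measurable]: "excess \<in> borel_measurable M"
    unfolding softmin_excess_def using finI by (intro borel_measurable_diff borel_measurable_sum borel_measurable_exp borel_measurable_uminus borel_measurable_Min) auto
  have meas: "(\<lambda>\<omega>. ?f (X i \<omega>, other_min i \<omega>)) \<in> borel_measurable M" if "i \<in> I" for i
    using that by measurable
  have "expectation excess = expectation (\<lambda>\<omega>. \<Sum>i\<in>I. ?f (X i \<omega>, other_min i \<omega>))"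
  proof (rule integral_cong_AE)
    show "AE \<omega> in M. excess \<omega> = (\<Sum>i\<in>I. ?f (X i \<omega>, other_min i \<omega>))"
      using AE_no_ties
      by eventually_elim
        (use sum_exp_gap_of_minimum(1)[OF finI card2] in \<open>simp add: softmin_excess_def other_min_def\<close>)
    show "(\<lambda>\<omega>. \<Sum>i\<in>I. ?f (X i \<omega>, other_min i \<omega>)) \<in> borel_measurable M"
      using meas by (rule borel_measurable_sum)
  qed simp
  also have "\<dots> = (\<Sum>i\<in>I. expectation (\<lambda>\<omega>. ?f (X i \<omega>, other_min i \<omega>)))"
    using meas bd by (intro Bochner_Integration.integral_sum integrable_const_bound[where B = 1]) auto
  also have "\<dots> = (\<Sum>i\<in>I. expectation (\<lambda>\<omega>. exceedance \<nu> (other_min i \<omega>)))"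
  proof (rule sum.cong)
    fix i assume i: "i \<in> I"
    let ?g = "\<lambda>z. ?f (snd z, fst z)"
    note iv = indep_other_min[OF i]
    have "expectation (\<lambda>\<omega>. ?g (other_min i \<omega>, X i \<omega>)) =
        expectation (\<lambda>\<omega>. expectation (\<lambda>\<omega>'. ?g (other_min i \<omega>, X i \<omega>')))"
      by (rule expectation_indep_iterated(1)[OF iv, where B = 1]) (use bd in auto)
    also have "\<dots> = expectation (\<lambda>\<omega>. exceedance \<nu> (other_min i \<omega>))"
      unfolding exceedance_def using i
      by (intro Bochner_Integration.integral_cong refl) (subst expectation_law[of i]; simp)
    finally show "expectation (\<lambda>\<omega>. ?f (X i \<omega>, other_min i \<omega>)) = expectation (\<lambda>\<omega>. exceedance \<nu> (other_min i \<omega>))" by simp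
  qed simp
  finally show ?thesis .
qed

text \<open>
  The \<open>i\<close>-th expectation is the probability that the \<open>i\<close>-th point is the minimum, and almost surely exactly
  one point is.
\<close>

lemma sum_expectation_cdf_other_min:
  "(\<Sum>i\<in>I. expectation (\<lambda>\<omega>. cdf \<nu> (other_min i \<omega>))) = 1"
proof -
  have "expectation (\<lambda>\<omega>. cdf \<nu> (other_min i \<omega>)) = prob {\<omega>\<in>space M. X i \<omega> \<le> other_min i \<omega>}" if i: "i \<in> I" for i
  proof -
    have "prob {\<omega>\<in>space M. (case (other_min i \<omega>, X i \<omega>) of (m, x) \<Rightarrow> x \<le> m)}
        = expectation (\<lambda>\<omega>. prob {\<omega>'\<in>space M. (case (other_min i \<omega>, X i \<omega>') of (m, x) \<Rightarrow> x \<le> m)})"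
      by (rule prob_indep_iterated[OF indep_other_min[OF i]]) measurable
    also have "\<dots> = expectation (\<lambda>\<omega>. cdf \<nu> (other_min i \<omega>))"
      using prob_law[OF i, of "{..other_min i \<omega>}" for \<omega>] by (simp add: cdf_def)
    finally show ?thesis by simp
  qed
  then have "(\<Sum>i\<in>I. expectation (\<lambda>\<omega>. cdf \<nu> (other_min i \<omega>)))
      = (\<Sum>i\<in>I. expectation (indicator {\<omega>\<in>space M. X i \<omega> \<le> other_min i \<omega>}))"
    by (intro sum.cong) auto
  also have "\<dots> = expectation (\<lambda>\<omega>. \<Sum>i\<in>I. indicator {\<omega>\<in>space M. X i \<omega> \<le> other_min i \<omega>} \<omega>)"
    by (intro Bochner_Integration.integral_sum[symmetric] integrable_real_indicator) (auto simp: emeasure_eq_measure)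
  also have "\<dots> = expectation (\<lambda>_. 1)"
  proof (rule integral_cong_AE)
    show "AE \<omega> in M. (\<Sum>i\<in>I. indicator {\<omega>\<in>space M. X i \<omega> \<le> other_min i \<omega>} \<omega>) = (1::real)"
      using AE_no_ties AE_space
    proof eventually_elim
      case (elim \<omega>)
      have "(\<Sum>i\<in>I. indicator {\<omega>\<in>space M. X i \<omega> \<le> other_min i \<omega>} \<omega>)
          = (\<Sum>i\<in>I. if X i \<omega> \<le> Min ((\<lambda>i. X i \<omega>) ` (I - {i})) then 1 else 0 :: real)"
        using elim by (intro sum.cong) (auto simp: other_min_def)
      then show ?case using sum_exp_gap_of_minimum(2)[OF finI card2 elim(1)] by simp
    qed
  qed auto
  finally show ?thesis by (simp add: prob_space)
qed

lemma prob_other_min_less: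
  assumes "i \<in> I"
  shows "prob {\<omega>\<in>space M. other_min i \<omega> < m} \<le> real (card I) * cdf \<nu> m"
proof -
  have "prob {\<omega>\<in>space M. other_min i \<omega> < m} \<le> prob (\<Union>k\<in>I - {i}. {\<omega>\<in>space M. X k \<omega> \<in> {..m}})"
    using finI others_ne[OF assms] unfolding other_min_def
    by (intro finite_measure_mono) (auto simp: Min_less_iff less_imp_le)
  also have "\<dots> \<le> (\<Sum>k\<in>I - {i}. prob {\<omega>\<in>space M. X k \<omega> \<in> {..m}})"
    using finI by (intro finite_measure_subadditive_finite) auto
  also have "\<dots> = (\<Sum>k\<in>I - {i}. cdf \<nu> m)"
    using prob_law[of _ "{..m}"] by (intro sum.cong) (auto simp: cdf_def)
  also have "\<dots> = real (card (I - {i})) * cdf \<nu> m" by simp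
  also have "\<dots> \<le> real (card I) * cdf \<nu> m"
    using finI by (intro mult_right_mono) (auto simp: cdf_def intro!: card_mono)
  finally show ?thesis .
qed

lemma prob_other_min_greater:
  assumes i: "i \<in> I"
  shows "prob {\<omega>\<in>space M. m < other_min i \<omega>} = (1 - cdf \<nu> m) ^ (card I - 1)"
proof -
  interpret \<nu>: prob_space \<nu> by (rule prob_space_law)
  have sp: "space \<nu> = UNIV" using sets_eq_imp_space_eq[OF sets_law] by simp
  have "measure \<nu> {m<..} = 1 - cdf \<nu> m"
    unfolding cdf_def using \<nu>.prob_compl[of "{..m}"] by (simp add: sp Compl_eq_Diff_UNIV[symmetric])
  moreover have "prob {\<omega>\<in>space M. m < other_min i \<omega>} = prob (\<Inter>k\<in>I - {i}. X k -` {m<..} \<inter> space M)"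
    using finI others_ne[OF i] unfolding other_min_def
    by (intro arg_cong[where f = prob]) (auto simp: Min_gr_iff)
  moreover have "\<dots> = (\<Prod>k\<in>I - {i}. prob (X k -` {m<..} \<inter> space M))"
    using finI by (intro indep_varsD[OF indep_vars_subset[OF indep] others_ne[OF i]]) auto
  moreover have "\<dots> = (\<Prod>k\<in>I - {i}. measure \<nu> {m<..})"
    using prob_law[of _ "{m<..}"] by (intro prod.cong) (auto simp: vimage_def Int_def conj_commute)
  ultimately show ?thesis using finI i by simp
qed

lemma exceedance_measurable [measurable]: "exceedance \<nu> \<in> borel_measurable borel"
proof -
  interpret \<nu>: prob_space \<nu> by (rule prob_space_law)
  show ?thesis unfolding exceedance_def by measurable
qed

lemma exceedance_bounds: "0 \<le> exceedance \<nu> m" "exceedance \<nu> m \<le> 1"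
proof -
  interpret \<nu>: prob_space \<nu> by (rule prob_space_law)
  show "0 \<le> exceedance \<nu> m" unfolding exceedance_def by (intro Bochner_Integration.integral_nonneg) auto
  have "exceedance \<nu> m \<le> (\<integral>x. 1 \<partial>\<nu>)" unfolding exceedance_def
    by (intro integral_mono \<nu>.integrable_const_bound[where B = 1]) auto
  then show "exceedance \<nu> m \<le> 1" by (simp add: \<nu>.prob_space)
qed

lemma cdf_measurable [measurable]: "cdf \<nu> \<in> borel_measurable borel"
proof -
  interpret \<nu>: prob_space \<nu> by (rule prob_space_law)
  interpret real_distribution \<nu> by standard (simp_all add: sets_law)
  show ?thesis by (intro borel_measurable_mono monoI cdf_nondecreasing)
qed

lemma cdf_range: "0 \<le> cdf \<nu> m" "cdf \<nu> m \<le> 1"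
  using prob_space.prob_le_1[OF prob_space_law] by (simp_all add: cdf_def)

lemma integrable_other_min:
  fixes f :: "real \<Rightarrow> real"
  assumes "i \<in> I" "f \<in> borel_measurable borel" "\<And>m. 0 \<le> f m" "\<And>m. f m \<le> B"
  shows "integrable M (\<lambda>\<omega>. f (other_min i \<omega>))"
  using assms by (intro integrable_const_bound[where B = B]) auto

lemma integrable_exceedance_other_min: "i \<in> I \<Longrightarrow> integrable M (\<lambda>\<omega>. exceedance \<nu> (other_min i \<omega>))"
  using exceedance_bounds by (intro integrable_other_min[where B = 1]) auto

lemma integrable_cdf_other_min: "i \<in> I \<Longrightarrow> integrable M (\<lambda>\<omega>. cdf \<nu> (other_min i \<omega>))"
  using cdf_range by (intro integrable_other_min[where B = 1]) auto

lemma expectation_indicator_other_min: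
  assumes "i \<in> I" and [measurable]: "A \<in> sets borel"
  shows "integrable M (\<lambda>\<omega>. indicator A (other_min i \<omega>) :: real)"
    and "expectation (\<lambda>\<omega>. indicator A (other_min i \<omega>)) = prob {\<omega>\<in>space M. other_min i \<omega> \<in> A}"
proof -
  have [measurable]: "random_variable borel (other_min i)" using assms by simp
  show "integrable M (\<lambda>\<omega>. indicator A (other_min i \<omega>) :: real)"
    using assms by (intro integrable_other_min[where B = 1]) (auto split: split_indicator)
  show "expectation (\<lambda>\<omega>. indicator A (other_min i \<omega>)) = prob {\<omega>\<in>space M. other_min i \<omega> \<in> A}"
    by (subst Bochner_Integration.integral_cong[OF refl, of _ _ "indicator {\<omega>\<in>space M. other_min i \<omega> \<in> A}"])
       (auto split: split_indicator)
qed

text \<open>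
  The main term comes from the proportionality of \<open>exceedance\<close> and \<open>cdf\<close> in the bulk. The indicators allow for
  weaker bounds to the left of thresholds which the minimum passes only with small probability.
\<close>

lemma expectation_softmin_excess_le:
  assumes "0 \<le> b"
    and le: "\<And>m. exceedance \<nu> m \<le> r * cdf \<nu> m + b * indicator {..<v} m + indicator {..<w} m"
  shows "expectation excess \<le> r + (real (card I))\<^sup>2 * b * cdf \<nu> v + (real (card I))\<^sup>2 * cdf \<nu> w"
proof -
  let ?n = "real (card I)"
  have "expectation (\<lambda>\<omega>. exceedance \<nu> (other_min i \<omega>)) \<le>
      r * expectation (\<lambda>\<omega>. cdf \<nu> (other_min i \<omega>)) + (b * (?n * cdf \<nu> v) + ?n * cdf \<nu> w)" if i: "i \<in> I" for i
  proof -
    note ints = integrable_exceedance_other_min[OF i] integrable_cdf_other_min[OF i]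
      expectation_indicator_other_min(1)[OF i]
    have "expectation (\<lambda>\<omega>. exceedance \<nu> (other_min i \<omega>)) \<le>
      expectation (\<lambda>\<omega>. r * cdf \<nu> (other_min i \<omega>) + b * indicator {..<v} (other_min i \<omega>)
        + indicator {..<w} (other_min i \<omega>))"
      using le ints by (intro integral_mono) auto
    also have "\<dots> = r * expectation (\<lambda>\<omega>. cdf \<nu> (other_min i \<omega>)) +
        b * prob {\<omega>\<in>space M. other_min i \<omega> \<in> {..<v}} + prob {\<omega>\<in>space M. other_min i \<omega> \<in> {..<w}}"
      using ints by (simp add: expectation_indicator_other_min(2)[OF i])
    also have "\<dots> \<le> r * expectation (\<lambda>\<omega>. cdf \<nu> (other_min i \<omega>)) + b * (?n * cdf \<nu> v) + ?n * cdf \<nu> w"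
      using prob_other_min_less[OF i] \<open>0 \<le> b\<close> by (intro add_mono order_refl mult_left_mono) auto
    finally show ?thesis by simp
  qed
  then have "expectation excess \<le>
     (\<Sum>i\<in>I. r * expectation (\<lambda>\<omega>. cdf \<nu> (other_min i \<omega>)) + (b * (?n * cdf \<nu> v) + ?n * cdf \<nu> w))"
    unfolding expectation_softmin_excess by (rule sum_mono)
  also have "\<dots> = r + ?n * (b * (?n * cdf \<nu> v) + ?n * cdf \<nu> w)"
    by (simp add: sum.distrib sum_distrib_left[symmetric] sum_expectation_cdf_other_min)
  finally show ?thesis by (simp add: power2_eq_square algebra_simps)
qed

text \<open>
  The typical positions of the minimum of the others are to the left of \<open>u\<close>. The event that all points other than a given one are
  to the right of \<open>u\<close> is so rare that bounding the distribution function by 1 on it is good enough.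
\<close>

lemma expectation_softmin_excess_ge:
  assumes "0 \<le> r"
    and ge: "\<And>m. m \<le> u \<Longrightarrow> r * cdf \<nu> m \<le> exceedance \<nu> m"
  shows "r * (1 - real (card I) * (1 - cdf \<nu> u) ^ (card I - 1)) \<le> expectation excess"
proof -
  let ?n = "real (card I)"
  have *: "r * (cdf \<nu> m - indicator {u<..} m) \<le> exceedance \<nu> m" for m
  proof (cases "m \<le> u")
    case False
    have "r * (cdf \<nu> m - 1) \<le> 0" using assms(1) cdf_range(2)[of m] by (simp add: mult_nonneg_nonpos)
    then show ?thesis using False exceedance_bounds(1)[of m] by simp
  qed (use ge in auto)
  have "r * (expectation (\<lambda>\<omega>. cdf \<nu> (other_min i \<omega>)) - (1 - cdf \<nu> u) ^ (card I - 1))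
      \<le> expectation (\<lambda>\<omega>. exceedance \<nu> (other_min i \<omega>))" if i: "i \<in> I" for i
  proof -
    note ints = integrable_exceedance_other_min[OF i] integrable_cdf_other_min[OF i]
      expectation_indicator_other_min(1)[OF i]
    have "r * (expectation (\<lambda>\<omega>. cdf \<nu> (other_min i \<omega>)) - (1 - cdf \<nu> u) ^ (card I - 1))
        = expectation (\<lambda>\<omega>. r * (cdf \<nu> (other_min i \<omega>) - indicator {u<..} (other_min i \<omega>)))"
      using ints prob_other_min_greater[OF i, of u] by (simp add: expectation_indicator_other_min(2)[OF i])
    also have "\<dots> \<le> expectation (\<lambda>\<omega>. exceedance \<nu> (other_min i \<omega>))"
      using * ints by (intro integral_mono) auto
    finally show ?thesis .
  qed
  then have "(\<Sum>i\<in>I. r * (expectation (\<lambda>\<omega>. cdf \<nu> (other_min i \<omega>)) - (1 - cdf \<nu> u) ^ (card I - 1)))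
      \<le> expectation excess"
    unfolding expectation_softmin_excess by (rule sum_mono)
  also have "(\<Sum>i\<in>I. r * (expectation (\<lambda>\<omega>. cdf \<nu> (other_min i \<omega>)) - (1 - cdf \<nu> u) ^ (card I - 1)))
      = r * (1 - ?n * (1 - cdf \<nu> u) ^ (card I - 1))"
    by (simp add: sum_distrib_left[symmetric] sum_subtractf sum_expectation_cdf_other_min)
  finally show ?thesis .
qed

end

section \<open>Exceedances for log-concave distribution functions\<close>

lemma log_concave_three_points:
  assumes F: "log_concave F" "0 < F x" "0 < F z" and "x < y" "y < z"
  shows "(z - y) * ln (F x) + (y - x) * ln (F z) \<le> (z - x) * ln (F y)" "0 < F y"
proof -
  define t where "t = (y - x) / (z - x)"
  have t: "0 < t" "t < 1" using assms by (auto simp: t_def field_simps)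
  have tz: "t * (z - x) = y - x" using assms by (simp add: t_def)
  then have y: "(1 - t) * x + t * z = y" by (simp add: algebra_simps)
  have le: "F x powr (1 - t) * F z powr t \<le> F y"
    using F(1) t y unfolding log_concave_def by metis
  have pos: "0 < F x powr (1 - t) * F z powr t" using F by simp
  then show Fy: "0 < F y" using le by linarith
  have "ln (F x powr (1 - t) * F z powr t) \<le> ln (F y)" using le pos Fy by simp
  then have "(1 - t) * ln (F x) + t * ln (F z) \<le> ln (F y)"
    using F by (simp add: ln_mult ln_powr)
  then have "(z - x) * ((1 - t) * ln (F x) + t * ln (F z)) \<le> (z - x) * ln (F y)"
    using assms by (intro mult_left_mono) auto
  moreover have "(z - x) * ((1 - t) * ln (F x) + t * ln (F z))
      = (z - x - t * (z - x)) * ln (F x) + (t * (z - x)) * ln (F z)" by (simp add: algebra_simps)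
  ultimately show "(z - y) * ln (F x) + (y - x) * ln (F z) \<le> (z - x) * ln (F y)"
    unfolding tz by simp
qed

text \<open>
  \<open>ln F\<close> is concave where it is defined, and by monotonicity it is defined to the right of any point where
  \<open>F\<close> is positive.
\<close>

lemma log_concave_slope_antimono:
  assumes F: "log_concave F" "mono F" "0 < F x" and "x < y" "y \<le> m" "m < z"
  shows "(ln (F z) - ln (F m)) / (z - m) \<le> (ln (F y) - ln (F x)) / (y - x)"
proof -
  have pos: "0 < F w" if "x \<le> w" for w using F(3) monoD[OF F(2) that] by linarith
  \<comment> \<open>Comparison of adjacent chords; the general case follows by chaining two of them.\<close>
  have adj: "(ln (F c) - ln (F b)) / (c - b) \<le> (ln (F b) - ln (F a)) / (b - a)"
    if "x \<le> a" "a < b" "b < c" for a b c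
    using log_concave_three_points(1)[of F a c b] F(1) pos[of a] pos[of c] that
    by (simp add: divide_simps) (simp add: algebra_simps)
  show ?thesis
  proof (cases "y = m")
    case False
    then show ?thesis using adj[of x y m] adj[of y m z] assms by auto
  qed (use adj[of x y z] assms in auto)
qed

lemma log_concave_growth_le:
  assumes F: "log_concave F" "mono F" "0 < F x" and "x < y" "y \<le> m" "0 \<le> u"
  shows "F (m + u) \<le> F m * exp ((ln (F y) - ln (F x)) / (y - x) * u)"
proof (cases "u = 0")
  case False
  have pos: "0 < F w" if "x \<le> w" for w using F(3) monoD[OF F(2) that] by linarith
  have "(ln (F (m + u)) - ln (F m)) / u \<le> (ln (F y) - ln (F x)) / (y - x)"
    using log_concave_slope_antimono[OF F assms(4,5), of "m + u"] assms False by simp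
  then have "ln (F (m + u)) - ln (F m) \<le> (ln (F y) - ln (F x)) / (y - x) * u"
    using False assms by (simp add: pos_divide_le_eq)
  then have "exp (ln (F (m + u))) \<le> exp (ln (F m) + (ln (F y) - ln (F x)) / (y - x) * u)" by simp
  then show ?thesis using pos[of m] pos[of "m + u"] assms by (simp add: exp_add)
qed simp

lemma log_concave_growth_ge:
  assumes F: "log_concave F" "mono F" "\<And>x. 0 \<le> F x" and "m + u \<le> y" "y < z" "0 \<le> u"
  shows "F m * exp ((ln (F z) - ln (F y)) / (z - y) * u) \<le> F (m + u)"
proof (cases "u = 0 \<or> F m = 0")
  case False
  then have u: "0 < u" and "0 < F m" using F(3)[of m] assms by (auto simp: less_le)
  then have pos: "0 < F w" if "m \<le> w" for w using monoD[OF F(2) that] by linarith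
  have "(ln (F z) - ln (F y)) / (z - y) \<le> (ln (F (m + u)) - ln (F m)) / u"
    using log_concave_slope_antimono[OF F(1,2) \<open>0 < F m\<close>, of "m + u" y z] assms u by simp
  then have "(ln (F z) - ln (F y)) / (z - y) * u \<le> ln (F (m + u)) - ln (F m)"
    using u by (simp add: pos_le_divide_eq)
  then have "exp (ln (F m) + (ln (F z) - ln (F y)) / (z - y) * u) \<le> exp (ln (F (m + u)))" by simp
  then show ?thesis using pos[of m] pos[of "m + u"] u by (simp add: exp_add)
qed (use F(3) in auto)

context real_distribution
begin

text \<open>
  Write \<open>exp (- (x - m))\<close> as the integral of \<open>exp (- u)\<close> over \<open>u \<ge> x - m\<close> and exchange the integrals.
\<close>

lemma nn_integral_exceedance:
  "ennreal (exceedance M m) =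
    (\<integral>\<^sup>+u. ennreal (exp (- u) * (cdf M (m + u) - cdf M m)) * indicator {0..} u \<partial>lborel)"
proof -
  have "ennreal (exceedance M m) = (\<integral>\<^sup>+x. ennreal (if m < x then exp (- (x - m)) else 0) \<partial>M)"
    unfolding exceedance_def
    by (intro nn_integral_eq_integral[symmetric] integrable_const_bound[where B = 1]) auto
  also have "\<dots> = (\<integral>\<^sup>+x. (\<integral>\<^sup>+u. ennreal (exp (- u)) * indicator {0..} u * indicator {m<..m + u} x \<partial>lborel) \<partial>M)"
  proof (rule nn_integral_cong)
    fix x
    show "ennreal (if m < x then exp (- (x - m)) else 0)
        = (\<integral>\<^sup>+u. ennreal (exp (- u)) * indicator {0..} u * indicator {m<..m + u} x \<partial>lborel)"
    proof (cases "m < x")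
      case True
      have "(\<integral>\<^sup>+u. ennreal (exp (- u)) * indicator {0..} u * indicator {m<..m + u} x \<partial>lborel)
          = (\<integral>\<^sup>+u. ennreal (exp (- u)) * indicator {x - m..} u \<partial>lborel)"
        using True by (intro nn_integral_cong) (auto split: split_indicator)
      also have "\<dots> = ennreal (0 - (- exp (- (x - m))))"
      proof (rule nn_integral_FTC_atLeast)
        show "((\<lambda>u::real. - exp (- u)) \<longlongrightarrow> 0) at_top" by real_asymp
      qed (auto intro!: derivative_eq_intros)
      finally show ?thesis using True by simp
    qed simp
  qed
  also have "\<dots> = (\<integral>\<^sup>+u. (\<integral>\<^sup>+x. ennreal (exp (- u)) * indicator {0..} u * indicator {m<..m + u} x \<partial>M) \<partial>lborel)"
  proof -
    interpret pair_sigma_finite lborel M ..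
    have [measurable]: "Measurable.pred (borel \<Otimes>\<^sub>M borel) (\<lambda>z. snd z \<in> {m<..m + fst z})"
      unfolding greaterThanAtMost_iff by measurable
    show ?thesis by (rule Fubini') measurable
  qed
  also have "\<dots> = (\<integral>\<^sup>+u. ennreal (exp (- u) * (cdf M (m + u) - cdf M m)) * indicator {0..} u \<partial>lborel)"
  proof (rule nn_integral_cong)
    fix u
    show "(\<integral>\<^sup>+x. ennreal (exp (- u)) * indicator {0..} u * indicator {m<..m + u} x \<partial>M)
        = ennreal (exp (- u) * (cdf M (m + u) - cdf M m)) * indicator {0..} u"
    proof (cases "0 \<le> u")
      case True
      have "cdf M (m + u) - cdf M m = measure M {m<..m + u}"
        using cdf_diff_eq[of m "m + u"] True by (cases "u = 0") auto
      moreover have "(\<integral>\<^sup>+x. ennreal (exp (- u)) * indicator {m<..m + u} x \<partial>M)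
          = ennreal (exp (- u)) * ennreal (measure M {m<..m + u})"
        by (subst nn_integral_cmult) (auto simp: emeasure_eq_measure)
      ultimately show ?thesis using True by (simp add: ennreal_mult)
    qed simp
  qed
  finally show ?thesis .
qed

text \<open>
  Inserting the growth bound into the previous integral leaves
  \<open>\<integral> exp (- u) (exp (\<kappa> u) - 1) du = 1 / (1 - \<kappa>) - 1\<close>.
\<close>

lemma exceedance_le:
  assumes \<kappa>: "0 \<le> \<kappa>" "\<kappa> < 1"
    and le: "\<And>u. 0 \<le> u \<Longrightarrow> cdf M (m + u) \<le> cdf M m * exp (\<kappa> * u)"
  shows "exceedance M m \<le> cdf M m * (\<kappa> / (1 - \<kappa>))"
proof -
  let ?F = "cdf M m"
  let ?G = "\<lambda>u. ?F * (exp (- u) - exp (- ((1 - \<kappa>) * u)) / (1 - \<kappa>))"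
  have "ennreal (exceedance M m) \<le> (\<integral>\<^sup>+u. ennreal (?F * (exp (- ((1 - \<kappa>) * u)) - exp (- u))) * indicator {0..} u \<partial>lborel)"
    unfolding nn_integral_exceedance
  proof (rule nn_integral_mono)
    fix u
    have "exp (- u) * (cdf M (m + u) - cdf M m) \<le> exp (- u) * (?F * exp (\<kappa> * u) - ?F)" if "0 \<le> u"
      using le[OF that] by (intro mult_left_mono) auto
    also have "exp (- u) * (?F * exp (\<kappa> * u) - ?F) = ?F * (exp (- ((1 - \<kappa>) * u)) - exp (- u))"
      by (simp add: algebra_simps exp_add[symmetric])
    finally show "ennreal (exp (- u) * (cdf M (m + u) - cdf M m)) * indicator {0..} u
        \<le> ennreal (?F * (exp (- ((1 - \<kappa>) * u)) - exp (- u))) * indicator {0..} u"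
      by (auto split: split_indicator intro!: ennreal_leI)
  qed
  also have "\<dots> = ennreal (0 - ?G 0)"
  proof (rule nn_integral_FTC_atLeast)
    have "((\<lambda>u. exp (- (a * u))) \<longlongrightarrow> 0) at_top" if "0 < a" for a :: real
      using that by real_asymp
    from this[of 1] this[of "1 - \<kappa>"] have "(?G \<longlongrightarrow> ?F * (0 - 0 / (1 - \<kappa>))) at_top"
      using \<kappa> by (intro tendsto_intros) auto
    then show "(?G \<longlongrightarrow> 0) at_top" by simp
    fix u :: real assume "0 \<le> u"
    have "((\<lambda>u. ?F * (exp (- u) - exp (- (a * u)) / a)) has_real_derivative ?F * (exp (- (a * u)) - exp (- u))) (at u)"
      if "0 < a" for a using that by (auto intro!: derivative_eq_intros)
    from this[of "1 - \<kappa>"] show "(?G has_real_derivative ?F * (exp (- ((1 - \<kappa>) * u)) - exp (- u))) (at u)"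
      using \<kappa> by simp
    have "- u \<le> - ((1 - \<kappa>) * u)" using \<kappa> \<open>0 \<le> u\<close> by (simp add: algebra_simps)
    then show "0 \<le> ?F * (exp (- ((1 - \<kappa>) * u)) - exp (- u))"
      by (intro mult_nonneg_nonneg cdf_nonneg) simp
  qed measurable
  also have "0 - ?G 0 = ?F * (\<kappa> / (1 - \<kappa>))" using \<kappa> by (simp add: field_simps)
  finally show ?thesis
    using \<kappa> cdf_nonneg[of m] by (subst (asm) ennreal_le_iff) auto
qed

text \<open>
  Here growth is known only on a window of length \<open>u0\<close>; the factor \<open>1 - (1 + u0) exp (- u0)\<close> is the integral
  of \<open>u exp (- u)\<close> over it.
\<close>

lemma exceedance_ge:
  assumes \<kappa>: "0 \<le> \<kappa>" "0 \<le> u0"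
    and ge: "\<And>u. 0 \<le> u \<Longrightarrow> u \<le> u0 \<Longrightarrow> cdf M m * exp (\<kappa> * u) \<le> cdf M (m + u)"
  shows "cdf M m * (\<kappa> * (1 - (1 + u0) * exp (- u0))) \<le> exceedance M m"
proof -
  let ?F = "cdf M m"
  let ?G = "\<lambda>u. - (?F * \<kappa> * ((1 + u) * exp (- u)))"
  have nn: "0 \<le> exceedance M m" unfolding exceedance_def by (intro Bochner_Integration.integral_nonneg) auto
  have "ennreal (?G u0 - ?G 0) = (\<integral>\<^sup>+u. ennreal (?F * \<kappa> * (u * exp (- u))) * indicator {0..u0} u \<partial>lborel)"
  proof (rule nn_integral_FTC_Icc[symmetric])
    show "(?G has_real_derivative ?F * \<kappa> * (x * exp (- x))) (at x)" for x
      by (auto intro!: derivative_eq_intros simp: field_simps)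
  qed (use \<kappa> cdf_nonneg in auto)
  also have "\<dots> \<le> ennreal (exceedance M m)"
    unfolding nn_integral_exceedance
  proof (rule nn_integral_mono)
    fix u
    have "?F * \<kappa> * (u * exp (- u)) \<le> exp (- u) * (cdf M (m + u) - ?F)" if u: "0 \<le> u" "u \<le> u0"
    proof -
      have "?F * (1 + \<kappa> * u) \<le> ?F * exp (\<kappa> * u)" by (intro mult_left_mono exp_ge_add_one_self cdf_nonneg)
      then have "?F * \<kappa> * u \<le> cdf M (m + u) - ?F" using ge[OF u] by (simp add: algebra_simps)
      then have "exp (- u) * (?F * \<kappa> * u) \<le> exp (- u) * (cdf M (m + u) - ?F)" by (intro mult_left_mono) auto
      then show ?thesis by (simp add: mult_ac)
    qed
    then show "ennreal (?F * \<kappa> * (u * exp (- u))) * indicator {0..u0} u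
        \<le> ennreal (exp (- u) * (cdf M (m + u) - cdf M m)) * indicator {0..} u"
      by (auto split: split_indicator intro!: ennreal_leI)
  qed
  finally have "?G u0 - ?G 0 \<le> exceedance M m" using nn by (subst (asm) ennreal_le_iff) auto
  then show ?thesis by (simp add: algebra_simps)
qed

end

section \<open>Left tails that are Gaussian to leading order\<close>

text \<open>
  The two bounds say that the cumulant generating function of \<open>- X\<close> is \<open>t\<^sup>2 s\<^sup>2 / 2\<close> up to a relative error of
  order \<open>t\<close>, with no error in the upper bound. Only the left tail is controlled, so only \<open>t \<ge> 0\<close> occurs.
\<close>

locale gaussian_left_tail = real_distribution M for M :: "real measure" +
  fixes s C :: real
  assumes s_pos: "0 < s" and C_nonneg: "0 \<le> C"
    and exp_integrable: "\<And>t. 0 \<le> t \<Longrightarrow> integrable M (\<lambda>x. exp (- (t * x)))"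
    and laplace_le: "\<And>t. 0 \<le> t \<Longrightarrow> (\<integral>x. exp (- (t * x)) \<partial>M) \<le> exp (t\<^sup>2 * s\<^sup>2 / 2)"
    and laplace_ge: "\<And>t. 0 \<le> t \<Longrightarrow> exp (t\<^sup>2 * s\<^sup>2 / 2 * (1 - C * t)) \<le> (\<integral>x. exp (- (t * x)) \<partial>M)"
begin

lemma cdf_eq_integral: "cdf M x = (\<integral>z. indicator {..x} z \<partial>M)"
  by (simp add: cdf_def)

lemma left_tail_le:
  assumes "0 \<le> y"
  shows "cdf M (- y) \<le> exp (- (y\<^sup>2 / (2 * s\<^sup>2)))"
proof -
  define t where "t = y / s\<^sup>2"
  have t: "0 \<le> t" "t * s\<^sup>2 = y" using assms s_pos by (auto simp: t_def)
  have "cdf M (- y) \<le> (\<integral>x. exp (- (t * y)) * exp (- (t * x)) \<partial>M)"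
    unfolding cdf_eq_integral
  proof (rule integral_mono)
    show "integrable M (indicator {..- y} :: real \<Rightarrow> real)" by (intro integrable_real_indicator) (auto simp: emeasure_eq_measure)
    show "integrable M (\<lambda>x. exp (- (t * y)) * exp (- (t * x)))" using exp_integrable[OF t(1)] by simp
    fix x :: real
    show "indicator {..- y} x \<le> exp (- (t * y)) * exp (- (t * x))"
    proof (cases "x \<le> - y")
      case True
      then have "t * (x + y) \<le> 0" using t(1) by (intro mult_nonneg_nonpos) auto
      then show ?thesis using True by (simp add: exp_add[symmetric] algebra_simps)
    qed simp
  qed
  also have "\<dots> \<le> exp (- (t * y)) * exp (t\<^sup>2 * s\<^sup>2 / 2)"
    using laplace_le[OF t(1)] by simp
  also have "\<dots> = exp (- (t * y) + t * (t * s\<^sup>2) / 2)"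
    by (simp add: exp_add[symmetric] power2_eq_square mult_ac)
  also have "- (t * y) + t * (t * s\<^sup>2) / 2 = - (y\<^sup>2 / (2 * s\<^sup>2))"
    unfolding t(2) by (simp add: t_def power2_eq_square)
  finally show ?thesis .
qed

text \<open>
  A Gaussian lower tail bound from Laplace transforms alone. Weighted with \<open>exp (- t X)\<close>, the law
  concentrates at \<open>- t s\<^sup>2\<close>: the parts to the right of \<open>- (1 - \<epsilon>) t s\<^sup>2\<close> and to the left of \<open>- (1 + \<epsilon>) t s\<^sup>2\<close>
  are bounded by the Laplace transforms at \<open>(1 - \<epsilon>) t\<close> and \<open>(1 + \<epsilon>) t\<close>, and are both at most
  \<open>exp ((1 - \<epsilon>\<^sup>2) t\<^sup>2 s\<^sup>2 / 2)\<close>, which is negligible against the total mass. The remaining part bounds the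
  probability of \<open>X \<le> - (1 - \<epsilon>) t s\<^sup>2\<close> from below.
\<close>

lemma left_tail_ge_tilt:
  assumes \<epsilon>: "0 < \<epsilon>" "\<epsilon> \<le> 1 / 4" and t: "0 \<le> t" "C * t \<le> \<epsilon>\<^sup>2 / 2" "16 \<le> \<epsilon>\<^sup>2 * (t\<^sup>2 * s\<^sup>2)"
  defines "y \<equiv> (1 - \<epsilon>) * (t * s\<^sup>2)"
  shows "exp (- ((1 + 10 * \<epsilon>) * (y\<^sup>2 / (2 * s\<^sup>2)))) \<le> cdf M (- y)"
proof -
  define a where "a = t\<^sup>2 * s\<^sup>2 / 2"
  define y' where "y' = (1 + \<epsilon>) * (t * s\<^sup>2)"
  have a: "8 \<le> \<epsilon>\<^sup>2 * a" "0 \<le> a" using t by (auto simp: a_def)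
  define P where "P = (\<lambda>x. exp (t * y') * indicator {..- y} x +
      exp (t * \<epsilon> * y) * exp (- ((1 - \<epsilon>) * t * x)) + exp (- (t * \<epsilon> * y')) * exp (- ((1 + \<epsilon>) * t * x)) :: real)"
  have le: "exp (- (t * x)) \<le> P x" for x
  proof -
    consider "- y < x" | "x < - y'" | "- y' \<le> x" "x \<le> - y" by linarith
    then show ?thesis
    proof cases
      case 1
      have "0 \<le> t * \<epsilon> * (y + x)" using t \<epsilon> 1 by (intro mult_nonneg_nonneg) auto
      then have "exp (- (t * x)) \<le> exp (t * \<epsilon> * y) * exp (- ((1 - \<epsilon>) * t * x))"
        by (simp add: exp_add[symmetric] algebra_simps)
      also have "\<dots> \<le> P x" by (simp add: P_def)
      finally show ?thesis .
    next
      case 2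
      have "t * \<epsilon> * (y' + x) \<le> 0" using t \<epsilon> 2 by (intro mult_nonneg_nonpos) auto
      then have "exp (- (t * x)) \<le> exp (- (t * \<epsilon> * y')) * exp (- ((1 + \<epsilon>) * t * x))"
        by (simp add: exp_add[symmetric] algebra_simps)
      also have "\<dots> \<le> P x" by (simp add: P_def)
      finally show ?thesis .
    next
      case 3
      have "0 \<le> t * (y' + x)" using t 3 by (intro mult_nonneg_nonneg) auto
      then have "exp (- (t * x)) \<le> exp (t * y')" by (simp add: algebra_simps)
      also have "\<dots> \<le> P x" using 3 by (simp add: P_def)
      finally show ?thesis .
    qed
  qed
  have t': "0 \<le> (1 - \<epsilon>) * t" "0 \<le> (1 + \<epsilon>) * t" using \<epsilon> t by auto
  have ind: "integrable M (indicator {..- y} :: real \<Rightarrow> real)" by (intro integrable_real_indicator) (auto simp: emeasure_eq_measure)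
  note ints = ind exp_integrable[OF t'(1)] exp_integrable[OF t'(2)]
  have "exp (a * (1 - C * t)) \<le> (\<integral>x. exp (- (t * x)) \<partial>M)"
    using laplace_ge[OF t(1)] by (simp add: a_def)
  also have "\<dots> \<le> (\<integral>x. P x \<partial>M)"
    using le ints exp_integrable[OF t(1)] by (intro integral_mono) (auto simp: P_def)
  also have "\<dots> = exp (t * y') * cdf M (- y) + exp (t * \<epsilon> * y) * (\<integral>x. exp (- ((1 - \<epsilon>) * t * x)) \<partial>M)
      + exp (- (t * \<epsilon> * y')) * (\<integral>x. exp (- ((1 + \<epsilon>) * t * x)) \<partial>M)"
    unfolding P_def cdf_eq_integral using ints by simp
  also have "\<dots> \<le> exp (t * y') * cdf M (- y) + exp (t * \<epsilon> * y) * exp (((1 - \<epsilon>) * t)\<^sup>2 * s\<^sup>2 / 2)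
      + exp (- (t * \<epsilon> * y')) * exp (((1 + \<epsilon>) * t)\<^sup>2 * s\<^sup>2 / 2)"
    using laplace_le[OF t'(1)] laplace_le[OF t'(2)] by (intro add_mono mult_left_mono) auto
  also have "\<dots> = exp (t * y') * cdf M (- y) + 2 * exp (a * (1 - \<epsilon>\<^sup>2))"
  proof -
    have "t * \<epsilon> * y + ((1 - \<epsilon>) * t)\<^sup>2 * s\<^sup>2 / 2 = a * (1 - \<epsilon>\<^sup>2)"
      "- (t * \<epsilon> * y') + ((1 + \<epsilon>) * t)\<^sup>2 * s\<^sup>2 / 2 = a * (1 - \<epsilon>\<^sup>2)"
      by (simp_all add: a_def y_def y'_def power2_eq_square) algebra+
    then show ?thesis by (simp add: exp_add[symmetric])
  qed
  finally have main: "exp (a * (1 - C * t)) - 2 * exp (a * (1 - \<epsilon>\<^sup>2)) \<le> exp (t * y') * cdf M (- y)" by simp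
  have aC: "a * (1 - \<epsilon>\<^sup>2 / 2) \<le> a * (1 - C * t)" using a t by (intro mult_left_mono) auto
  have "ln 4 \<le> (4 - 1 :: real)" by (rule ln_le_minus_one) simp
  then have "exp (ln 4 + a * (1 - \<epsilon>\<^sup>2)) \<le> exp (a * (1 - C * t))"
    using a aC by (simp add: algebra_simps)
  then have "4 * exp (a * (1 - \<epsilon>\<^sup>2)) \<le> exp (a * (1 - C * t))" by (simp add: exp_add)
  then have "exp (a * (1 - C * t)) / 2 \<le> exp (t * y') * cdf M (- y)" using main by simp
  then have "exp (- (t * y')) * (exp (a * (1 - C * t)) / 2) \<le> exp (- (t * y')) * (exp (t * y') * cdf M (- y))"
    by (intro mult_left_mono) auto
  also have "\<dots> = cdf M (- y)" by (simp add: mult.assoc[symmetric] exp_add[symmetric])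
  also have "exp (- (t * y')) * (exp (a * (1 - C * t)) / 2) = exp (- (t * y') + a * (1 - C * t) - ln 2)"
    by (simp add: exp_add[symmetric] exp_diff)
  finally have "exp (- (t * y') + a * (1 - C * t) - ln 2) \<le> cdf M (- y)" .
  moreover have "- ((1 + 10 * \<epsilon>) * (y\<^sup>2 / (2 * s\<^sup>2))) \<le> - (t * y') + a * (1 - C * t) - ln 2"
  proof -
    have eq1: "y\<^sup>2 / (2 * s\<^sup>2) = (1 - \<epsilon>)\<^sup>2 * a"
      using s_pos by (simp add: y_def a_def power2_eq_square field_simps)
    have eq2: "t * y' = 2 * (1 + \<epsilon>) * a" by (simp add: y'_def a_def power2_eq_square)
    have "ln 2 \<le> (2 - 1 :: real)" by (rule ln_le_minus_one) simp
    then have "ln 2 \<le> \<epsilon>\<^sup>2 / 4 * a" using a by simp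
    moreover have "2 * (1 + \<epsilon>) * a - a * (1 - \<epsilon>\<^sup>2 / 2) + \<epsilon>\<^sup>2 / 4 * a \<le> (1 + 10 * \<epsilon>) * ((1 - \<epsilon>)\<^sup>2 * a)"
    proof -
      have "0 \<le> \<epsilon> * (24 - 79 * \<epsilon> + 40 * \<epsilon>\<^sup>2) * a"
        using \<epsilon> a(2) zero_le_power2[of \<epsilon>] by (intro mult_nonneg_nonneg) auto
      also have "\<dots> = 4 * ((1 + 10 * \<epsilon>) * ((1 - \<epsilon>)\<^sup>2 * a) - (2 * (1 + \<epsilon>) * a - a * (1 - \<epsilon>\<^sup>2 / 2) + \<epsilon>\<^sup>2 / 4 * a))"
        by (simp add: power2_eq_square algebra_simps)
      finally show ?thesis by simp
    qed
    ultimately show ?thesis unfolding eq1 eq2 using aC by linarith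
  qed
  ultimately show ?thesis by (meson exp_le_cancel_iff order_trans)
qed

lemma left_tail_ge:
  assumes \<epsilon>: "0 < \<epsilon>" "\<epsilon> \<le> 1 / 4" and y: "4 / \<epsilon> * s \<le> y" "y \<le> \<epsilon>\<^sup>2 / (4 * (C + 1)) * s\<^sup>2"
  shows "exp (- ((1 + 10 * \<epsilon>) * (y\<^sup>2 / (2 * s\<^sup>2)))) \<le> cdf M (- y)"
proof -
  define t where "t = y / ((1 - \<epsilon>) * s\<^sup>2)"
  have y0: "0 \<le> y" using y(1) \<epsilon> s_pos by (intro order_trans[OF _ y(1)]) simp
  have yt: "y = (1 - \<epsilon>) * (t * s\<^sup>2)" using \<epsilon> s_pos by (simp add: t_def)
  have t: "0 \<le> t" using y0 \<epsilon> by (simp add: t_def)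
  define v where "v = y / s\<^sup>2"
  have v: "0 \<le> v" "v \<le> \<epsilon>\<^sup>2 / (4 * (C + 1))"
    using y(2) y0 s_pos by (simp_all add: v_def pos_divide_le_eq)
  have "t = v / (1 - \<epsilon>)" by (simp add: t_def v_def)
  also have "\<dots> \<le> v / (1 / 2)" using v \<epsilon> by (intro divide_left_mono) auto
  also have "\<dots> = 2 * v" by simp
  also have "\<dots> \<le> 2 * (\<epsilon>\<^sup>2 / (4 * (C + 1)))" using v(2) by (intro mult_left_mono) auto
  finally have "t \<le> 2 * (\<epsilon>\<^sup>2 / (4 * (C + 1)))" .
  then have "C * t \<le> C * (2 * (\<epsilon>\<^sup>2 / (4 * (C + 1))))" using C_nonneg by (intro mult_left_mono)
  also have "\<dots> = C / (C + 1) * (\<epsilon>\<^sup>2 / 2)"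
    using C_nonneg by (simp add: field_simps)
  also have "\<dots> \<le> 1 * (\<epsilon>\<^sup>2 / 2)" using C_nonneg by (intro mult_right_mono) auto
  finally have Ct: "C * t \<le> \<epsilon>\<^sup>2 / 2" by simp
  have "(1 - \<epsilon>) * (t * s\<^sup>2) \<le> 1 * (t * s\<^sup>2)" using \<epsilon> t by (intro mult_right_mono) auto
  then have "4 / \<epsilon> * s \<le> t * s * s" using y(1) yt by (simp add: power2_eq_square mult.assoc)
  then have "4 / \<epsilon> \<le> t * s" using s_pos by (rule mult_right_le_imp_le)
  then have "4 \<le> \<epsilon> * (t * s)" using \<epsilon> by (simp add: field_simps)
  then have "4\<^sup>2 \<le> (\<epsilon> * (t * s))\<^sup>2" by (intro power_mono) auto
  then have "16 \<le> \<epsilon>\<^sup>2 * (t\<^sup>2 * s\<^sup>2)" by (simp add: power_mult_distrib)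
  from left_tail_ge_tilt[OF \<epsilon> t Ct this] show ?thesis by (simp add: yt)
qed

end

lemma xexp_antimono:
  fixes s :: real
  assumes "0 < s" "s \<le> y0" "y0 \<le> y"
  shows "y * exp (- (y\<^sup>2 / (2 * s\<^sup>2))) \<le> y0 * exp (- (y0\<^sup>2 / (2 * s\<^sup>2)))"
proof -
  have y0: "0 < y0" using assms by simp
  have "1 + (y / y0 - 1) \<le> exp (y / y0 - 1)" by (rule exp_ge_add_one_self)
  also have "y / y0 - 1 \<le> y\<^sup>2 / (2 * s\<^sup>2) - y0\<^sup>2 / (2 * s\<^sup>2)"
  proof -
    have "s * s \<le> y0 * y0" using assms by (intro mult_mono) auto
    moreover have "y0 * y0 \<le> y0 * y" using assms y0 by (intro mult_left_mono) auto
    ultimately have "2 * s\<^sup>2 \<le> y0 * (y + y0)" by (simp add: power2_eq_square algebra_simps)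
    then have "(y - y0) * (2 * s\<^sup>2) \<le> (y - y0) * (y0 * (y + y0))" using assms by (intro mult_left_mono) auto
    then have "(y - y0) / y0 \<le> (y - y0) * (y + y0) / (2 * s\<^sup>2)"
      using y0 assms by (simp add: divide_simps mult_ac)
    then show ?thesis using y0 by (simp add: diff_divide_distrib power2_eq_square algebra_simps)
  qed
  finally have "y \<le> y0 * exp (y\<^sup>2 / (2 * s\<^sup>2) - y0\<^sup>2 / (2 * s\<^sup>2))"
    using y0 by (simp add: field_simps)
  then have "y * exp (- (y\<^sup>2 / (2 * s\<^sup>2))) \<le> y0 * exp (y\<^sup>2 / (2 * s\<^sup>2) - y0\<^sup>2 / (2 * s\<^sup>2)) * exp (- (y\<^sup>2 / (2 * s\<^sup>2)))"
    by (intro mult_right_mono) auto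
  then show ?thesis by (simp add: mult.assoc exp_add[symmetric])
qed

lemma divided_difference_cancel:
  fixes d w x y :: real
  assumes "d \<noteq> 0"
  shows "x / (2 * d) * (y / w) * (d * y) = x * (y\<^sup>2 / (2 * w))"
  using assms by (simp add: power2_eq_square)

text \<open>
  Between \<open>A s\<close> and \<open>c s\<^sup>2\<close> the logarithm of the tail is known with relative accuracy \<open>\<eta>\<^sup>2\<close>. The square is
  there because slopes will be estimated by difference quotients with relative step \<open>\<eta>\<close>, which divides
  the error by \<open>\<eta>\<close>.
\<close>

locale log_concave_gaussian_tail = gaussian_left_tail M s C for M s C +
  fixes \<eta> A c :: real
  assumes log_concave_cdf: "log_concave (cdf M)"
    and \<eta>: "0 < \<eta>" "\<eta> \<le> 1 / 4"
    and A: "1 \<le> A" and c: "0 < c" "c \<le> 1 / 4"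
    and tail_ge: "\<And>y. A * s \<le> y \<Longrightarrow> y \<le> c * s\<^sup>2 \<Longrightarrow>
      exp (- ((1 + \<eta>\<^sup>2) * (y\<^sup>2 / (2 * s\<^sup>2)))) \<le> cdf M (- y)"
begin

lemma mono_cdf: "mono (cdf M)"
  by (intro monoI cdf_nondecreasing)

text \<open>
  The difference quotient of \<open>ln (cdf M)\<close> over the interval from \<open>- z\<close> to \<open>- y\<close>.
\<close>

definition slope :: "real \<Rightarrow> real \<Rightarrow> real" where
  "slope y z = (ln (cdf M (- y)) - ln (cdf M (- z))) / (z - y)"

text \<open>
  The upper tail bound at \<open>y\<close> and the lower tail bound at \<open>k y\<close> enclose the difference quotient. For \<open>k = 1 + \<eta>\<close>
  the resulting factor of \<open>y / s\<^sup>2\<close> is close to 1; for \<open>k = 2\<close> it is merely bounded, which is enough far from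
  the typical position of the minimum.
\<close>

lemma slope_le:
  assumes "A * s \<le> y" "1 < k" "k * y \<le> c * s\<^sup>2"
  shows "0 \<le> slope y (k * y)"
    and "slope y (k * y) \<le> ((1 + \<eta>\<^sup>2) * k\<^sup>2 - 1) / (2 * (k - 1)) * (y / s\<^sup>2)"
    and "0 < cdf M (- (k * y))"
proof -
  have "0 < A * s" using A s_pos by simp
  then have y: "0 < y" using assms(1) by linarith
  have ky: "y < k * y" using y assms(2) by simp
  have ge: "exp (- ((1 + \<eta>\<^sup>2) * ((k * y)\<^sup>2 / (2 * s\<^sup>2)))) \<le> cdf M (- (k * y))"
    using ky assms by (intro tail_ge) auto
  then show pos: "0 < cdf M (- (k * y))" by (rule less_le_trans[rotated]) simp
  have mono: "cdf M (- (k * y)) \<le> cdf M (- y)" using ky by (intro cdf_nondecreasing) auto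
  then have "ln (cdf M (- (k * y))) \<le> ln (cdf M (- y))" using pos by simp
  then show "0 \<le> slope y (k * y)" unfolding slope_def using ky by simp
  have "ln (exp (- ((1 + \<eta>\<^sup>2) * ((k * y)\<^sup>2 / (2 * s\<^sup>2))))) \<le> ln (cdf M (- (k * y)))"
    using ge by (intro ln_mono) auto
  moreover have "ln (cdf M (- y)) \<le> ln (exp (- (y\<^sup>2 / (2 * s\<^sup>2))))"
    using left_tail_le[of y] y pos mono by (intro ln_mono) auto
  ultimately have "ln (cdf M (- y)) - ln (cdf M (- (k * y))) \<le> (1 + \<eta>\<^sup>2) * ((k * y)\<^sup>2 / (2 * s\<^sup>2)) - y\<^sup>2 / (2 * s\<^sup>2)"
    by simp
  also have "\<dots> = ((1 + \<eta>\<^sup>2) * k\<^sup>2 - 1) / (2 * (k - 1)) * (y / s\<^sup>2) * (k * y - y)"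
  proof -
    have "k * y - y = (k - 1) * y" by (simp add: algebra_simps)
    then have eq: "((1 + \<eta>\<^sup>2) * k\<^sup>2 - 1) / (2 * (k - 1)) * (y / s\<^sup>2) * (k * y - y)
        = ((1 + \<eta>\<^sup>2) * k\<^sup>2 - 1) * (y\<^sup>2 / (2 * s\<^sup>2))"
      using divided_difference_cancel[of "k - 1"] assms by simp
    show ?thesis unfolding eq by (simp add: power_mult_distrib algebra_simps add_divide_distrib)
  qed
  finally show "slope y (k * y) \<le> ((1 + \<eta>\<^sup>2) * k\<^sup>2 - 1) / (2 * (k - 1)) * (y / s\<^sup>2)"
    unfolding slope_def using ky by (simp add: pos_divide_le_eq)
qed

lemma slope_ge:
  assumes "A * s \<le> k * y" "0 < k" "k < 1" "y \<le> c * s\<^sup>2"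
  shows "(1 - (1 + \<eta>\<^sup>2) * k\<^sup>2) / (2 * (1 - k)) * (y / s\<^sup>2) \<le> slope (k * y) y"
proof -
  have "0 < A * s" using A s_pos by simp
  then have "0 < k * y" using assms(1) by linarith
  then have y: "0 < y" using assms by (simp add: zero_less_mult_iff)
  have ky: "k * y < y" using y assms by simp
  have ge: "exp (- ((1 + \<eta>\<^sup>2) * (y\<^sup>2 / (2 * s\<^sup>2)))) \<le> cdf M (- y)"
    using ky assms by (intro tail_ge) auto
  then have pos: "0 < cdf M (- y)" by (rule less_le_trans[rotated]) simp
  have ge': "exp (- ((1 + \<eta>\<^sup>2) * ((k * y)\<^sup>2 / (2 * s\<^sup>2)))) \<le> cdf M (- (k * y))"
    using ky assms by (intro tail_ge) auto
  have "ln (exp (- ((1 + \<eta>\<^sup>2) * ((k * y)\<^sup>2 / (2 * s\<^sup>2))))) \<le> ln (cdf M (- (k * y)))"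
    using ge' by (intro ln_mono) auto
  moreover have "ln (cdf M (- y)) \<le> ln (exp (- (y\<^sup>2 / (2 * s\<^sup>2))))"
    using left_tail_le[of y] y pos by (intro ln_mono) auto
  ultimately have "y\<^sup>2 / (2 * s\<^sup>2) - (1 + \<eta>\<^sup>2) * ((k * y)\<^sup>2 / (2 * s\<^sup>2)) \<le> ln (cdf M (- (k * y))) - ln (cdf M (- y))"
    by simp
  moreover have "y\<^sup>2 / (2 * s\<^sup>2) - (1 + \<eta>\<^sup>2) * ((k * y)\<^sup>2 / (2 * s\<^sup>2))
      = (1 - (1 + \<eta>\<^sup>2) * k\<^sup>2) / (2 * (1 - k)) * (y / s\<^sup>2) * (y - k * y)"
  proof -
    have "y - k * y = (1 - k) * y" by (simp add: algebra_simps)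
    then have eq: "(1 - (1 + \<eta>\<^sup>2) * k\<^sup>2) / (2 * (1 - k)) * (y / s\<^sup>2) * (y - k * y)
        = (1 - (1 + \<eta>\<^sup>2) * k\<^sup>2) * (y\<^sup>2 / (2 * s\<^sup>2))"
      using divided_difference_cancel[of "1 - k"] assms by simp
    show ?thesis unfolding eq by (simp add: power_mult_distrib algebra_simps add_divide_distrib)
  qed
  ultimately show ?thesis
    unfolding slope_def using ky by (simp add: pos_le_divide_eq)
qed

lemma exceedance_le_slope:
  assumes "0 < cdf M (- z)" "y < z" "- y \<le> m" "0 \<le> slope y z" "slope y z < 1"
  shows "exceedance M m \<le> cdf M m * (slope y z / (1 - slope y z))"
proof (rule exceedance_le)
  fix u :: real assume "0 \<le> u"
  then show "cdf M (m + u) \<le> cdf M m * exp (slope y z * u)"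
    using log_concave_growth_le[OF log_concave_cdf mono_cdf assms(1), of "- y" m u] assms
    by (simp add: slope_def)
qed (use assms in auto)

lemma exceedance_ge_slope:
  assumes "m + u0 \<le> - z" "y < z" "0 \<le> slope y z" "0 \<le> u0"
  shows "cdf M m * (slope y z * (1 - (1 + u0) * exp (- u0))) \<le> exceedance M m"
proof (rule exceedance_ge)
  fix u :: real assume "0 \<le> u" "u \<le> u0"
  then show "cdf M m * exp (slope y z * u) \<le> cdf M (m + u)"
    using log_concave_growth_ge[OF log_concave_cdf mono_cdf cdf_nonneg, of m u "- z" "- y"] assms
    by (simp add: slope_def)
qed (use assms in auto)

text \<open>
  Here \<open>- \<theta> s\<close> is the place where the minimum is expected. To the right of \<open>- (1 + \<eta>) \<theta> s\<close> the slope of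
  \<open>ln F\<close> is at most about \<open>\<theta> / s\<close>. To the left the slope increases, but the product of the slope bound
  \<open>y / s\<^sup>2\<close> and the tail bound \<open>exp (- y\<^sup>2 / (2 s\<^sup>2))\<close> decreases, so its value at the threshold serves for the whole
  region. This region cannot be dismissed by bounding the exceedance by the tail alone, because \<open>s\<close> may be
  arbitrarily large compared with \<open>n\<close>. Beyond \<open>c s\<^sup>2 / 2\<close> the tail is so thin that the trivial bound 1 is
  enough.
\<close>

lemma exceedance_upper_bound:
  fixes \<theta> :: real
  assumes \<theta>: "2 * A \<le> \<theta>" "4 * \<theta> \<le> c * s" "2 * \<theta> \<le> \<eta> * s"
  shows "exceedance M m \<le> (1 + 10 * \<eta>) * (\<theta> / s) * cdf M m
    + 10 * (\<theta> / s) * exp (- ((1 + \<eta>)\<^sup>2 * \<theta>\<^sup>2 / 2)) * indicator {..< - ((1 + \<eta>) * \<theta> * s)} m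
    + indicator {..< - (c * s\<^sup>2 / 2)} m"
proof -
  define y0 where "y0 = (1 + \<eta>) * \<theta> * s"
  define q where "q = \<theta> / s"
  have \<theta>0: "2 \<le> \<theta>" using \<theta> A by linarith
  have q: "0 < q" using \<theta>0 s_pos by (simp add: q_def)
  have q\<eta>: "2 * q \<le> \<eta>" using \<theta>(3) s_pos by (simp add: q_def field_simps)
  have y0q: "y0 / s\<^sup>2 = (1 + \<eta>) * q" using s_pos by (simp add: y0_def q_def power2_eq_square)
  have As: "A * s \<le> y0"
  proof -
    have "A \<le> \<theta>" using \<theta> A by linarith
    also have "\<theta> \<le> (1 + \<eta>) * \<theta>" using \<eta> \<theta>0 by simp
    finally show ?thesis unfolding y0_def using s_pos by (intro mult_right_mono) auto
  qed
  have s_y0: "s \<le> y0"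
  proof -
    have "1 * s \<le> A * s" using A s_pos by (intro mult_right_mono) auto
    then show ?thesis using As by simp
  qed
  have y0_pos: "0 < y0" using s_y0 s_pos by linarith
  let ?b = "10 * q * exp (- ((1 + \<eta>)\<^sup>2 * \<theta>\<^sup>2 / 2))"
  have nn: "0 \<le> (1 + 10 * \<eta>) * q * cdf M m" using q \<eta> cdf_nonneg[of m] by (intro mult_nonneg_nonneg) auto
  have b0: "0 \<le> ?b" using q by simp
  consider "- y0 \<le> m" | "m < - y0" "- (c * s\<^sup>2 / 2) \<le> m" | "m < - y0" "m < - (c * s\<^sup>2 / 2)" by linarith
  then have "exceedance M m \<le> (1 + 10 * \<eta>) * q * cdf M m
    + ?b * indicator {..< - y0} m + indicator {..< - (c * s\<^sup>2 / 2)} m"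
  proof cases
    case 1
    \<comment> \<open>By concavity, the slope of this chord bounds all slopes to the right of \<open>- y0\<close>.\<close>
    define \<kappa> where "\<kappa> = slope y0 ((1 + \<eta>) * y0)"
    have "(1 + \<eta>) * y0 = (1 + \<eta>)\<^sup>2 * (\<theta> * s)" by (simp add: y0_def power2_eq_square)
    also have "\<dots> \<le> 4 * (\<theta> * s)"
    proof (rule mult_right_mono)
      have "(1 + \<eta>)\<^sup>2 \<le> 2\<^sup>2" using \<eta> by (intro power_mono) auto
      then show "(1 + \<eta>)\<^sup>2 \<le> 4" by simp
    qed (use \<theta>0 s_pos in auto)
    also have "\<dots> \<le> c * s * s" using mult_right_mono[OF \<theta>(2), of s] s_pos by (simp add: mult.assoc)
    finally have le: "(1 + \<eta>) * y0 \<le> c * s\<^sup>2" by (simp add: power2_eq_square mult.assoc)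
    have k: "1 < 1 + \<eta>" using \<eta> by simp
    note sl = slope_le[OF As k le]
    have "\<kappa> \<le> ((1 + \<eta>\<^sup>2) * (1 + \<eta>)\<^sup>2 - 1) / (2 * \<eta>) * ((1 + \<eta>) * q)"
      using sl(2) by (simp add: \<kappa>_def y0q)
    also have "((1 + \<eta>\<^sup>2) * (1 + \<eta>)\<^sup>2 - 1) / (2 * \<eta>) = 1 + \<eta> + \<eta>\<^sup>2 + \<eta>^3 / 2"
      using \<eta> by (simp add: divide_simps) (simp add: power2_eq_square power3_eq_cube algebra_simps)
    also have "(1 + \<eta> + \<eta>\<^sup>2 + \<eta>^3 / 2) * ((1 + \<eta>) * q) \<le> (1 + 4 * \<eta>) * q"
    proof -
      have "\<eta>\<^sup>2 \<le> \<eta> * (1/4)" "\<eta>^3 \<le> \<eta> * (1/4)" "\<eta>^4 \<le> \<eta> * (1/4)"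
      proof -
        show 2: "\<eta>\<^sup>2 \<le> \<eta> * (1/4)" using \<eta> by (simp add: power2_eq_square)
        have "\<eta> * \<eta> \<le> 1 * (1/4)" using \<eta> by (intro mult_mono) auto
        then show "\<eta>^3 \<le> \<eta> * (1/4)" using \<eta> by (simp add: power3_eq_cube)
        have "\<eta> * \<eta> * \<eta> \<le> 1 * 1 * (1/4)" using \<eta> by (intro mult_mono) auto
        then show "\<eta>^4 \<le> \<eta> * (1/4)" using \<eta> by (simp add: eval_nat_numeral mult.assoc)
      qed
      moreover have "(1 + \<eta> + \<eta>\<^sup>2 + \<eta>^3 / 2) * (1 + \<eta>) = 1 + 2 * \<eta> + 2 * \<eta>\<^sup>2 + 3 / 2 * \<eta>^3 + \<eta>^4 / 2"
        by (simp add: eval_nat_numeral field_simps)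
      ultimately have "(1 + \<eta> + \<eta>\<^sup>2 + \<eta>^3 / 2) * (1 + \<eta>) \<le> 1 + 4 * \<eta>"
        using \<eta>(1) by linarith
      then show ?thesis using q by (simp add: mult.assoc[symmetric] mult_right_mono)
    qed
    finally have \<kappa>: "\<kappa> \<le> (1 + 4 * \<eta>) * q" .
    also have "\<dots> \<le> 2 * q" using \<eta> q by (intro mult_right_mono) auto
    finally have \<kappa>\<eta>: "\<kappa> \<le> \<eta>" using q\<eta> by simp
    have \<kappa>0: "0 \<le> \<kappa>" using sl(1) by (simp add: \<kappa>_def)
    have "exceedance M m \<le> cdf M m * (\<kappa> / (1 - \<kappa>))"
      unfolding \<kappa>_def using \<kappa>\<eta> \<kappa>0 \<eta> 1 y0_pos sl(3)
      by (intro exceedance_le_slope) (auto simp: \<kappa>_def)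
    also have "\<kappa> / (1 - \<kappa>) \<le> (1 + 4 * \<eta>) * q / (1 - \<eta>)"
      using \<kappa> \<kappa>\<eta> \<kappa>0 \<eta> by (intro frac_le) auto
    also have "\<dots> \<le> (1 + 10 * \<eta>) * q"
    proof -
      have "\<eta> * \<eta> \<le> \<eta> * (1/4)" using \<eta> by (intro mult_left_mono) auto
      then have "1 + 4 * \<eta> \<le> (1 + 10 * \<eta>) * (1 - \<eta>)" using \<eta> by (simp add: algebra_simps)
      then have "(1 + 4 * \<eta>) * q \<le> (1 + 10 * \<eta>) * (1 - \<eta>) * q" using q by (intro mult_right_mono) auto
      then show ?thesis using \<eta> by (simp add: pos_divide_le_eq mult_ac)
    qed
    finally have "exceedance M m \<le> cdf M m * ((1 + 10 * \<eta>) * q)" using cdf_nonneg[of m] by (simp add: mult_left_mono)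
    also have "\<dots> = (1 + 10 * \<eta>) * q * cdf M m" by simp
    finally show ?thesis using b0 by (auto split: split_indicator)
  next
    case 2
    define y where "y = - m"
    \<comment> \<open>A chord of length \<open>y\<close>; the factor 2 has to stay in the range where the lower tail bound holds.\<close>
    define \<kappa> where "\<kappa> = slope y (2 * y)"
    have y: "y0 < y" "y \<le> c * s\<^sup>2 / 2" using 2 by (auto simp: y_def)
    have Asy: "A * s \<le> y" using As y by linarith
    have le: "2 * y \<le> c * s\<^sup>2" using y by simp
    have k: "1 < (2::real)" by simp
    note sl = slope_le[OF Asy k le]
    have ys: "0 \<le> y / s\<^sup>2" using y y0_pos by simp
    have "\<eta>\<^sup>2 \<le> 1\<^sup>2" using \<eta> by (intro power_mono) auto
    then have "((1 + \<eta>\<^sup>2) * 2\<^sup>2 - 1) / (2 * (2 - 1)) \<le> 4" by simp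
    then have "((1 + \<eta>\<^sup>2) * 2\<^sup>2 - 1) / (2 * (2 - 1)) * (y / s\<^sup>2) \<le> 4 * (y / s\<^sup>2)"
      using ys by (rule mult_right_mono)
    then have \<kappa>: "\<kappa> \<le> 4 * (y / s\<^sup>2)" using sl(2) unfolding \<kappa>_def by linarith
    have "y / s\<^sup>2 \<le> c / 2" using y s_pos by (simp add: pos_divide_le_eq)
    then have \<kappa>half: "\<kappa> \<le> 1 / 2" using \<kappa> c by linarith
    have \<kappa>0: "0 \<le> \<kappa>" using sl(1) by (simp add: \<kappa>_def)
    have "exceedance M m \<le> cdf M m * (\<kappa> / (1 - \<kappa>))"
      unfolding \<kappa>_def using \<kappa>half \<kappa>0 sl(3) y y0_pos
      by (intro exceedance_le_slope) (auto simp: \<kappa>_def y_def)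
    also have "\<dots> \<le> exp (- (y\<^sup>2 / (2 * s\<^sup>2))) * (4 * (y / s\<^sup>2) / (1 / 2))"
    proof (rule mult_mono)
      show "cdf M m \<le> exp (- (y\<^sup>2 / (2 * s\<^sup>2)))" using left_tail_le[of y] y y0_pos by (simp add: y_def)
      show "\<kappa> / (1 - \<kappa>) \<le> 4 * (y / s\<^sup>2) / (1 / 2)" using \<kappa> \<kappa>0 \<kappa>half by (intro frac_le) auto
    qed (use \<kappa>0 \<kappa>half in auto)
    also have "\<dots> = 8 / s\<^sup>2 * (y * exp (- (y\<^sup>2 / (2 * s\<^sup>2))))" by simp
    also have "\<dots> \<le> 8 / s\<^sup>2 * (y0 * exp (- (y0\<^sup>2 / (2 * s\<^sup>2))))"
      using xexp_antimono[OF s_pos s_y0, of y] y by (intro mult_left_mono) auto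
    also have "\<dots> = 8 * ((1 + \<eta>) * q) * exp (- (y0\<^sup>2 / (2 * s\<^sup>2)))" by (simp add: y0q[symmetric])
    also have "y0\<^sup>2 / (2 * s\<^sup>2) = (1 + \<eta>)\<^sup>2 * \<theta>\<^sup>2 / 2" using s_pos by (simp add: y0_def power_mult_distrib)
    also have "8 * ((1 + \<eta>) * q) * exp (- ((1 + \<eta>)\<^sup>2 * \<theta>\<^sup>2 / 2)) \<le> ?b"
      using \<eta> q by (intro mult_right_mono) (auto simp: mult.assoc[symmetric] intro!: mult_right_mono)
    finally have "exceedance M m \<le> ?b" .
    then show ?thesis using 2 nn by simp
  next
    case 3
    have "exceedance M m \<le> (\<integral>x. 1 \<partial>M)" unfolding exceedance_def
      by (intro integral_mono integrable_const_bound[where B = 1]) auto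
    then have "exceedance M m \<le> 1" using prob_space by simp
    then show ?thesis using 3 nn b0 by simp
  qed
  then show ?thesis by (simp add: q_def y0_def)
qed

text \<open>
  To the left of \<open>- (1 - \<eta>) \<theta> s\<close>, and still on a window of length \<open>\<eta> (1 - \<eta>) \<theta> s\<close> beyond, the slope of \<open>ln F\<close> is
  at least about \<open>\<theta> / s\<close>. The window is long on the scale of the weight \<open>exp (- u)\<close>.
\<close>

lemma exceedance_lower_bound:
  fixes \<theta> :: real
  assumes \<theta>: "4 * A \<le> \<theta>" "\<theta> \<le> c * s" and m: "m \<le> - ((1 - \<eta>) * \<theta> * s)"
    and u0: "(1 + \<eta> * (1 - \<eta>) * \<theta> * s) * exp (- (\<eta> * (1 - \<eta>) * \<theta> * s)) \<le> \<eta>"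
  shows "(1 - \<eta>)^4 * (\<theta> / s) * cdf M m \<le> exceedance M m"
proof -
  define y1 where "y1 = (1 - \<eta>) * \<theta> * s"
  define y2 where "y2 = (1 - \<eta>) * y1"
  define q where "q = \<theta> / s"
  define \<kappa> where "\<kappa> = slope ((1 - \<eta>) * y2) y2"
  have \<theta>0: "4 \<le> \<theta>" using \<theta> A by linarith
  have q: "0 < q" using \<theta>0 s_pos by (simp add: q_def)
  have y1: "0 < y1" using \<eta> \<theta>0 s_pos by (simp add: y1_def)
  then have y2: "0 < y2" "y2 \<le> y1" using \<eta> by (auto simp: y2_def algebra_simps)
  have y2q: "y2 / s\<^sup>2 = (1 - \<eta>)\<^sup>2 * q" using s_pos by (simp add: y1_def y2_def q_def power2_eq_square)
  have "y1 \<le> 1 * \<theta> * s" unfolding y1_def using \<eta> \<theta>0 s_pos by (intro mult_right_mono) auto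
  also have "\<dots> \<le> c * s * s" using mult_right_mono[OF \<theta>(2), of s] s_pos by simp
  finally have y2c: "y2 \<le> c * s\<^sup>2" using y2 by (simp add: power2_eq_square mult.assoc)
  have As: "A * s \<le> (1 - \<eta>) * y2"
  proof -
    have "(3/4) ^ 3 \<le> (1 - \<eta>) ^ 3" using \<eta> by (intro power_mono) auto
    then have "1 / 4 \<le> (1 - \<eta>) ^ 3" by (simp add: power3_eq_cube)
    then have "1 / 4 * \<theta> \<le> (1 - \<eta>) ^ 3 * \<theta>" using \<theta>0 by (intro mult_right_mono) auto
    then have "A \<le> (1 - \<eta>) ^ 3 * \<theta>" using \<theta> by linarith
    then have "A * s \<le> (1 - \<eta>) ^ 3 * \<theta> * s" using s_pos by (intro mult_right_mono) auto
    then show ?thesis by (simp add: y2_def y1_def power3_eq_cube mult_ac)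
  qed
  have k: "0 < 1 - \<eta>" "1 - \<eta> < 1" using \<eta> by auto
  have "(1 - \<eta>)^3 * q = (1 - \<eta>) * ((1 - \<eta>)\<^sup>2 * q)" by (simp add: power3_eq_cube power2_eq_square)
  also have "\<dots> \<le> (1 - (1 + \<eta>\<^sup>2) * (1 - \<eta>)\<^sup>2) / (2 * \<eta>) * ((1 - \<eta>)\<^sup>2 * q)"
  proof (rule mult_right_mono)
    have "(1 - (1 + \<eta>\<^sup>2) * (1 - \<eta>)\<^sup>2) / (2 * \<eta>) = 1 - \<eta> + \<eta>\<^sup>2 * (1 - \<eta> / 2)"
      using \<eta> by (simp add: divide_simps) (simp add: power2_eq_square algebra_simps)
    moreover have "0 \<le> \<eta>\<^sup>2 * (1 - \<eta> / 2)" using \<eta> by simp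
    ultimately show "1 - \<eta> \<le> (1 - (1 + \<eta>\<^sup>2) * (1 - \<eta>)\<^sup>2) / (2 * \<eta>)" by simp
  qed (use q in simp)
  also have "\<dots> \<le> \<kappa>"
    using slope_ge[OF As k y2c] by (simp add: \<kappa>_def y2q)
  finally have \<kappa>: "(1 - \<eta>)^3 * q \<le> \<kappa>" .
  moreover have "0 \<le> (1 - \<eta>)^3 * q" using q \<eta> by simp
  ultimately have \<kappa>0: "0 \<le> \<kappa>" by linarith
  define u where "u = \<eta> * y1"
  have u: "0 \<le> u" "(1 + u) * exp (- u) \<le> \<eta>"
    using u0 y1 \<eta> by (auto simp: u_def y1_def mult.assoc)
  have "(1 - \<eta>)^4 * q * cdf M m = cdf M m * (((1 - \<eta>)^3 * q) * (1 - \<eta>))"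
    by (simp add: eval_nat_numeral)
  also have "\<dots> \<le> cdf M m * (\<kappa> * (1 - (1 + u) * exp (- u)))"
    using \<kappa> \<kappa>0 u \<eta> cdf_nonneg by (intro mult_left_mono mult_mono) auto
  also have "\<dots> \<le> exceedance M m"
    unfolding \<kappa>_def
  proof (rule exceedance_ge_slope)
    show "m + u \<le> - y2" using m by (simp add: y2_def u_def y1_def algebra_simps)
    show "(1 - \<eta>) * y2 < y2" using y2 \<eta> by simp
  qed (use \<kappa>0 u in \<open>auto simp: \<kappa>_def\<close>)
  finally show ?thesis by (simp add: q_def)
qed

end

section \<open>Asymptotics uniform in the law of the sample\<close>

text \<open>
  The numerical assumptions express that \<open>n\<close> and \<open>s\<close> are large and \<open>\<theta> / s\<close> is small. The first of the smallness
  conditions makes the minimum fall below \<open>- (1 + \<eta>) \<theta> s\<close> too rarely to matter, the second one does the same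
  for \<open>- c s\<^sup>2 / 2\<close>; \<open>typical\<close> says that the minimum rarely stays above \<open>- (1 - \<eta>) \<theta> s\<close>.
\<close>

lemma softmin_excess_bounds:
  fixes M :: "'a measure" and X :: "'i \<Rightarrow> 'a \<Rightarrow> real"
  assumes "iid_sample M X I \<nu>" and "log_concave_gaussian_tail \<nu> s C \<eta> A c"
  defines "n \<equiv> real (card I)" and "\<theta> \<equiv> sqrt (2 * ln (real (card I)))"
  assumes \<theta>: "4 * A \<le> \<theta>" "4 * \<theta> \<le> c * s" "2 * \<theta> \<le> \<eta> * s"
    and window: "(1 + \<eta> * (1 - \<eta>) * \<theta> * s) * exp (- (\<eta> * (1 - \<eta>) * \<theta> * s)) \<le> \<eta>"
    and typical: "n * exp (- ((n - 1) * exp (- ((1 - \<eta>) * ln n)))) \<le> \<eta>"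
    and small: "10 * exp (- (2 * \<eta> * \<theta>\<^sup>2)) \<le> \<eta>" "s * exp (- (c\<^sup>2 * s\<^sup>2 / 16)) \<le> \<eta>"
  shows "prob_space.expectation M (\<lambda>\<omega>. softmin_excess (\<lambda>i. X i \<omega>) I) \<le> (1 + 12 * \<eta>) * (\<theta> / s)"
    and "(1 - \<eta>)^5 * (\<theta> / s) \<le> prob_space.expectation M (\<lambda>\<omega>. softmin_excess (\<lambda>i. X i \<omega>) I)"
proof -
  interpret iid_sample M X I \<nu> by fact
  interpret \<nu>: log_concave_gaussian_tail \<nu> s C \<eta> A c by fact
  note s_pos = \<nu>.s_pos and \<eta> = \<nu>.\<eta> and A = \<nu>.A and c = \<nu>.c
  define q where "q = \<theta> / s"
  have \<theta>1: "4 \<le> \<theta>" using \<theta>(1) A by linarith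
  have q: "0 < q" using \<theta>1 s_pos by (simp add: q_def)
  have n2: "2 \<le> n" using card2 by (simp add: n_def)
  \<comment> \<open>All powers of \<open>n\<close> are expressed through \<open>\<theta>\<close>, to be compared with the tail bounds.\<close>
  have ln_n: "ln n = \<theta>\<^sup>2 / 2" using n2 by (simp add: \<theta>_def n_def)
  then have "exp (\<theta>\<^sup>2 / 2) = n" using n2 by (metis exp_ln less_le_trans zero_less_numeral)
  then have n_sq: "n\<^sup>2 = exp (\<theta>\<^sup>2)" using exp_double[of "\<theta>\<^sup>2 / 2"] by simp
  show "expectation excess \<le> (1 + 12 * \<eta>) * (\<theta> / s)"
  proof -
    define y0 where "y0 = (1 + \<eta>) * \<theta> * s"
    let ?b = "10 * q * exp (- ((1 + \<eta>)\<^sup>2 * \<theta>\<^sup>2 / 2))"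
    have "expectation excess \<le> (1 + 10 * \<eta>) * q + n\<^sup>2 * ?b * cdf \<nu> (- y0) + n\<^sup>2 * cdf \<nu> (- (c * s\<^sup>2 / 2))"
      unfolding n_def y0_def
    proof (rule expectation_softmin_excess_le)
      show "0 \<le> ?b" using q by simp
      show "exceedance \<nu> m \<le> (1 + 10 * \<eta>) * q * cdf \<nu> m + ?b * indicator {..< - ((1 + \<eta>) * \<theta> * s)} m
          + indicator {..< - (c * s\<^sup>2 / 2)} m" for m
        unfolding q_def using \<theta> A by (intro \<nu>.exceedance_upper_bound) auto
    qed
    \<comment> \<open>Both factors \<open>exp (- (1 + \<eta>)\<^sup>2 \<theta>\<^sup>2 / 2)\<close> are needed to beat \<open>n\<^sup>2 = exp (\<theta>\<^sup>2)\<close>.\<close>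
    also have "n\<^sup>2 * ?b * cdf \<nu> (- y0) \<le> \<eta> * q"
    proof -
      have "cdf \<nu> (- y0) \<le> exp (- (y0\<^sup>2 / (2 * s\<^sup>2)))"
        using \<eta> \<theta>1 s_pos by (intro \<nu>.left_tail_le) (simp add: y0_def)
      also have "y0\<^sup>2 / (2 * s\<^sup>2) = (1 + \<eta>)\<^sup>2 * \<theta>\<^sup>2 / 2" using s_pos by (simp add: y0_def power_mult_distrib)
      finally have "n\<^sup>2 * ?b * cdf \<nu> (- y0) \<le> n\<^sup>2 * ?b * exp (- ((1 + \<eta>)\<^sup>2 * \<theta>\<^sup>2 / 2))"
        using q by (intro mult_left_mono) auto
      also have "\<dots> = 10 * q * exp (\<theta>\<^sup>2 - (1 + \<eta>)\<^sup>2 * \<theta>\<^sup>2)"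
        by (simp add: n_sq exp_add[symmetric])
      also have "\<dots> \<le> 10 * q * exp (- (2 * \<eta> * \<theta>\<^sup>2))"
        using q \<eta> by (intro mult_left_mono) (auto simp: power2_eq_square algebra_simps)
      also have "\<dots> \<le> \<eta> * q" using mult_right_mono[OF small(1), of q] q by (simp add: mult_ac)
      finally show ?thesis .
    qed
    also have "n\<^sup>2 * cdf \<nu> (- (c * s\<^sup>2 / 2)) \<le> \<eta> * q"
    proof -
      have "cdf \<nu> (- (c * s\<^sup>2 / 2)) \<le> exp (- ((c * s\<^sup>2 / 2)\<^sup>2 / (2 * s\<^sup>2)))"
        using c by (intro \<nu>.left_tail_le) auto
      also have "(c * s\<^sup>2 / 2)\<^sup>2 / (2 * s\<^sup>2) = c\<^sup>2 * s\<^sup>2 / 8"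
        using s_pos by (simp add: power2_eq_square)
      finally have "n\<^sup>2 * cdf \<nu> (- (c * s\<^sup>2 / 2)) \<le> exp (\<theta>\<^sup>2) * exp (- (c\<^sup>2 * s\<^sup>2 / 8))"
        unfolding n_sq by (intro mult_left_mono) auto
      also have "\<dots> = exp (\<theta>\<^sup>2 - c\<^sup>2 * s\<^sup>2 / 8)" by (simp add: exp_add[symmetric])
      finally have "n\<^sup>2 * cdf \<nu> (- (c * s\<^sup>2 / 2)) \<le> exp (\<theta>\<^sup>2 - c\<^sup>2 * s\<^sup>2 / 8)" .
      also have "\<dots> \<le> exp (- (c\<^sup>2 * s\<^sup>2 / 16))"
      proof -
        have "(4 * \<theta>)\<^sup>2 \<le> (c * s)\<^sup>2" using \<theta>(2) \<theta>1 by (intro power_mono) auto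
        then show ?thesis by (simp add: power_mult_distrib)
      qed
      also have "\<dots> \<le> \<eta> / s" using small(2) s_pos by (simp add: field_simps)
      also have "\<dots> \<le> \<eta> * q" using \<theta>1 \<eta> s_pos by (simp add: q_def field_simps)
      finally show ?thesis .
    qed
    finally show ?thesis by (simp add: q_def algebra_simps)
  qed
  show "(1 - \<eta>)^5 * (\<theta> / s) \<le> expectation excess"
  proof -
    define y1 where "y1 = (1 - \<eta>) * \<theta> * s"
    define p where "p = cdf \<nu> (- y1)"
    have "(1 - \<eta>)^4 * q * (1 - n * (1 - p) ^ (card I - 1)) \<le> expectation excess"
      unfolding n_def p_def
    proof (rule expectation_softmin_excess_ge)
      show "(1 - \<eta>)^4 * q * cdf \<nu> m \<le> exceedance \<nu> m" if "m \<le> - y1" for m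
        unfolding q_def using \<theta> \<theta>1 window that by (intro \<nu>.exceedance_lower_bound) (auto simp: y1_def)
    qed (use q in simp)
    \<comment> \<open>Since \<open>p\<close> is at least \<open>n\<close> to the power \<open>- (1 - \<eta>)\<close>, the \<open>n - 1\<close> other points rarely all exceed \<open>- y1\<close>.\<close>
    moreover have "n * (1 - p) ^ (card I - 1) \<le> \<eta>"
    proof -
      have p_ge: "exp (- ((1 - \<eta>) * ln n)) \<le> p"
      proof -
        have "A * s \<le> y1"
        proof -
          have "1/2 * \<theta> \<le> (1 - \<eta>) * \<theta>" using \<eta> \<theta>1 by (intro mult_right_mono) auto
          then have "A \<le> (1 - \<eta>) * \<theta>" using \<theta>(1) A by linarith
          then show ?thesis unfolding y1_def using s_pos by (intro mult_right_mono) auto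
        qed
        moreover have "y1 \<le> c * s\<^sup>2"
        proof -
          have "(1 - \<eta>) * \<theta> \<le> 1 * \<theta>" using \<eta> \<theta>1 by (intro mult_right_mono) auto
          then have "(1 - \<eta>) * \<theta> \<le> c * s" using \<theta> \<theta>1 by linarith
          then have "y1 \<le> c * s * s" unfolding y1_def using s_pos by (intro mult_right_mono) auto
          then show ?thesis by (simp add: power2_eq_square mult.assoc)
        qed
        ultimately have "exp (- ((1 + \<eta>\<^sup>2) * (y1\<^sup>2 / (2 * s\<^sup>2)))) \<le> p"
          unfolding p_def by (rule \<nu>.tail_ge)
        moreover have "y1\<^sup>2 / (2 * s\<^sup>2) = (1 - \<eta>)\<^sup>2 * ln n"
          using s_pos by (simp add: y1_def power_mult_distrib ln_n)
        moreover have "(1 + \<eta>\<^sup>2) * ((1 - \<eta>)\<^sup>2 * ln n) \<le> (1 - \<eta>) * ln n"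
        proof -
          have "(1 + \<eta>\<^sup>2) * (1 - \<eta>) \<le> 1"
          proof -
            have "\<eta>\<^sup>2 \<le> \<eta>" using \<eta> by (simp add: power2_eq_square)
            moreover have "0 \<le> \<eta>\<^sup>2 * \<eta>" using \<eta> by simp
            ultimately show ?thesis by (simp add: algebra_simps)
          qed
          then have "(1 + \<eta>\<^sup>2) * (1 - \<eta>) * ((1 - \<eta>) * ln n) \<le> 1 * ((1 - \<eta>) * ln n)"
            using \<eta> n2 by (intro mult_right_mono mult_nonneg_nonneg) auto
          then show ?thesis by (simp add: power2_eq_square mult.assoc)
        qed
        ultimately show ?thesis by (smt (verit) exp_le_cancel_iff)
      qed
      have "1 - p \<le> exp (- p)" using exp_ge_add_one_self[of "- p"] by simp
      moreover have "p \<le> 1" using cdf_range(2) by (simp add: p_def)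
      ultimately have "(1 - p) ^ (card I - 1) \<le> exp (- p) ^ (card I - 1)" by (intro power_mono) auto
      also have "\<dots> = exp (- ((n - 1) * p))"
        using card2 by (simp add: exp_of_nat_mult[symmetric] n_def of_nat_diff)
      also have "\<dots> \<le> exp (- ((n - 1) * exp (- ((1 - \<eta>) * ln n))))"
        using p_ge n2 by (auto intro!: mult_left_mono)
      finally have "n * (1 - p) ^ (card I - 1) \<le> n * exp (- ((n - 1) * exp (- ((1 - \<eta>) * ln n))))"
        using n2 by (intro mult_left_mono) auto
      then show ?thesis using typical by simp
    qed
    then have "(1 - \<eta>)^4 * q * (1 - \<eta>) \<le> (1 - \<eta>)^4 * q * (1 - n * (1 - p) ^ (card I - 1))"
      using q by (intro mult_left_mono) auto
    moreover have "(1 - \<eta>)^5 * (\<theta> / s) = (1 - \<eta>)^4 * q * (1 - \<eta>)" by (simp add: q_def eval_nat_numeral)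
    ultimately show ?thesis by linarith
  qed
qed

lemma (in gaussian_left_tail) log_concave_gaussian_tailI:
  assumes "log_concave (cdf M)" and \<eta>: "0 < \<eta>" "\<eta> \<le> 1 / 4"
  shows "log_concave_gaussian_tail M s C \<eta> (40 / \<eta>\<^sup>2) ((\<eta>\<^sup>2 / 10)\<^sup>2 / (4 * (C + 1)))"
proof unfold_locales
  have \<eta>2: "\<eta>\<^sup>2 \<le> 1" using \<eta> by (simp add: power_le_one)
  show "1 \<le> 40 / \<eta>\<^sup>2" using \<eta> \<eta>2 by (simp add: field_simps)
  show "0 < (\<eta>\<^sup>2 / 10)\<^sup>2 / (4 * (C + 1))" using \<eta> C_nonneg by simp
  have "(\<eta>\<^sup>2 / 10)\<^sup>2 \<le> 1\<^sup>2" using \<eta>2 by (intro power_mono) auto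
  then have "(\<eta>\<^sup>2 / 10)\<^sup>2 / (4 * (C + 1)) \<le> 1 / 4" using C_nonneg by (intro frac_le) auto
  then show "(\<eta>\<^sup>2 / 10)\<^sup>2 / (4 * (C + 1)) \<le> 1 / 4" .
  fix y assume "40 / \<eta>\<^sup>2 * s \<le> y" "y \<le> (\<eta>\<^sup>2 / 10)\<^sup>2 / (4 * (C + 1)) * s\<^sup>2"
  then show "exp (- ((1 + \<eta>\<^sup>2) * (y\<^sup>2 / (2 * s\<^sup>2)))) \<le> cdf M (- y)"
    using left_tail_ge[of "\<eta>\<^sup>2 / 10" y] \<eta> \<eta>2 by simp
qed (use assms in auto)

text \<open>
  The thresholds \<open>N\<close>, \<open>R\<close> and \<open>\<rho>\<close> depend on the law only through \<open>C\<close>. This uniformity is what allows the law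
  to be random later on.
\<close>

lemma softmin_excess_asymptotics:
  fixes C \<epsilon> :: real
  assumes "0 \<le> C" "0 < \<epsilon>"
  shows "\<exists>N R \<rho>. 0 < \<rho> \<and> (\<forall>(M :: 'a measure) (X :: nat \<Rightarrow> 'a \<Rightarrow> real) n \<nu> s.
    iid_sample M X {1..n} \<nu> \<longrightarrow> gaussian_left_tail \<nu> s C \<longrightarrow> log_concave (cdf \<nu>) \<longrightarrow>
    N \<le> n \<longrightarrow> R \<le> s \<longrightarrow> sqrt (2 * ln (real n)) \<le> \<rho> * s \<longrightarrow>
    \<bar>prob_space.expectation M (\<lambda>\<omega>. softmin_excess (\<lambda>i. X i \<omega>) {1..n}) * (s / sqrt (2 * ln (real n))) - 1\<bar> \<le> \<epsilon>)"
proof -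
  \<comment> \<open>The factor 12 is the one in the upper bound of \<open>softmin_excess_bounds\<close>.\<close>
  define \<eta> where "\<eta> = min (1 / 4) (\<epsilon> / 12)"
  have \<eta>: "0 < \<eta>" "\<eta> \<le> 1 / 4" "12 * \<eta> \<le> \<epsilon>" using assms by (auto simp: \<eta>_def)
  define A where "A = 40 / \<eta>\<^sup>2"
  define c where "c = (\<eta>\<^sup>2 / 10)\<^sup>2 / (4 * (C + 1))"
  define \<rho> where "\<rho> = min (c / 4) (\<eta> / 2)"
  have c: "0 < c" using \<eta> assms by (simp add: c_def)
  have A: "0 < A" using \<eta> by (simp add: A_def)
  have \<rho>: "0 < \<rho>" using c \<eta> by (simp add: \<rho>_def)
  have "((\<lambda>u :: real. (1 + u) * exp (- u)) \<longlongrightarrow> 0) at_top" by real_asymp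
  then have "\<forall>\<^sub>F u in at_top. (1 + u) * exp (- u) < \<eta>" using \<eta>(1) by (rule order_tendstoD(2))
  then obtain u1 where u1: "\<And>u. u1 \<le> u \<Longrightarrow> (1 + u) * exp (- u) < \<eta>" by (auto simp: eventually_at_top_linorder)
  have "((\<lambda>s. s * exp (- (c\<^sup>2 * s\<^sup>2 / 16))) \<longlongrightarrow> 0) at_top" using c by real_asymp
  then have "\<forall>\<^sub>F s in at_top. s * exp (- (c\<^sup>2 * s\<^sup>2 / 16)) < \<eta>" using \<eta>(1) by (rule order_tendstoD(2))
  then obtain R1 where R1: "\<And>s. R1 \<le> s \<Longrightarrow> s * exp (- (c\<^sup>2 * s\<^sup>2 / 16)) < \<eta>" by (auto simp: eventually_at_top_linorder)
  have 1: "\<forall>\<^sub>F n in sequentially. 4 * A + 1 \<le> sqrt (2 * ln (real n))"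
    by real_asymp
  have 2: "\<forall>\<^sub>F n in sequentially. 10 * exp (- (2 * \<eta> * (2 * ln (real n)))) \<le> \<eta>"
    using \<eta> by real_asymp
  have 3: "\<forall>\<^sub>F n in sequentially. real n * exp (- ((real n - 1) * exp (- ((1 - \<eta>) * ln (real n))))) \<le> \<eta>"
  proof -
    have "((\<lambda>n. real n * exp (- (1 / 2 * exp (\<eta> * ln (real n))))) \<longlongrightarrow> 0) sequentially" using \<eta>(1) by real_asymp
    then have "\<forall>\<^sub>F n in sequentially. real n * exp (- (1 / 2 * exp (\<eta> * ln (real n)))) < \<eta>"
      using \<eta>(1) by (rule order_tendstoD(2))
    then show ?thesis using eventually_ge_at_top[of 2]
    proof eventually_elim
      case (elim n)
      have "exp (\<eta> * ln (real n)) = exp (ln (real n)) * exp (- ((1 - \<eta>) * ln (real n)))"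
        by (simp add: exp_add[symmetric] algebra_simps)
      then have "1 / 2 * exp (\<eta> * ln (real n)) = real n / 2 * exp (- ((1 - \<eta>) * ln (real n)))"
        using elim by simp
      also have "\<dots> \<le> (real n - 1) * exp (- ((1 - \<eta>) * ln (real n)))"
        using elim by (intro mult_right_mono) auto
      finally have "real n * exp (- ((real n - 1) * exp (- ((1 - \<eta>) * ln (real n)))))
          \<le> real n * exp (- (1 / 2 * exp (\<eta> * ln (real n))))"
        by (intro mult_left_mono) auto
      then show ?case using elim by linarith
    qed
  qed
  obtain N where N: "\<And>n. N \<le> n \<Longrightarrow> 4 * A + 1 \<le> sqrt (2 * ln (real n)) \<and>
      10 * exp (- (2 * \<eta> * (2 * ln (real n)))) \<le> \<eta> \<and>
      real n * exp (- ((real n - 1) * exp (- ((1 - \<eta>) * ln (real n))))) \<le> \<eta>"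
    using eventually_conj[OF 1 eventually_conj[OF 2 3]] by (auto simp: eventually_sequentially)
  define R where "R = max (max 1 R1) (u1 / (\<eta> * (1 - \<eta>)))"
  show ?thesis
  proof (intro exI conjI allI impI)
    fix M :: "'a measure" and X :: "nat \<Rightarrow> 'a \<Rightarrow> real" and n \<nu> s
    assume iid: "iid_sample M X {1..n} \<nu>" and tail: "gaussian_left_tail \<nu> s C" and lc: "log_concave (cdf \<nu>)"
      and n: "N \<le> n" and s: "R \<le> s" and le: "sqrt (2 * ln (real n)) \<le> \<rho> * s"
    define \<theta> where "\<theta> = sqrt (2 * ln (real n))"
    define E where "E = prob_space.expectation M (\<lambda>\<omega>. softmin_excess (\<lambda>i. X i \<omega>) {1..n})"
    have \<theta>1: "4 * A + 1 \<le> \<theta>" using N[OF n] by (simp add: \<theta>_def)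
    then have \<theta>_pos: "1 \<le> \<theta>" using A by linarith
    have \<theta>sq: "\<theta>\<^sup>2 = 2 * ln (real n)"
      using \<theta>_pos unfolding \<theta>_def by (metis less_le_trans less_eq_real_def real_sqrt_ge_0_iff real_sqrt_pow2 zero_less_one)
    have s1: "1 \<le> s" "R1 \<le> s" "u1 / (\<eta> * (1 - \<eta>)) \<le> s" using s by (auto simp: R_def)
    have u_le: "u1 \<le> \<eta> * (1 - \<eta>) * \<theta> * s"
    proof -
      have "u1 \<le> \<eta> * (1 - \<eta>) * s" using s1(3) \<eta> by (simp add: field_simps)
      also have "\<dots> \<le> \<eta> * (1 - \<eta>) * s * \<theta>" using \<theta>_pos \<eta> s1 by (intro mult_left_mono[of 1 \<theta>, simplified]) auto
      finally show ?thesis by (simp add: mult_ac)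
    qed
    have "\<rho> * s \<le> c / 4 * s" "\<rho> * s \<le> \<eta> / 2 * s" using s1 by (auto simp: \<rho>_def intro!: mult_right_mono)
    then have \<theta>_le: "4 * \<theta> \<le> c * s" "2 * \<theta> \<le> \<eta> * s" using le by (auto simp: \<theta>_def)
    have "log_concave_gaussian_tail \<nu> s C \<eta> A c"
      unfolding A_def c_def using tail lc \<eta> by (intro gaussian_left_tail.log_concave_gaussian_tailI)
    note bounds = softmin_excess_bounds[OF iid this]
    have "E \<le> (1 + 12 * \<eta>) * (\<theta> / s)" "(1 - \<eta>)^5 * (\<theta> / s) \<le> E"
      unfolding E_def \<theta>_def using bounds \<theta>1 \<theta>_le u1[OF u_le] R1[OF s1(2)] N[OF n] \<theta>sq
      by (auto simp: \<theta>_def less_imp_le)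
    moreover have "\<theta> / s * (s / \<theta>) = 1" using \<theta>_pos s1 by simp
    ultimately have "E * (s / \<theta>) \<le> 1 + 12 * \<eta>" "(1 - \<eta>)^5 \<le> E * (s / \<theta>)"
      using \<theta>_pos s1 by (simp_all add: field_simps)
    moreover have "1 + real 5 * (- \<eta>) \<le> (1 + (- \<eta>))^5" using \<eta> by (intro Bernoulli_inequality) auto
    ultimately show "\<bar>E * (s / \<theta>) - 1\<bar> \<le> \<epsilon>" using \<eta> by (simp add: abs_le_iff)
  qed (rule \<rho>)
qed

section \<open>Quadratic functions of Gaussian variables\<close>

lemma ln_one_plus_ge:
  fixes y :: real
  assumes "0 \<le> y"
  shows "y - y\<^sup>2 / 2 \<le> ln (1 + y)"
proof -
  let ?f = "\<lambda>y. ln (1 + y) - (y - y\<^sup>2 / 2)"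
  have "?f 0 \<le> ?f y"
  proof (rule DERIV_nonneg_imp_nondecreasing[OF assms])
    fix x :: real assume x: "0 \<le> x" "x \<le> y"
    have "(?f has_real_derivative 1 / (1 + x) - (1 - x)) (at x)"
      using x by (auto intro!: derivative_eq_intros)
    moreover have "1 / (1 + x) - (1 - x) = x\<^sup>2 / (1 + x)"
      using x by (simp add: field_simps power2_eq_square)
    ultimately show "\<exists>d. (?f has_real_derivative d) (at x) \<and> 0 \<le> d"
      using x by (intro exI[of _ "x\<^sup>2 / (1 + x)"]) auto
  qed
  then show ?thesis by simp
qed

lemma ln_one_plus_le:
  fixes y :: real
  assumes "0 \<le> y"
  shows "ln (1 + y) \<le> y - y\<^sup>2 / 2 + y ^ 3 / 3"
proof -
  let ?f = "\<lambda>y. (y - y\<^sup>2 / 2 + y ^ 3 / 3) - ln (1 + y)"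
  have "?f 0 \<le> ?f y"
  proof (rule DERIV_nonneg_imp_nondecreasing[OF assms])
    fix x :: real assume x: "0 \<le> x" "x \<le> y"
    have "(?f has_real_derivative (1 - x + x\<^sup>2) - 1 / (1 + x)) (at x)"
      using x by (auto intro!: derivative_eq_intros simp: power2_eq_square)
    moreover have "(1 - x + x\<^sup>2) - 1 / (1 + x) = x ^ 3 / (1 + x)"
      using x by (simp add: field_simps power2_eq_square power3_eq_cube)
    ultimately show "\<exists>d. (?f has_real_derivative d) (at x) \<and> 0 \<le> d"
      using x by (intro exI[of _ "x ^ 3 / (1 + x)"]) auto
  qed
  then show ?thesis by simp
qed

text \<open>
  Completing the square turns the integrand into a multiple of the normal density with mean \<open>b / (1 + 2 a)\<close>
  and variance \<open>1 / (1 + 2 a)\<close>.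
\<close>

lemma has_bochner_integral_std_normal_exp_quadratic:
  fixes a b :: real
  assumes "0 < 1 + 2 * a"
  shows "has_bochner_integral lborel (\<lambda>u. std_normal_density u * exp (b * u - a * u\<^sup>2))
    (exp (b\<^sup>2 / (2 * (1 + 2 * a))) / sqrt (1 + 2 * a))"
proof -
  define v where "v = 1 + 2 * a"
  have v: "0 < v" using assms by (simp add: v_def)
  define K where "K = exp (b\<^sup>2 / (2 * v)) / sqrt v"
  have eq: "std_normal_density u * exp (b * u - a * u\<^sup>2) = K * normal_density (b / v) (1 / sqrt v) u" for u
  proof -
    have "- u\<^sup>2 / 2 + (b * u - a * u\<^sup>2) = b\<^sup>2 / (2 * v) - (u - b / v)\<^sup>2 * v / 2"
    proof -
      have eq: "(u - b / v)\<^sup>2 * v = u\<^sup>2 * v - 2 * u * b + b\<^sup>2 / v"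
        using v by (simp add: power2_eq_square field_simps)
      have "- u\<^sup>2 / 2 + (b * u - a * u\<^sup>2) = (c - (u\<^sup>2 * v - 2 * u * b + c)) / 2" for c
        by (simp add: v_def field_simps)
      from this[of "b\<^sup>2 / v"] show ?thesis unfolding eq[symmetric] by (simp add: diff_divide_distrib)
    qed
    then have "exp (- u\<^sup>2 / 2) * exp (b * u - a * u\<^sup>2) = exp (b\<^sup>2 / (2 * v)) * exp (- ((u - b / v)\<^sup>2 * v / 2))"
      by (simp add: exp_add[symmetric])
    moreover have "normal_density (b / v) (1 / sqrt v) u = sqrt v / sqrt (2 * pi) * exp (- ((u - b / v)\<^sup>2 * v / 2))"
      using v by (simp add: normal_density_def power_divide real_sqrt_divide)
    ultimately show ?thesis
      using v by (simp add: std_normal_density_def K_def)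
  qed
  have "has_bochner_integral lborel (normal_density (b / v) (1 / sqrt v)) 1"
    using v by (simp add: has_bochner_integral_iff)
  then have "has_bochner_integral lborel (\<lambda>u. K * normal_density (b / v) (1 / sqrt v) u) (K * 1)"
    by (rule has_bochner_integral_mult_right)
  then show ?thesis unfolding eq by (simp add: K_def v_def)
qed

lemma (in prob_space) std_normal_exp_quadratic:
  assumes Z: "distributed M lborel Z std_normal_density" and "0 < 1 + 2 * a"
  shows "integrable M (\<lambda>\<omega>. exp (b * Z \<omega> - a * (Z \<omega>)\<^sup>2))"
    and "expectation (\<lambda>\<omega>. exp (b * Z \<omega> - a * (Z \<omega>)\<^sup>2)) = exp (b\<^sup>2 / (2 * (1 + 2 * a)) - ln (1 + 2 * a) / 2)"
proof -
  note * = has_bochner_integral_std_normal_exp_quadratic[OF assms(2), of b, unfolded has_bochner_integral_iff]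
  show "integrable M (\<lambda>\<omega>. exp (b * Z \<omega> - a * (Z \<omega>)\<^sup>2))"
    using distributed_integrable[OF Z, of "\<lambda>u. exp (b * u - a * u\<^sup>2)"] * by simp
  have "exp (ln (1 + 2 * a) / 2) = sqrt (1 + 2 * a)"
    using assms(2) by (simp add: ln_sqrt[symmetric])
  then show "expectation (\<lambda>\<omega>. exp (b * Z \<omega> - a * (Z \<omega>)\<^sup>2)) = exp (b\<^sup>2 / (2 * (1 + 2 * a)) - ln (1 + 2 * a) / 2)"
    using distributed_integral[OF Z, of "\<lambda>u. exp (b * u - a * u\<^sup>2)"] * by (simp add: exp_diff)
qed

text \<open>
  This equals \<open>w ((m - u)\<^sup>2 - (1 + m\<^sup>2))\<close>, the summand in the numerator of \<open>S\<close> once \<open>W\<close> is replaced by \<open>mu - U\<close>.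
\<close>

definition quad :: "real \<Rightarrow> real \<Rightarrow> real \<Rightarrow> real" where
  "quad w m u = w * (u\<^sup>2 - 1 - 2 * m * u)"

lemma quad_measurable [measurable]: "quad w m \<in> borel_measurable borel"
  unfolding quad_def[abs_def] by measurable

lemma convex_quad:
  assumes "0 \<le> w"
  shows "convex_on UNIV (quad w m)"
proof (rule convex_onI)
  fix t x y :: real assume t: "0 < t" "t < 1"
  have "(1 - t) * quad w m x + t * quad w m y - quad w m ((1 - t) * x + t * y) = w * (t * (1 - t) * (x - y)\<^sup>2)"
    by (simp add: quad_def power2_eq_square algebra_simps)
  moreover have "0 \<le> w * (t * (1 - t) * (x - y)\<^sup>2)" using assms t by simp
  ultimately show "quad w m ((1 - t) *\<^sub>R x + t *\<^sub>R y) \<le> (1 - t) * quad w m x + t * quad w m y" by simp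
qed simp

text \<open>
  The logarithm of the Laplace transform at \<open>t\<close> of \<open>quad w m\<close> of a standard normal variable.
\<close>

definition quad_cumulant :: "real \<Rightarrow> real \<Rightarrow> real \<Rightarrow> real" where
  "quad_cumulant w m t = t * w + 2 * (t * w)\<^sup>2 * m\<^sup>2 / (1 + 2 * (t * w)) - ln (1 + 2 * (t * w)) / 2"

lemma (in prob_space) laplace_quad:
  assumes Z: "distributed M lborel Z std_normal_density" and "0 \<le> w" "0 \<le> t"
  shows "integrable M (\<lambda>\<omega>. exp (- (t * quad w m (Z \<omega>))))"
    and "expectation (\<lambda>\<omega>. exp (- (t * quad w m (Z \<omega>)))) = exp (quad_cumulant w m t)"
proof -
  have "0 \<le> t * w" using assms by simp
  then have pos: "0 < 1 + 2 * (t * w)" by linarith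
  have eq: "exp (- (t * quad w m u)) = exp (t * w) * exp (2 * (t * w) * m * u - (t * w) * u\<^sup>2)" for u
    by (simp add: quad_def exp_add[symmetric] algebra_simps)
  note * = std_normal_exp_quadratic[OF Z pos, of "2 * (t * w) * m"]
  show "integrable M (\<lambda>\<omega>. exp (- (t * quad w m (Z \<omega>))))" unfolding eq using *(1) by simp
  have "(2 * x * m)\<^sup>2 / (2 * y) = 2 * x\<^sup>2 * m\<^sup>2 / y" for x y :: real
    by (simp add: power_mult_distrib)
  note e = *(2)[unfolded this]
  have "expectation (\<lambda>\<omega>. exp (- (t * quad w m (Z \<omega>)))) =
      exp (t * w) * expectation (\<lambda>\<omega>. exp (2 * (t * w) * m * Z \<omega> - (t * w) * (Z \<omega>)\<^sup>2))"
    unfolding eq by simp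
  then show "expectation (\<lambda>\<omega>. exp (- (t * quad w m (Z \<omega>)))) = exp (quad_cumulant w m t)"
    unfolding e by (simp add: quad_cumulant_def exp_add[symmetric] add_diff_eq)
qed

text \<open>
  With \<open>x = t w\<close>, the expansion of \<open>ln (1 + 2 x)\<close> gives the leading term \<open>x\<^sup>2 (1 + 2 m\<^sup>2)\<close>. The relative error
  \<open>2 x\<close> does not involve \<open>m\<close>, which keeps later estimates uniform in the hidden variables.
\<close>

lemma quad_cumulant_bounds:
  assumes "0 \<le> w" "0 \<le> t"
  shows "quad_cumulant w m t \<le> t\<^sup>2 * (w\<^sup>2 * (1 + 2 * m\<^sup>2))"
    and "t\<^sup>2 * (w\<^sup>2 * (1 + 2 * m\<^sup>2)) * (1 - 2 * (t * w)) \<le> quad_cumulant w m t"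
proof -
  define x where "x = t * w"
  have x: "0 \<le> x" using assms by (simp add: x_def)
  have xx: "t\<^sup>2 * (w\<^sup>2 * (1 + 2 * m\<^sup>2)) = x\<^sup>2 + 2 * x\<^sup>2 * m\<^sup>2" by (simp add: x_def power_mult_distrib algebra_simps)
  have l1: "2 * x - (2 * x)\<^sup>2 / 2 \<le> ln (1 + 2 * x)" and l2: "ln (1 + 2 * x) \<le> 2 * x - (2 * x)\<^sup>2 / 2 + (2 * x) ^ 3 / 3"
    using ln_one_plus_ge[of "2 * x"] ln_one_plus_le[of "2 * x"] x by auto
  have "2 * x\<^sup>2 * m\<^sup>2 / (1 + 2 * x) \<le> 2 * x\<^sup>2 * m\<^sup>2 / 1" using x by (intro divide_left_mono) auto
  moreover have "x - ln (1 + 2 * x) / 2 \<le> x\<^sup>2" using l1 by (simp add: power_mult_distrib)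
  ultimately show "quad_cumulant w m t \<le> t\<^sup>2 * (w\<^sup>2 * (1 + 2 * m\<^sup>2))"
    unfolding xx by (simp add: quad_cumulant_def x_def[symmetric])
  have "x\<^sup>2 * (1 - 2 * x) \<le> x - ln (1 + 2 * x) / 2"
  proof -
    have "0 \<le> x ^ 3" using x by simp
    then show ?thesis using l2 by (simp add: power_mult_distrib algebra_simps power2_eq_square power3_eq_cube)
  qed
  moreover have "2 * x\<^sup>2 * m\<^sup>2 * (1 - 2 * x) \<le> 2 * x\<^sup>2 * m\<^sup>2 * (1 / (1 + 2 * x))"
  proof (rule mult_left_mono)
    have "(1 - 2 * x) * (1 + 2 * x) \<le> 1" by (simp add: algebra_simps)
    then show "1 - 2 * x \<le> 1 / (1 + 2 * x)" using x by (simp add: pos_le_divide_eq)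
  qed simp
  ultimately show "t\<^sup>2 * (w\<^sup>2 * (1 + 2 * m\<^sup>2)) * (1 - 2 * (t * w)) \<le> quad_cumulant w m t"
    unfolding xx by (simp add: quad_cumulant_def x_def[symmetric] algebra_simps)
qed

lemma (in prob_space) laplace_quad_sum:
  fixes Z :: "'i \<Rightarrow> 'a \<Rightarrow> real"
  assumes J: "finite J" and ind: "indep_vars (\<lambda>_. borel) Z J"
    and Z: "\<And>j. j \<in> J \<Longrightarrow> distributed M lborel (Z j) std_normal_density"
    and w: "\<And>j. j \<in> J \<Longrightarrow> 0 \<le> w j" and t: "0 \<le> t"
  shows "integrable M (\<lambda>\<omega>. exp (- (t * (\<Sum>j\<in>J. quad (w j) (m j) (Z j \<omega>)))))"
    and "expectation (\<lambda>\<omega>. exp (- (t * (\<Sum>j\<in>J. quad (w j) (m j) (Z j \<omega>))))) = exp (\<Sum>j\<in>J. quad_cumulant (w j) (m j) t)"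
proof -
  have eq: "exp (- (t * (\<Sum>j\<in>J. quad (w j) (m j) (Z j \<omega>)))) = (\<Prod>j\<in>J. exp (- (t * quad (w j) (m j) (Z j \<omega>))))" for \<omega>
    by (simp add: sum_distrib_left exp_sum[OF J, symmetric] sum_negf)
  have iv: "indep_vars (\<lambda>_. borel) (\<lambda>j \<omega>. exp (- (t * quad (w j) (m j) (Z j \<omega>)))) J"
    by (rule indep_vars_compose2[OF ind]) measurable
  have int: "integrable M (\<lambda>\<omega>. exp (- (t * quad (w j) (m j) (Z j \<omega>))))" if "j \<in> J" for j
    using laplace_quad(1)[OF Z w t] that by simp
  show "integrable M (\<lambda>\<omega>. exp (- (t * (\<Sum>j\<in>J. quad (w j) (m j) (Z j \<omega>)))))"
    unfolding eq using indep_vars_integrable[OF J iv int] by simp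
  have "expectation (\<lambda>\<omega>. \<Prod>j\<in>J. exp (- (t * quad (w j) (m j) (Z j \<omega>)))) = (\<Prod>j\<in>J. exp (quad_cumulant (w j) (m j) t))"
    using indep_vars_lebesgue_integral[OF J iv int] laplace_quad(2)[OF Z w t] by simp
  then show "expectation (\<lambda>\<omega>. exp (- (t * (\<Sum>j\<in>J. quad (w j) (m j) (Z j \<omega>))))) = exp (\<Sum>j\<in>J. quad_cumulant (w j) (m j) t)"
    unfolding eq by (simp add: exp_sum[OF J])
qed

lemma (in prob_space) std_normal_null_finite:
  assumes Z: "distributed M lborel Z std_normal_density" and "finite B"
  shows "prob {\<omega>\<in>space M. Z \<omega> \<in> B} = 0"
proof -
  have B: "B \<in> sets lborel" "B \<in> null_sets lborel"
    using assms(2) by (auto intro: finite_imp_null_set_lborel finite_imp_closed borel_closed)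
  have "emeasure M (Z -` B \<inter> space M) = (\<integral>\<^sup>+x. ennreal (std_normal_density x) * indicator B x \<partial>lborel)"
    using distributed_emeasure[OF Z B(1)] by simp
  also have "\<dots> = 0"
  proof -
    have "AE x in lborel. ennreal (std_normal_density x) * indicator B x = 0"
      using AE_not_in[OF B(2)] by eventually_elim simp
    then show ?thesis by (subst nn_integral_cong_AE) auto
  qed
  finally show ?thesis by (simp add: measure_def vimage_def Int_def conj_commute)
qed

lemma finite_quad_level:
  assumes "0 < w"
  shows "finite {u. quad w m u = x}"
proof -
  have "{u. quad w m u = x} = {u. poly [:- w - x, - 2 * w * m, w:] u = 0}"
    by (auto simp: quad_def power2_eq_square algebra_simps)
  also have "finite \<dots>" using assms by (intro poly_roots_finite) auto
  finally show ?thesis .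
qed

text \<open>
  With all coordinates but one frozen, the sum takes a given value only if the last coordinate is a root
  of a quadratic polynomial.
\<close>

lemma (in prob_space) quad_sum_no_atoms:
  fixes Z :: "'i \<Rightarrow> 'a \<Rightarrow> real"
  assumes J: "finite J" "J \<noteq> {}" and ind: "indep_vars (\<lambda>_. borel) Z J"
    and Z: "\<And>j. j \<in> J \<Longrightarrow> distributed M lborel (Z j) std_normal_density"
    and w: "\<And>j. j \<in> J \<Longrightarrow> 0 < w j"
  shows "prob {\<omega>\<in>space M. (\<Sum>j\<in>J. quad (w j) (m j) (Z j \<omega>)) = x} = 0"
proof -
  obtain i where i: "i \<in> J" using J by auto
  define J' where "J' = J - {i}"
  have J': "finite J'" "i \<notin> J'" "insert i J' = J" using J i by (auto simp: J'_def)
  define R where "R \<omega> = (\<Sum>j\<in>J'. quad (w j) (m j) (Z j \<omega>))" for \<omega>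
  have iv: "indep_var borel R borel (Z i)"
  proof -
    have "indep_var borel ((\<lambda>f. \<Sum>j\<in>J'. quad (w j) (m j) (f j)) \<circ> (\<lambda>\<omega>. restrict (\<lambda>i. Z i \<omega>) J'))
        borel ((\<lambda>f. f i) \<circ> (\<lambda>\<omega>. restrict (\<lambda>i. Z i \<omega>) {i}))"
      using J' by (intro indep_var_compose[OF indep_var_restrict[OF ind]]) auto
    then show ?thesis by (simp add: comp_def R_def[abs_def])
  qed
  have "prob {\<omega>\<in>space M. (\<Sum>j\<in>J. quad (w j) (m j) (Z j \<omega>)) = x}
      = prob {\<omega>\<in>space M. (case (R \<omega>, Z i \<omega>) of (r, z) \<Rightarrow> r + quad (w i) (m i) z = x)}"
    using J' unfolding J'(3)[symmetric] by (simp add: R_def add.commute)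
  also have "\<dots> = expectation (\<lambda>\<omega>. prob {\<omega>'\<in>space M. (case (R \<omega>, Z i \<omega>') of (r, z) \<Rightarrow> r + quad (w i) (m i) z = x)})"
    by (rule prob_indep_iterated[OF iv]) measurable
  also have "\<dots> = expectation (\<lambda>\<omega>. prob {\<omega>'\<in>space M. Z i \<omega>' \<in> {u. quad (w i) (m i) u = x - R \<omega>}})"
    by (simp add: algebra_simps eq_diff_eq)
  also have "\<dots> = 0"
    using std_normal_null_finite[OF Z[OF i] finite_quad_level[OF w[OF i]]] by simp
  finally show ?thesis .
qed

text \<open>
  The hypotheses on the common law of the sample: a Gaussian left tail with the true variance of the sum,
  log-concavity, and the absence of atoms.
\<close>

lemma (in prob_space) quad_sum_gaussian_left_tail:
  fixes Z :: "'i \<Rightarrow> 'a \<Rightarrow> real" and m :: "'i \<Rightarrow> real"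
  assumes J: "finite J" "J \<noteq> {}" and ind: "indep_vars (\<lambda>_. borel) Z J"
    and Z: "\<And>j. j \<in> J \<Longrightarrow> distributed M lborel (Z j) std_normal_density"
    and w: "\<And>j. j \<in> J \<Longrightarrow> 0 < w j" "\<And>j. j \<in> J \<Longrightarrow> w j \<le> \<Lambda>"
  defines "X \<equiv> \<lambda>\<omega>. \<Sum>j\<in>J. quad (w j) (m j) (Z j \<omega>)"
  shows "gaussian_left_tail (distr M borel X) (sqrt (2 * (\<Sum>j\<in>J. (w j)\<^sup>2 * (1 + 2 * (m j)\<^sup>2)))) (2 * \<Lambda>)"
    and "log_concave (cdf (distr M borel X))"
    and "measure (distr M borel X) {x} = 0"
proof -
  have [measurable]: "random_variable borel (Z j)" if "j \<in> J" for j
    using ind that by (auto simp: indep_vars_def)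
  have X [measurable]: "random_variable borel X" unfolding X_def by measurable
  have cdf: "cdf (distr M borel X) = (\<lambda>x. prob {\<omega>\<in>space M. (\<Sum>j\<in>J. quad (w j) (m j) (Z j \<omega>)) \<le> x})"
    unfolding cdf_def by (subst measure_distr) (auto simp: X_def intro!: ext arg_cong[where f = prob])
  show "log_concave (cdf (distr M borel X))"
    unfolding cdf using w by (intro log_concave_cdf_convex_sum J ind Z convex_quad) (auto intro: less_imp_le)
  show "measure (distr M borel X) {x} = 0"
    using quad_sum_no_atoms[OF J ind Z w(1), where m = m and x = x]
    by (subst measure_distr) (auto simp: X_def vimage_def Int_def conj_commute)
  define s2 where "s2 = 2 * (\<Sum>j\<in>J. (w j)\<^sup>2 * (1 + 2 * (m j)\<^sup>2))"
  have "w j \<noteq> 0" if "j \<in> J" for j using w(1)[OF that] by simp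
  then have s2: "0 < s2" unfolding s2_def using J
    by (auto intro!: sum_pos mult_pos_pos add_pos_nonneg)
  then have sq: "(sqrt s2)\<^sup>2 = s2" by simp
  obtain j where "j \<in> J" using J by auto
  then have \<Lambda>: "0 \<le> \<Lambda>" using w[of j] by simp
  interpret D: prob_space "distr M borel X" by (rule prob_space_distr) simp
  show "gaussian_left_tail (distr M borel X) (sqrt s2) (2 * \<Lambda>)"
  proof (unfold_locales, goal_cases)
    case (4 t)
    have "integrable M (\<lambda>\<omega>. exp (- (t * X \<omega>)))"
      using laplace_quad_sum(1)[OF J(1) ind Z _ 4, where w = w and m = m] w by (simp add: X_def less_imp_le)
    then show ?case by (subst integrable_distr_eq) auto
  next
    case (5 t)
    have "(\<Sum>j\<in>J. quad_cumulant (w j) (m j) t) \<le> (\<Sum>j\<in>J. t\<^sup>2 * ((w j)\<^sup>2 * (1 + 2 * (m j)\<^sup>2)))"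
      using w 5 by (intro sum_mono quad_cumulant_bounds) (auto intro: less_imp_le)
    also have "\<dots> = t\<^sup>2 * (sqrt s2)\<^sup>2 / 2" unfolding sq by (simp add: s2_def sum_distrib_left[symmetric])
    finally show ?case
      using laplace_quad_sum(2)[OF J(1) ind Z _ 5, where w = w and m = m] w
      by (subst integral_distr) (auto simp: X_def less_imp_le)
  next
    case (6 t)
    have "t\<^sup>2 * (sqrt s2)\<^sup>2 / 2 * (1 - 2 * \<Lambda> * t) = (\<Sum>j\<in>J. t\<^sup>2 * ((w j)\<^sup>2 * (1 + 2 * (m j)\<^sup>2)) * (1 - 2 * \<Lambda> * t))"
      unfolding sq by (simp add: s2_def sum_distrib_left[symmetric] sum_distrib_right[symmetric])
    also have "\<dots> \<le> (\<Sum>j\<in>J. t\<^sup>2 * ((w j)\<^sup>2 * (1 + 2 * (m j)\<^sup>2)) * (1 - 2 * (t * w j)))"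
      using w(2) 6 by (intro sum_mono mult_left_mono) (auto simp: mult.commute[of t] intro!: mult_right_mono mult_nonneg_nonneg)
    also have "\<dots> \<le> (\<Sum>j\<in>J. quad_cumulant (w j) (m j) t)"
      using w 6 by (intro sum_mono quad_cumulant_bounds) (auto intro: less_imp_le)
    finally show ?case
      using laplace_quad_sum(2)[OF J(1) ind Z _ 6, where w = w and m = m] w
      by (subst integral_distr) (auto simp: X_def less_imp_le)
  qed (use s2 \<Lambda> in auto)
qed

section \<open>The particle filter conditionally on its hidden variables\<close>

lemma (in prob_space) indep_vars_blocks:
  assumes "indep_vars (\<lambda>_. borel) X I" and "\<And>l. l \<in> L \<Longrightarrow> K l \<subseteq> I" and "disjoint_family_on K L"
    and "\<And>l. l \<in> L \<Longrightarrow> G l \<in> borel_measurable (PiM (K l) (\<lambda>_. borel))"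
  shows "indep_vars (\<lambda>_. borel) (\<lambda>l \<omega>. G l (\<lambda>i\<in>K l. X i \<omega>)) L"
  using indep_vars_compose2[OF indep_vars_restrict[OF assms(1-3)] assms(4)] by simp

definition cond_sd :: "(nat \<Rightarrow> real) \<Rightarrow> nat \<Rightarrow> (nat \<Rightarrow> real) \<Rightarrow> real" where
  "cond_sd lam d m = sqrt (2 * (\<Sum>j=1..d. (lam j)^4 * (1 + 2 * (m j)\<^sup>2)))"

definition potential :: "(nat \<Rightarrow> real) \<Rightarrow> nat \<Rightarrow> (nat \<Rightarrow> real) \<Rightarrow> (nat \<Rightarrow> real) \<Rightarrow> real" where
  "potential lam d m u = (\<Sum>j=1..d. quad ((lam j)\<^sup>2) (m j) (u j))"

lemma cond_sd_pos:
  assumes "\<And>j. 1 \<le> j \<Longrightarrow> 0 < lam j" "1 \<le> d"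
  shows "0 < cond_sd lam d m"
proof -
  have "0 < (lam j)^4 * (1 + 2 * (m j)\<^sup>2)" if "j \<in> {1..d}" for j
    using assms(1)[of j] that by (intro mult_pos_pos add_pos_nonneg) auto
  then have "0 < (\<Sum>j=1..d. (lam j)^4 * (1 + 2 * (m j)\<^sup>2))" using assms(2) by (intro sum_pos) auto
  then show ?thesis by (simp add: cond_sd_def)
qed

text \<open>
  The factor \<open>sigma * sqrt d\<close> in \<open>T\<close> is the denominator of \<open>S\<close>, so only the numerators remain.
\<close>

lemma T_eq_softmin:
  assumes lam: "\<And>j. 1 \<le> j \<Longrightarrow> 0 < lam j" and d: "1 \<le> d" and n: "1 \<le> n"
  shows "T lam n d V e U \<omega> = softmin_excess (\<lambda>i. potential lam d (\<lambda>j. mu lam V e j \<omega>) (\<lambda>j. U i j \<omega>)) {1..n}"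
proof -
  define s where "s = cond_sd lam d (\<lambda>j. mu lam V e j \<omega>)"
  define X where "X i = potential lam d (\<lambda>j. mu lam V e j \<omega>) (\<lambda>j. U i j \<omega>)" for i
  define Y where "Y i = S lam d V e U i \<omega>" for i
  have s: "0 < s" unfolding s_def using lam d by (rule cond_sd_pos)
  have sig: "sigma lam d V e \<omega> * sqrt (real d) = s"
    using d by (simp add: sigma_def s_def cond_sd_def real_sqrt_mult real_sqrt_divide)
  have "(W lam V e U i j \<omega>)\<^sup>2 - (1 + (mu lam V e j \<omega>)\<^sup>2) = (U i j \<omega>)\<^sup>2 - 1 - 2 * mu lam V e j \<omega> * U i j \<omega>" for i j
    by (simp add: W_def power2_eq_square algebra_simps)
  then have "Y i = X i / s" for i
    by (simp only: X_def Y_def S_def potential_def quad_def s_def cond_sd_def)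
  then have X: "X i = s * Y i" for i
    using s by simp
  have "s * Min (Y ` {1..n}) = Min ((\<lambda>y. s * y) ` Y ` {1..n})"
    using n s by (intro mono_Min_commute monoI mult_left_mono) auto
  then have min: "s * Min (Y ` {1..n}) = Min (X ` {1..n})"
    unfolding X by (simp add: image_image)
  have "T lam n d V e U \<omega> = (\<Sum>l=2..n. exp (- (s * (order_stat n Y l - order_stat n Y 1))))"
    by (simp add: T_def sig Y_def[abs_def])
  also have "\<dots> = (\<Sum>i=1..n. exp (- (s * (Y i - Min (Y ` {1..n}))))) - 1"
    using n by (rule sum_exp_order_stat)
  also have "\<dots> = (\<Sum>i=1..n. exp (- (X i - Min (X ` {1..n})))) - 1"
    using min by (simp add: right_diff_distrib X)
  finally show ?thesis by (simp add: softmin_excess_def X_def)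
qed

lemma softmin_excess_cong:
  assumes "\<And>i. i \<in> I \<Longrightarrow> x i = y i"
  shows "softmin_excess x I = softmin_excess y I"
  using assms by (simp add: softmin_excess_def cong: sum.cong image_cong)

lemma softmin_bounds:
  fixes x :: "nat \<Rightarrow> real"
  assumes "1 \<le> n"
  shows "0 \<le> softmin_excess x {1..n}" and "softmin_excess x {1..n} \<le> real n"
proof -
  have "Min (x ` {1..n}) \<in> x ` {1..n}" using assms by (intro Min_in) auto
  then obtain k where k: "k \<in> {1..n}" "x k = Min (x ` {1..n})" by force
  have "exp (- (x k - Min (x ` {1..n}))) \<le> (\<Sum>i=1..n. exp (- (x i - Min (x ` {1..n}))))"
    using k(1) by (intro member_le_sum) auto
  then show "0 \<le> softmin_excess x {1..n}" by (simp add: softmin_excess_def k(2))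
  have "(\<Sum>i=1..n. exp (- (x i - Min (x ` {1..n})))) \<le> (\<Sum>i=1..n. 1)"
    by (intro sum_mono) auto
  then show "softmin_excess x {1..n} \<le> real n" by (simp add: softmin_excess_def)
qed

locale particle_filter = prob_space M for M :: "'a measure" +
  fixes lam :: "nat \<Rightarrow> real" and n d :: nat and V e :: "nat \<Rightarrow> 'a \<Rightarrow> real" and U :: "nat \<Rightarrow> nat \<Rightarrow> 'a \<Rightarrow> real"
  assumes lam_pos: "\<And>j. 1 \<le> j \<Longrightarrow> 0 < lam j" and d: "1 \<le> d" and n: "2 \<le> n"
    and normals: "indep_std_normals M n d V e U"
begin

abbreviation "fam \<equiv> case_sum V (case_sum e (case_prod U))"
abbreviation "hidden \<equiv> Inl ` {1..d} \<union> (\<lambda>j. Inr (Inl j)) ` {1..d} :: (nat + (nat + nat \<times> nat)) set"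
abbreviation "particles \<equiv> (\<lambda>p. Inr (Inr p)) ` ({1..n} \<times> {1..d}) :: (nat + (nat + nat \<times> nat)) set"

lemma indep_fam: "indep_vars (\<lambda>_. borel) fam (hidden \<union> particles)"
proof -
  have "{1..d} <+> ({1..d} <+> {1..n} \<times> {1..d}) = hidden \<union> particles"
    by (auto simp: Plus_def image_Un image_image)
  then show ?thesis using normals by (simp add: indep_std_normals_def)
qed

lemma normal_V: "j \<in> {1..d} \<Longrightarrow> distributed M lborel (V j) std_normal_density"
  and normal_e: "j \<in> {1..d} \<Longrightarrow> distributed M lborel (e j) std_normal_density"
  and normal_U: "i \<in> {1..n} \<Longrightarrow> j \<in> {1..d} \<Longrightarrow> distributed M lborel (U i j) std_normal_density"
  using normals by (auto simp: indep_std_normals_def)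

lemma rv_V [measurable]: "j \<in> {1..d} \<Longrightarrow> random_variable borel (V j)"
  and rv_e [measurable]: "j \<in> {1..d} \<Longrightarrow> random_variable borel (e j)"
  and rv_U [measurable]: "i \<in> {1..n} \<Longrightarrow> j \<in> {1..d} \<Longrightarrow> random_variable borel (U i j)"
  using normal_V normal_e normal_U by (auto simp: distributed_def)

lemma indep_U:
  assumes "i \<in> {1..n}"
  shows "indep_vars (\<lambda>_. borel) (U i) {1..d}"
proof -
  have "indep_vars (\<lambda>_. borel) (\<lambda>j \<omega>. (\<lambda>f. f (Inr (Inr (i, j)))) (\<lambda>k\<in>{Inr (Inr (i, j))}. fam k \<omega>)) {1..d}"
    using assms by (intro indep_vars_blocks[OF indep_fam]) (auto simp: disjoint_family_on_def)
  then show ?thesis by simp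
qed

definition potential_law :: "(nat \<Rightarrow> real) \<Rightarrow> real measure" where
  "potential_law m = distr M borel (\<lambda>\<omega>. potential lam d m (\<lambda>j. U 1 j \<omega>))"

lemma measurable_potential [measurable]:
  "potential lam d m \<in> borel_measurable (PiM {1..d} (\<lambda>_. borel))"
  unfolding potential_def[abs_def] quad_def by measurable

text \<open>
  The identity of the laws comes from the joint law of \<open>U i\<close>, which is the same product of normal laws for
  every \<open>i\<close>.
\<close>

lemma law_potential:
  assumes i: "i \<in> {1..n}"
  shows "distr M borel (\<lambda>\<omega>. potential lam d m (\<lambda>j. U i j \<omega>)) = potential_law m"
proof -
  define N where "N = density lborel (\<lambda>x. ennreal (std_normal_density x))"
  have law: "distr M borel (\<lambda>\<omega>. potential lam d m (\<lambda>j. U i j \<omega>)) = distr (PiM {1..d} (\<lambda>_. N)) borel (potential lam d m)"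
    if i: "i \<in> {1..n}" for i
  proof -
    have rv: "(\<lambda>\<omega>. \<lambda>j\<in>{1..d}. U i j \<omega>) \<in> measurable M (PiM {1..d} (\<lambda>_. borel))"
      using i by (intro measurable_restrict) auto
    have "distr M (PiM {1..d} (\<lambda>_. borel)) (\<lambda>\<omega>. \<lambda>j\<in>{1..d}. U i j \<omega>) = PiM {1..d} (\<lambda>j. distr M borel (U i j))"
      using indep_vars_iff_distr_eq_PiM'[where I = "{1..d}" and M' = "\<lambda>_. borel" and X = "U i"] indep_U[OF i] i d by simp
    also have "\<dots> = PiM {1..d} (\<lambda>_. N)"
    proof (intro PiM_cong refl)
      fix j assume "j \<in> {1..d}"
      then have "distr M lborel (U i j) = N"
        using distributed_distr_eq_density[OF normal_U[OF i]] by (simp add: N_def)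
      then show "distr M borel (U i j) = N" by (subst distr_cong[of M M borel lborel]) auto
    qed
    finally have joint: "distr M (PiM {1..d} (\<lambda>_. borel)) (\<lambda>\<omega>. \<lambda>j\<in>{1..d}. U i j \<omega>) = PiM {1..d} (\<lambda>_. N)" .
    have "distr M borel (\<lambda>\<omega>. potential lam d m (\<lambda>j. U i j \<omega>)) =
        distr M borel (potential lam d m \<circ> (\<lambda>\<omega>. \<lambda>j\<in>{1..d}. U i j \<omega>))"
      by (intro distr_cong) (auto simp: potential_def)
    also have "\<dots> = distr (PiM {1..d} (\<lambda>_. N)) borel (potential lam d m)"
      unfolding joint[symmetric] by (rule distr_distr[OF measurable_potential rv, symmetric])
    finally show ?thesis .
  qed
  show ?thesis unfolding potential_law_def using law[OF i] law[of 1] n by simp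
qed

lemma tail_potential_law:
  assumes "\<And>j. 1 \<le> j \<Longrightarrow> (lam j)\<^sup>2 \<le> \<Lambda>"
  shows "gaussian_left_tail (potential_law m) (cond_sd lam d m) (2 * \<Lambda>)"
    and "log_concave (cdf (potential_law m))"
    and "measure (potential_law m) {x} = 0"
proof -
  have one: "1 \<in> {1..n}" using n by simp
  have ne: "finite {1..d}" "{1..d} \<noteq> {}" using d by auto
  have w: "0 < (lam j)\<^sup>2" "(lam j)\<^sup>2 \<le> \<Lambda>" if "j \<in> {1..d}" for j
    using that lam_pos[of j] assms by auto
  have pw: "((lam j)\<^sup>2)\<^sup>2 = (lam j) ^ 4" for j by simp
  note * = quad_sum_gaussian_left_tail[where w = "\<lambda>j. (lam j)\<^sup>2" and m = m,
      OF ne indep_U[OF one] normal_U[OF one] w, unfolded pw,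
      folded cond_sd_def potential_def potential_law_def]
  show "gaussian_left_tail (potential_law m) (cond_sd lam d m) (2 * \<Lambda>)"
    "log_concave (cdf (potential_law m))" "measure (potential_law m) {x} = 0"
    using * by auto
qed

lemma iid_potentials:
  assumes "\<And>j. 1 \<le> j \<Longrightarrow> (lam j)\<^sup>2 \<le> \<Lambda>"
  shows "iid_sample M (\<lambda>i \<omega>. potential lam d m (\<lambda>j. U i j \<omega>)) {1..n} (potential_law m)"
proof unfold_locales
  have "indep_vars (\<lambda>_. borel) (\<lambda>i \<omega>. (\<lambda>f. potential lam d m (\<lambda>j. f (Inr (Inr (i, j)))))
      (\<lambda>k\<in>(\<lambda>j. Inr (Inr (i, j))) ` {1..d}. fam k \<omega>)) {1..n}"
    by (intro indep_vars_blocks[OF indep_fam])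
       (auto simp: disjoint_family_on_def potential_def quad_def intro!: borel_measurable_sum)
  also have "?this \<longleftrightarrow> indep_vars (\<lambda>_. borel) (\<lambda>i \<omega>. potential lam d m (\<lambda>j. U i j \<omega>)) {1..n}"
    by (intro indep_vars_cong) (auto simp: potential_def fun_eq_iff)
  finally show "indep_vars (\<lambda>_. borel) (\<lambda>i \<omega>. potential lam d m (\<lambda>j. U i j \<omega>)) {1..n}" .
qed (use n law_potential tail_potential_law(3)[OF assms] in auto)

definition cond_expectation_T :: "'a \<Rightarrow> real" where
  "cond_expectation_T \<omega> = expectation (\<lambda>\<omega>'. softmin_excess
     (\<lambda>i. potential lam d (\<lambda>j. mu lam V e j \<omega>) (\<lambda>j. U i j \<omega>')) {1..n})"

text \<open>
  The variables \<open>V\<close>, \<open>e\<close> on the one hand and \<open>U\<close> on the other are independent, so the former may be frozen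
  while the expectation over the latter is taken.
\<close>

lemma expectation_T:
  shows "expectation (T lam n d V e U) = expectation cond_expectation_T"
    and "integrable M cond_expectation_T"
    and "0 \<le> cond_expectation_T \<omega>" "cond_expectation_T \<omega> \<le> real n"
proof -
  have n1: "1 \<le> n" using n by simp
  define P where "P z i = potential lam d (\<lambda>j. fst z (Inl j) + fst z (Inr (Inl j)) / lam j) (\<lambda>j. snd z (Inr (Inr (i, j))))"
    for z :: "(nat + (nat + nat \<times> nat) \<Rightarrow> real) \<times> (nat + (nat + nat \<times> nat) \<Rightarrow> real)" and i :: nat
  define f where "f z = softmin_excess (P z) {1..n}" for z
  let ?H = "PiM hidden (\<lambda>_. borel) :: (nat + (nat + nat \<times> nat) \<Rightarrow> real) measure"
  let ?P = "PiM particles (\<lambda>_. borel) :: (nat + (nat + nat \<times> nat) \<Rightarrow> real) measure"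
  have P [measurable]: "(\<lambda>z. P z i) \<in> borel_measurable (?H \<Otimes>\<^sub>M ?P)" if "i \<in> {1..n}" for i
  proof -
    have 1: "(\<lambda>z. fst z k) \<in> borel_measurable (?H \<Otimes>\<^sub>M ?P)" if "k \<in> hidden" for k
      using that by (intro measurable_compose[OF measurable_fst measurable_component_singleton])
    have 2: "(\<lambda>z. snd z k) \<in> borel_measurable (?H \<Otimes>\<^sub>M ?P)" if "k \<in> particles" for k
      using that by (intro measurable_compose[OF measurable_snd measurable_component_singleton])
    show ?thesis unfolding P_def potential_def quad_def using that
      by (intro borel_measurable_sum borel_measurable_times borel_measurable_diff borel_measurable_power
          borel_measurable_const borel_measurable_add borel_measurable_divide 1 2) auto
  qed
  have f: "f \<in> borel_measurable (?H \<Otimes>\<^sub>M ?P)"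
    unfolding f_def softmin_excess_def
    by (intro borel_measurable_diff borel_measurable_sum measurable_compose[OF _ borel_measurable_exp]
      borel_measurable_uminus borel_measurable_Min borel_measurable_const P) auto
  have bdd: "\<bar>f z\<bar> \<le> real n" for z
    using softmin_bounds[OF n1, of "P z"] by (simp add: f_def)
  have ind: "indep_var ?H (\<lambda>\<omega>. \<lambda>k\<in>hidden. fam k \<omega>) ?P (\<lambda>\<omega>. \<lambda>k\<in>particles. fam k \<omega>)"
    by (rule indep_var_restrict[OF indep_fam]) auto
  have PE: "P (\<lambda>k\<in>hidden. fam k \<omega>, \<lambda>k\<in>particles. fam k \<omega>') i = potential lam d (\<lambda>j. mu lam V e j \<omega>) (\<lambda>j. U i j \<omega>')"
    if "i \<in> {1..n}" for i \<omega> \<omega>'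
    using that unfolding P_def potential_def by (intro sum.cong refl) (auto simp: mu_def)
  have fE: "f (\<lambda>k\<in>hidden. fam k \<omega>, \<lambda>k\<in>particles. fam k \<omega>') =
      softmin_excess (\<lambda>i. potential lam d (\<lambda>j. mu lam V e j \<omega>) (\<lambda>j. U i j \<omega>')) {1..n}" for \<omega> \<omega>'
    unfolding f_def by (rule softmin_excess_cong) (rule PE)
  have T: "T lam n d V e U \<omega> = f (\<lambda>k\<in>hidden. fam k \<omega>, \<lambda>k\<in>particles. fam k \<omega>)" for \<omega>
    unfolding fE by (rule T_eq_softmin[OF lam_pos d n1])
  have g: "cond_expectation_T \<omega> = expectation (\<lambda>\<omega>'. f (\<lambda>k\<in>hidden. fam k \<omega>, \<lambda>k\<in>particles. fam k \<omega>'))" for \<omega>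
    unfolding fE cond_expectation_T_def ..
  show "expectation (T lam n d V e U) = expectation cond_expectation_T"
    unfolding T g by (rule expectation_indep_iterated(1)[OF ind f bdd])
  show "integrable M cond_expectation_T"
    unfolding g by (rule expectation_indep_iterated(2)[OF ind f bdd])
  show "0 \<le> cond_expectation_T \<omega>"
    unfolding g using softmin_bounds(1)[OF n1] by (intro Bochner_Integration.integral_nonneg) (simp add: f_def)
  show "cond_expectation_T \<omega> \<le> real n"
  proof -
    have "cond_expectation_T \<omega> \<le> expectation (\<lambda>_. real n)"
      unfolding g
    proof (rule integral_mono')
      show "f (\<lambda>k\<in>hidden. fam k \<omega>, \<lambda>k\<in>particles. fam k \<omega>') \<le> real n" for \<omega>'
        using bdd by (auto simp: abs_le_iff)
    qed auto
    then show ?thesis by (simp add: prob_space)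
  qed
qed

end

section \<open>Concentration of the conditional variance\<close>

text \<open>
  Exponential Markov inequality. The value \<open>t = \<eta> / (8 K)\<close> keeps \<open>2 t w\<close> below \<open>1 / 4\<close>, where the cumulants
  are at most \<open>4 t\<^sup>2 w\<^sup>2\<close>, and minimises the resulting exponent \<open>- t \<eta> B + 4 t\<^sup>2 K B\<close>.
\<close>

lemma (in prob_space) quad_sum_upper_tail:
  fixes Z :: "'i \<Rightarrow> 'a \<Rightarrow> real"
  assumes J: "finite J" and ind: "indep_vars (\<lambda>_. borel) Z J"
    and Z: "\<And>j. j \<in> J \<Longrightarrow> distributed M lborel (Z j) std_normal_density"
    and w: "\<And>j. j \<in> J \<Longrightarrow> 0 \<le> w j" "\<And>j. j \<in> J \<Longrightarrow> w j \<le> K" "0 < K" "(\<Sum>j\<in>J. w j) \<le> B"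
    and \<eta>: "0 \<le> \<eta>" "\<eta> \<le> 1"
  shows "prob {\<omega>\<in>space M. \<eta> * B \<le> (\<Sum>j\<in>J. quad (w j) 0 (Z j \<omega>))} \<le> exp (- (\<eta>\<^sup>2 * B / (16 * K)))"
proof -
  define t where "t = \<eta> / (8 * K)"
  have t: "0 \<le> t" "8 * (t * K) = \<eta>" using \<eta> w(3) by (auto simp: t_def)
  have [measurable]: "random_variable borel (Z j)" if "j \<in> J" for j
    using ind that by (auto simp: indep_vars_def)
  let ?Q = "\<lambda>\<omega>. \<Sum>j\<in>J. quad (w j) 0 (Z j \<omega>)"
  have tw: "0 \<le> t * w j" "8 * (t * w j) \<le> 1" if "j \<in> J" for j
  proof -
    show "0 \<le> t * w j" using t w that by simp
    have "t * w j \<le> t * K" using t w that by (intro mult_left_mono) auto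
    then show "8 * (t * w j) \<le> 1" using t(2) \<eta> by linarith
  qed
  have one: "integrable M (\<lambda>\<omega>. exp (t * quad (w j) 0 (Z j \<omega>)))"
     "expectation (\<lambda>\<omega>. exp (t * quad (w j) 0 (Z j \<omega>))) \<le> exp (4 * t\<^sup>2 * (w j)\<^sup>2)" if j: "j \<in> J" for j
  proof -
    have eq: "exp (t * quad (w j) 0 u) = exp (- (t * w j)) * exp (0 * u - (- (t * w j)) * u\<^sup>2)" for u
      by (simp add: quad_def exp_add[symmetric] algebra_simps)
    have "0 < 1 + 2 * (- (t * w j))" using tw[OF j] by linarith
    note * = std_normal_exp_quadratic[OF Z[OF j] this, of 0]
    show "integrable M (\<lambda>\<omega>. exp (t * quad (w j) 0 (Z j \<omega>)))" unfolding eq using *(1) by simp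
    have "- (2 * (t * w j)) - 2 * (2 * (t * w j))\<^sup>2 \<le> ln (1 - 2 * (t * w j))"
      using tw[OF j] by (intro ln_one_minus_pos_lower_bound) auto
    then have "- (t * w j) - ln (1 - 2 * (t * w j)) / 2 \<le> 4 * t\<^sup>2 * (w j)\<^sup>2"
      by (simp add: power_mult_distrib)
    moreover have "expectation (\<lambda>\<omega>. exp (t * quad (w j) 0 (Z j \<omega>))) =
        exp (- (t * w j)) * expectation (\<lambda>\<omega>. exp (0 * Z j \<omega> - (- (t * w j)) * (Z j \<omega>)\<^sup>2))"
      unfolding eq by (rule integral_mult_right_zero)
    ultimately show "expectation (\<lambda>\<omega>. exp (t * quad (w j) 0 (Z j \<omega>))) \<le> exp (4 * t\<^sup>2 * (w j)\<^sup>2)"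
      unfolding *(2) by (simp add: exp_add[symmetric])
  qed
  have prod: "exp (t * ?Q \<omega>) = (\<Prod>j\<in>J. exp (t * quad (w j) 0 (Z j \<omega>)))" for \<omega>
    by (simp add: sum_distrib_left exp_sum[OF J, symmetric])
  have iv: "indep_vars (\<lambda>_. borel) (\<lambda>j \<omega>. exp (t * quad (w j) 0 (Z j \<omega>))) J"
    by (rule indep_vars_compose2[OF ind]) measurable
  have int: "integrable M (\<lambda>\<omega>. exp (t * ?Q \<omega>))"
    unfolding prod using indep_vars_integrable[OF J iv] one(1) by simp
  have "expectation (\<lambda>\<omega>. exp (t * ?Q \<omega>)) = (\<Prod>j\<in>J. expectation (\<lambda>\<omega>. exp (t * quad (w j) 0 (Z j \<omega>))))"
    unfolding prod using indep_vars_lebesgue_integral[OF J iv] one(1) by simp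
  also have "\<dots> \<le> (\<Prod>j\<in>J. exp (4 * t\<^sup>2 * (w j)\<^sup>2))"
    using one(2) by (intro prod_mono) auto
  also have "\<dots> = exp (4 * t\<^sup>2 * (\<Sum>j\<in>J. (w j)\<^sup>2))" by (simp add: exp_sum[OF J, symmetric] sum_distrib_left)
  also have "\<dots> \<le> exp (4 * t\<^sup>2 * (K * B))"
  proof -
    have "(\<Sum>j\<in>J. (w j)\<^sup>2) \<le> (\<Sum>j\<in>J. K * w j)"
      using w by (intro sum_mono) (simp add: power2_eq_square mult_right_mono)
    also have "\<dots> \<le> K * B" using w by (simp add: sum_distrib_left[symmetric])
    finally show ?thesis by (simp add: mult_left_mono)
  qed
  finally have E: "expectation (\<lambda>\<omega>. exp (t * ?Q \<omega>)) \<le> exp (4 * t\<^sup>2 * (K * B))" .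
  have "prob {\<omega>\<in>space M. \<eta> * B \<le> ?Q \<omega>} = expectation (indicator {\<omega>\<in>space M. \<eta> * B \<le> ?Q \<omega>})"
    by simp
  also have "\<dots> \<le> expectation (\<lambda>\<omega>. exp (- (t * (\<eta> * B))) * exp (t * ?Q \<omega>))"
  proof (rule integral_mono)
    fix \<omega>
    show "indicator {\<omega>\<in>space M. \<eta> * B \<le> ?Q \<omega>} \<omega> \<le> exp (- (t * (\<eta> * B))) * exp (t * ?Q \<omega>)"
    proof (cases "\<eta> * B \<le> ?Q \<omega>")
      case True
      then have "t * (\<eta> * B) \<le> t * ?Q \<omega>" using t by (intro mult_left_mono)
      then show ?thesis by (auto simp: exp_add[symmetric] split: split_indicator)
    qed simp
  qed (use int in \<open>auto simp: emeasure_eq_measure intro!: integrable_real_indicator\<close>)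
  also have "\<dots> \<le> exp (- (t * (\<eta> * B))) * exp (4 * t\<^sup>2 * (K * B))" using E by simp
  also have "\<dots> = exp (- (\<eta>\<^sup>2 * B / (16 * K)))"
    using w(3) by (simp add: exp_add[symmetric] t_def power2_eq_square field_simps)
  finally show ?thesis .
qed

text \<open>
  With \<open>m = 0\<close> this is an instance of the left tail bound that was proved for the sample.
\<close>

lemma (in prob_space) quad_sum_lower_tail:
  fixes Z :: "'i \<Rightarrow> 'a \<Rightarrow> real"
  assumes J: "finite J" "J \<noteq> {}" and ind: "indep_vars (\<lambda>_. borel) Z J"
    and Z: "\<And>j. j \<in> J \<Longrightarrow> distributed M lborel (Z j) std_normal_density"
    and w: "\<And>j. j \<in> J \<Longrightarrow> 0 < w j" "\<And>j. j \<in> J \<Longrightarrow> w j \<le> K" "0 < K" "(\<Sum>j\<in>J. w j) \<le> B"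
    and \<eta>: "0 \<le> \<eta>" "\<eta> \<le> 1"
  shows "prob {\<omega>\<in>space M. (\<Sum>j\<in>J. quad (w j) 0 (Z j \<omega>)) \<le> - (\<eta> * B)} \<le> exp (- (\<eta>\<^sup>2 * B / (16 * K)))"
proof -
  let ?Q = "\<lambda>\<omega>. \<Sum>j\<in>J. quad (w j) 0 (Z j \<omega>)"
  have [measurable]: "random_variable borel (Z j)" if "j \<in> J" for j
    using ind that by (auto simp: indep_vars_def)
  have pos: "0 < (\<Sum>j\<in>J. w j)" using J w by (intro sum_pos) auto
  then have B: "0 < B" using w(4) by linarith
  define v where "v = (\<Sum>j\<in>J. (w j)\<^sup>2)"
  have v: "0 < v" unfolding v_def using J w(1) by (intro sum_pos) (auto simp: less_imp_neq[symmetric])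
  have "v \<le> (\<Sum>j\<in>J. K * w j)"
    unfolding v_def using w by (intro sum_mono) (simp add: power2_eq_square mult_right_mono less_imp_le)
  also have "\<dots> \<le> K * B" using w by (simp add: sum_distrib_left[symmetric])
  finally have vKB: "v \<le> K * B" .
  have "gaussian_left_tail (distr M borel ?Q) (sqrt (2 * v)) (2 * K)"
    using quad_sum_gaussian_left_tail(1)[where m = "\<lambda>_. 0", OF J ind Z w(1,2)] by (simp add: v_def)
  then interpret G: gaussian_left_tail "distr M borel ?Q" "sqrt (2 * v)" "2 * K" .
  have "prob {\<omega>\<in>space M. ?Q \<omega> \<le> - (\<eta> * B)} = cdf (distr M borel ?Q) (- (\<eta> * B))"
    unfolding cdf_def by (subst measure_distr) (auto intro!: arg_cong[where f = prob])
  also have "\<dots> \<le> exp (- ((\<eta> * B)\<^sup>2 / (2 * (sqrt (2 * v))\<^sup>2)))"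
    using \<eta> B by (intro G.left_tail_le) auto
  also have "\<dots> \<le> exp (- (\<eta>\<^sup>2 * B / (16 * K)))"
  proof -
    have "\<eta>\<^sup>2 * B / (16 * K) = (\<eta> * B)\<^sup>2 / (16 * (K * B))"
      using B by (simp add: power2_eq_square)
    also have "\<dots> \<le> (\<eta> * B)\<^sup>2 / (4 * v)"
    proof (rule divide_left_mono)
      show "4 * v \<le> 16 * (K * B)" using vKB mult_pos_pos[OF w(3) B] by linarith
    qed (use v w(3) B in auto)
    finally show ?thesis using v by simp
  qed
  finally show ?thesis .
qed

context particle_filter
begin

text \<open>
  The variance of \<open>mu\<close> at \<open>j\<close> is \<open>1 + 1 / (lam j)\<^sup>2\<close>.
\<close>

definition std_mu :: "nat \<Rightarrow> 'a \<Rightarrow> real" where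
  "std_mu j \<omega> = mu lam V e j \<omega> / sqrt (1 + 1 / (lam j)\<^sup>2)"

lemma normal_std_mu:
  assumes j: "j \<in> {1..d}"
  shows "distributed M lborel (std_mu j) std_normal_density"
proof -
  have lam: "0 < lam j" using lam_pos j by simp
  define r where "r = sqrt (1 + 1 / (lam j)\<^sup>2)"
  have r: "0 < r" unfolding r_def using lam by (simp add: add_pos_nonneg)
  have "indep_var borel ((\<lambda>f. f (Inl j)) \<circ> (\<lambda>\<omega>. \<lambda>k\<in>{Inl j}. fam k \<omega>))
      borel ((\<lambda>f. f (Inr (Inl j)) / lam j) \<circ> (\<lambda>\<omega>. \<lambda>k\<in>{Inr (Inl j)}. fam k \<omega>))"
    using j by (intro indep_var_compose[OF indep_var_restrict[OF indep_fam]]) auto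
  then have iv: "indep_var borel (V j) borel (\<lambda>\<omega>. e j \<omega> / lam j)" by (simp add: comp_def)
  have "distributed M lborel (\<lambda>\<omega>. 0 + 1 / lam j * e j \<omega>) (normal_density (0 + 1 / lam j * 0) (\<bar>1 / lam j\<bar> * 1))"
    using lam by (intro normal_density_affine normal_e[OF j]) auto
  then have en: "distributed M lborel (\<lambda>\<omega>. e j \<omega> / lam j) (normal_density 0 (1 / lam j))"
    using lam by simp
  have "distributed M lborel (\<lambda>\<omega>. V j \<omega> + e j \<omega> / lam j) (normal_density (0 + 0) (sqrt (1\<^sup>2 + (1 / lam j)\<^sup>2)))"
    using lam by (intro add_indep_normal[OF iv _ _ normal_V[OF j] en]) auto
  then have "distributed M lborel (\<lambda>\<omega>. V j \<omega> + e j \<omega> / lam j) (normal_density 0 r)"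
    by (simp add: r_def power_divide)
  then have "distributed M lborel (\<lambda>\<omega>. (V j \<omega> + e j \<omega> / lam j - 0) / r) std_normal_density"
    using normal_standard_normal_convert[OF r] by simp
  then show ?thesis by (simp add: std_mu_def[abs_def] mu_def r_def)
qed

lemma indep_std_mu: "indep_vars (\<lambda>_. borel) std_mu {1..d}"
proof -
  have "indep_vars (\<lambda>_. borel) (\<lambda>j \<omega>. (\<lambda>f. (f (Inl j) + f (Inr (Inl j)) / lam j) / sqrt (1 + 1 / (lam j)\<^sup>2))
      (\<lambda>k\<in>{Inl j, Inr (Inl j)}. fam k \<omega>)) {1..d}"
    by (intro indep_vars_blocks[OF indep_fam])
       (auto simp: disjoint_family_on_def)
  then show ?thesis by (simp add: std_mu_def[abs_def] mu_def)
qed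

lemma tau_pos: "0 < tau lam d"
proof -
  have "0 < 3 * (lam j)^4 + 2 * (lam j)\<^sup>2" if "j \<in> {1..d}" for j
  proof -
    have "0 < lam j" using lam_pos that by simp
    then show ?thesis by (simp add: add_pos_pos)
  qed
  then have "0 < (\<Sum>j=1..d. 3 * (lam j)^4 + 2 * (lam j)\<^sup>2)"
    using d by (intro sum_pos) auto
  then show ?thesis by (simp add: tau_def)
qed

lemma tau_sq: "(tau lam d)\<^sup>2 = (\<Sum>j=1..d. 6 * (lam j)^4 + 4 * (lam j)\<^sup>2)"
proof -
  have "0 \<le> (\<Sum>j=1..d. 3 * (lam j)^4 + 2 * (lam j)\<^sup>2)" by (intro sum_nonneg) auto
  then have "(tau lam d)\<^sup>2 = 2 * (\<Sum>j=1..d. 3 * (lam j)^4 + 2 * (lam j)\<^sup>2)" by (simp add: tau_def)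
  then show ?thesis by (simp add: sum_distrib_left algebra_simps)
qed

text \<open>
  The conditional variance is a quadratic form in the hidden Gaussian variables with expectation \<open>tau\<^sup>2\<close>.
\<close>

lemma cond_variance_eq:
  "(cond_sd lam d (\<lambda>j. mu lam V e j \<omega>))\<^sup>2 =
    (tau lam d)\<^sup>2 + (\<Sum>j=1..d. quad (4 * ((lam j)^4 + (lam j)\<^sup>2)) 0 (std_mu j \<omega>))"
proof -
  have "0 \<le> (\<Sum>j=1..d. (lam j)^4 * (1 + 2 * (mu lam V e j \<omega>)\<^sup>2))" by (intro sum_nonneg) auto
  then have "(cond_sd lam d (\<lambda>j. mu lam V e j \<omega>))\<^sup>2 = 2 * (\<Sum>j=1..d. (lam j)^4 * (1 + 2 * (mu lam V e j \<omega>)\<^sup>2))"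
    by (simp add: cond_sd_def)
  also have "\<dots> = (\<Sum>j=1..d. 2 * ((lam j)^4 * (1 + 2 * (mu lam V e j \<omega>)\<^sup>2)))"
    by (rule sum_distrib_left)
  also have "\<dots> = (\<Sum>j=1..d. (6 * (lam j)^4 + 4 * (lam j)\<^sup>2) + quad (4 * ((lam j)^4 + (lam j)\<^sup>2)) 0 (std_mu j \<omega>))"
  proof (rule sum.cong)
    fix j assume "j \<in> {1..d}"
    then have lam: "0 < lam j" using lam_pos by simp
    have "0 < 1 + 1 / (lam j)\<^sup>2" using lam by (simp add: add_pos_nonneg)
    then have "(mu lam V e j \<omega>)\<^sup>2 = (1 + 1 / (lam j)\<^sup>2) * (std_mu j \<omega>)\<^sup>2"
      by (simp add: std_mu_def power_divide)
    moreover have "(lam j)^4 * (1 + 1 / (lam j)\<^sup>2) = (lam j)^4 + (lam j)\<^sup>2"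
      using lam by (simp add: field_simps eval_nat_numeral)
    ultimately have "(lam j)^4 * (mu lam V e j \<omega>)\<^sup>2 = ((lam j)^4 + (lam j)\<^sup>2) * (std_mu j \<omega>)\<^sup>2"
      by (simp add: mult.assoc[symmetric])
    then show "2 * ((lam j)^4 * (1 + 2 * (mu lam V e j \<omega>)\<^sup>2)) =
      6 * (lam j)^4 + 4 * (lam j)\<^sup>2 + quad (4 * ((lam j)^4 + (lam j)\<^sup>2)) 0 (std_mu j \<omega>)"
      by (simp add: quad_def algebra_simps)
  qed simp
  finally show ?thesis by (simp add: tau_sq sum.distrib)
qed

text \<open>
  The weights of the quadratic form are bounded by \<open>4 (\<Lambda>\<^sup>2 + \<Lambda>)\<close> and sum to at most \<open>tau\<^sup>2\<close>, so deviations of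
  order \<open>tau\<^sup>2\<close> are exponentially unlikely in \<open>tau\<^sup>2\<close>.
\<close>

lemma cond_variance_concentration:
  assumes \<Lambda>: "\<And>j. 1 \<le> j \<Longrightarrow> (lam j)\<^sup>2 \<le> \<Lambda>" and \<eta>: "0 < \<eta>" "\<eta> \<le> 1"
  defines "bad \<equiv> {\<omega>\<in>space M. \<eta> * (tau lam d)\<^sup>2 \<le> \<bar>(cond_sd lam d (\<lambda>j. mu lam V e j \<omega>))\<^sup>2 - (tau lam d)\<^sup>2\<bar>}"
  shows "bad \<in> events" and "prob bad \<le> 2 * exp (- (\<eta>\<^sup>2 * (tau lam d)\<^sup>2 / (64 * (\<Lambda>\<^sup>2 + \<Lambda>))))"
proof -
  define w where "w j = 4 * ((lam j)^4 + (lam j)\<^sup>2)" for j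
  define K where "K = 4 * (\<Lambda>\<^sup>2 + \<Lambda>)"
  define Q where "Q \<omega> = (\<Sum>j=1..d. quad (w j) 0 (std_mu j \<omega>))" for \<omega>
  let ?B = "(tau lam d)\<^sup>2"
  have [measurable]: "random_variable borel (std_mu j)" if "j \<in> {1..d}" for j
    using indep_std_mu that by (auto simp: indep_vars_def)
  have [measurable]: "random_variable borel Q" unfolding Q_def by measurable
  have bad: "bad = {\<omega>\<in>space M. \<eta> * ?B \<le> \<bar>Q \<omega>\<bar>}"
    unfolding bad_def cond_variance_eq by (simp add: Q_def w_def)
  show "bad \<in> events" unfolding bad by measurable
  have "0 < (lam 1)\<^sup>2" using lam_pos[of 1] by simp
  also have "(lam 1)\<^sup>2 \<le> \<Lambda>" by (simp add: \<Lambda>)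
  finally have \<Lambda>0: "0 < \<Lambda>" .
  have w: "0 < w j" "w j \<le> K" if "j \<in> {1..d}" for j
  proof -
    have "0 < lam j" using lam_pos that by simp
    then show "0 < w j" by (simp add: w_def add_pos_pos)
    have l: "(lam j)\<^sup>2 \<le> \<Lambda>" using \<Lambda> that by simp
    then have "((lam j)\<^sup>2)\<^sup>2 \<le> \<Lambda>\<^sup>2" by (intro power_mono) auto
    then show "w j \<le> K" using l by (simp add: w_def K_def)
  qed
  have K: "0 < K" using \<Lambda>0 by (simp add: K_def add_pos_pos)
  have B: "(\<Sum>j=1..d. w j) \<le> ?B" unfolding tau_sq w_def by (intro sum_mono) simp
  have "bad \<subseteq> {\<omega>\<in>space M. \<eta> * ?B \<le> Q \<omega>} \<union> {\<omega>\<in>space M. Q \<omega> \<le> - (\<eta> * ?B)}"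
    unfolding bad by auto
  then have "prob bad \<le> prob ({\<omega>\<in>space M. \<eta> * ?B \<le> Q \<omega>} \<union> {\<omega>\<in>space M. Q \<omega> \<le> - (\<eta> * ?B)})"
    by (intro finite_measure_mono) auto
  also have "\<dots> \<le> prob {\<omega>\<in>space M. \<eta> * ?B \<le> Q \<omega>} + prob {\<omega>\<in>space M. Q \<omega> \<le> - (\<eta> * ?B)}"
    by (intro measure_Un_le) auto
  also have "\<dots> \<le> exp (- (\<eta>\<^sup>2 * ?B / (16 * K))) + exp (- (\<eta>\<^sup>2 * ?B / (16 * K)))"
    unfolding Q_def using w K B \<eta> d
    by (intro add_mono quad_sum_upper_tail quad_sum_lower_tail indep_std_mu normal_std_mu) (auto intro: less_imp_le)
  finally show "prob bad \<le> 2 * exp (- (\<eta>\<^sup>2 * (tau lam d)\<^sup>2 / (64 * (\<Lambda>\<^sup>2 + \<Lambda>))))"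
    by (simp add: K_def algebra_simps)
qed

end

section \<open>Removing the conditioning\<close>

lemma abs_ratio_minus_one_le:
  fixes a b \<eta> :: real
  assumes "0 < a" "0 < b" and \<eta>: "0 \<le> \<eta>" "\<eta> \<le> 1 / 2" and le: "\<bar>b\<^sup>2 - a\<^sup>2\<bar> \<le> \<eta> * a\<^sup>2"
  shows "\<bar>a / b - 1\<bar> \<le> 2 * \<eta>"
proof -
  have "\<eta> * a\<^sup>2 \<le> 1 / 2 * a\<^sup>2" using \<eta> by (intro mult_right_mono) auto
  then have b: "a\<^sup>2 \<le> 2 * b\<^sup>2" using le by (simp add: abs_le_iff)
  have "\<bar>a - b\<bar> * b \<le> \<bar>a - b\<bar> * (a + b)" using assms by (intro mult_left_mono) auto
  also have "\<dots> = \<bar>(a - b) * (a + b)\<bar>" using assms by (simp add: abs_mult)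
  also have "(a - b) * (a + b) = - (b\<^sup>2 - a\<^sup>2)" by (simp add: power2_eq_square algebra_simps)
  also have "\<bar>- (b\<^sup>2 - a\<^sup>2)\<bar> \<le> \<eta> * (2 * b\<^sup>2)"
    using le mult_left_mono[OF b \<eta>(1)] by (simp only: abs_minus_cancel)
  finally have "\<bar>a - b\<bar> * b \<le> 2 * \<eta> * b * b" by (simp add: power2_eq_square mult_ac)
  then have "\<bar>a - b\<bar> \<le> 2 * \<eta> * b" using assms by simp
  moreover have "a / b - 1 = (a - b) / b" using assms by (simp add: diff_divide_distrib)
  then have "\<bar>a / b - 1\<bar> = \<bar>a - b\<bar> / b" using assms by (simp only: abs_divide abs_of_pos)
  ultimately show ?thesis using assms by (simp add: pos_divide_le_eq)
qed

text \<open>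
  Where \<open>s\<^sup>2\<close> is within a factor \<open>1 \<plusminus> \<epsilon>\<close> of \<open>tau\<^sup>2\<close>, the conditional asymptotics apply and \<open>s\<close> may be exchanged
  for \<open>tau\<close>. On the exceptional event the conditional expectation is bounded by \<open>n\<close>, which is outweighed by the
  exponentially small probability.
\<close>

lemma (in particle_filter) expectation_T_approx:
  fixes \<theta> \<epsilon> :: real
  assumes \<Lambda>: "\<And>j. 1 \<le> j \<Longrightarrow> (lam j)\<^sup>2 \<le> \<Lambda>" and \<epsilon>: "0 < \<epsilon>" "\<epsilon> \<le> 1 / 2" and \<theta>: "1 \<le> \<theta>"
    and good: "\<And>m. tau lam d / 2 \<le> cond_sd lam d m \<Longrightarrow>
      \<bar>expectation (\<lambda>\<omega>. softmin_excess (\<lambda>i. potential lam d m (\<lambda>j. U i j \<omega>)) {1..n}) * (cond_sd lam d m / \<theta>) - 1\<bar> \<le> \<epsilon>"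
  shows "\<bar>tau lam d / \<theta> * expectation (T lam n d V e U) - 1\<bar>
    \<le> 4 * \<epsilon> + 2 * (real n * tau lam d + 1) * exp (- (\<epsilon>\<^sup>2 * (tau lam d)\<^sup>2 / (64 * (\<Lambda>\<^sup>2 + \<Lambda>))))"
proof -
  define t where "t = tau lam d"
  define s where "s \<omega> = cond_sd lam d (\<lambda>j. mu lam V e j \<omega>)" for \<omega>
  define g where "g = cond_expectation_T"
  define bad where "bad = {\<omega>\<in>space M. \<epsilon> * t\<^sup>2 \<le> \<bar>(s \<omega>)\<^sup>2 - t\<^sup>2\<bar>}"
  have t: "0 < t" using tau_pos by (simp add: t_def)
  have s: "0 < s \<omega>" for \<omega> unfolding s_def using lam_pos d by (rule cond_sd_pos)
  have g_int: "integrable M g" using expectation_T(2) by (simp add: g_def)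
  have bad: "bad \<in> events" "prob bad \<le> 2 * exp (- (\<epsilon>\<^sup>2 * t\<^sup>2 / (64 * (\<Lambda>\<^sup>2 + \<Lambda>))))"
    unfolding bad_def s_def t_def using \<epsilon>(2) by (intro cond_variance_concentration[OF \<Lambda> \<epsilon>(1)]; simp)+
  have pt: "\<bar>t / \<theta> * g \<omega> - 1\<bar> \<le> 4 * \<epsilon> + (real n * t + 1) * indicator bad \<omega>" if \<omega>: "\<omega> \<in> space M" for \<omega>
  proof (cases "\<omega> \<in> bad")
    case True
    have "t / \<theta> * g \<omega> \<le> t / 1 * real n"
      using t \<theta> expectation_T(3,4) by (intro mult_mono divide_left_mono) (auto simp: g_def)
    moreover have "0 \<le> t / \<theta> * g \<omega>" using t \<theta> expectation_T(3) by (simp add: g_def)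
    ultimately have "\<bar>t / \<theta> * g \<omega> - 1\<bar> \<le> real n * t + 1" by (simp add: abs_le_iff mult.commute)
    then show ?thesis using True \<epsilon> by simp
  next
    case False
    then have le: "\<bar>(s \<omega>)\<^sup>2 - t\<^sup>2\<bar> \<le> \<epsilon> * t\<^sup>2" using \<omega> by (auto simp: bad_def)
    have r: "\<bar>t / s \<omega> - 1\<bar> \<le> 2 * \<epsilon>" by (rule abs_ratio_minus_one_le[OF t s _ \<epsilon>(2) le]) (use \<epsilon> in simp)
    then have "t / s \<omega> \<le> 2" using \<epsilon> by (simp add: abs_le_iff)
    then have "t / 2 \<le> s \<omega>" using s[of \<omega>] by (simp add: field_simps)
    then have x: "\<bar>g \<omega> * (s \<omega> / \<theta>) - 1\<bar> \<le> \<epsilon>"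
      using good[of "\<lambda>j. mu lam V e j \<omega>"] unfolding g_def cond_expectation_T_def s_def t_def by blast
    define x where "x = g \<omega> * (s \<omega> / \<theta>)"
    define y where "y = t / s \<omega>"
    have xb: "\<bar>x - 1\<bar> \<le> \<epsilon>" using x by (simp only: x_def)
    have yb: "\<bar>y - 1\<bar> \<le> 2 * \<epsilon>" using r by (simp only: y_def)
    have y: "0 \<le> y" "y \<le> 2" using t s[of \<omega>] \<open>t / s \<omega> \<le> 2\<close> by (auto simp: y_def intro: less_imp_le)
    have "t / \<theta> * g \<omega> - 1 = (x - 1) * y + (y - 1)" using s[of \<omega>] by (simp add: x_def y_def algebra_simps)
    also have "\<bar>\<dots>\<bar> \<le> \<bar>x - 1\<bar> * y + \<bar>y - 1\<bar>"
      using abs_triangle_ineq[of "(x - 1) * y" "y - 1"] y(1) by (simp only: abs_mult abs_of_nonneg)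
    also have "\<dots> \<le> \<epsilon> * 2 + 2 * \<epsilon>" using xb yb y \<epsilon> by (intro add_mono mult_mono) auto
    finally have "\<bar>t / \<theta> * g \<omega> - 1\<bar> \<le> 4 * \<epsilon>" by simp
    then show ?thesis using False by simp
  qed
  have int: "integrable M (\<lambda>\<omega>. t / \<theta> * g \<omega> - 1)" using g_int by simp
  have ind: "integrable M (indicator bad :: 'a \<Rightarrow> real)"
    using bad(1) by (intro integrable_real_indicator) (auto simp: emeasure_eq_measure)
  have "tau lam d / \<theta> * expectation (T lam n d V e U) - 1 = expectation (\<lambda>\<omega>. t / \<theta> * g \<omega> - 1)"
    using g_int by (simp add: expectation_T(1) g_def t_def prob_space)
  also have "\<bar>\<dots>\<bar> \<le> expectation (\<lambda>\<omega>. \<bar>t / \<theta> * g \<omega> - 1\<bar>)"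
    by (rule integral_abs_bound)
  also have "\<dots> \<le> expectation (\<lambda>\<omega>. 4 * \<epsilon> + (real n * t + 1) * indicator bad \<omega>)"
    using pt int ind by (intro integral_mono) auto
  also have "\<dots> = 4 * \<epsilon> + (real n * t + 1) * prob bad"
    using ind bad(1) by (simp add: prob_space)
  also have "(real n * t + 1) * prob bad \<le> (real n * t + 1) * (2 * exp (- (\<epsilon>\<^sup>2 * t\<^sup>2 / (64 * (\<Lambda>\<^sup>2 + \<Lambda>)))))"
    using bad(2) t by (intro mult_left_mono) auto
  also have "\<dots> = 2 * (real n * t + 1) * exp (- (\<epsilon>\<^sup>2 * t\<^sup>2 / (64 * (\<Lambda>\<^sup>2 + \<Lambda>))))" by simp
  finally show ?thesis by (simp only: t_def)
qed

theorem proposition3p3: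
  fixes lam :: "nat \<Rightarrow> real"
    and n :: "nat \<Rightarrow> nat"
    and M :: "nat \<Rightarrow> 'a measure"
    and V e :: "nat \<Rightarrow> nat \<Rightarrow> 'a \<Rightarrow> real"
    and U :: "nat \<Rightarrow> nat \<Rightarrow> nat \<Rightarrow> 'a \<Rightarrow> real"
  assumes lam_pos: "\<And>j. 1 \<le> j \<Longrightarrow> 0 < lam j"
    and lam_decreasing: "\<And>i j. 1 \<le> i \<Longrightarrow> i \<le> j \<Longrightarrow> lam j \<le> lam i"
    and lam_diverges: "filterlim (\<lambda>N. \<Sum>j=1..N. (lam j)\<^sup>2) at_top sequentially"
    and normals: "\<And>d. 1 \<le> d \<Longrightarrow> indep_std_normals (M d) (n d) d (V d) (e d) (U d)"
    and n_tendsto: "filterlim n at_top sequentially"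
    and rate: "(\<lambda>d. ln (real (n d)) * ln (real d) / (tau lam d)\<^sup>2) \<longlonglongrightarrow> 0"
  shows "(\<lambda>d. tau lam d / sqrt (2 * ln (real (n d))) *
           prob_space.expectation (M d) (T lam (n d) d (V d) (e d) (U d))) \<longlonglongrightarrow> 1"
proof (rule LIMSEQ_I)
  fix r :: real assume r: "0 < r"
  define \<epsilon> where "\<epsilon> = min (1 / 2) (r / 8)"
  have \<epsilon>: "0 < \<epsilon>" "\<epsilon> \<le> 1 / 2" "8 * \<epsilon> \<le> r" using r by (auto simp: \<epsilon>_def)
  define \<Lambda> where "\<Lambda> = (lam 1)\<^sup>2"
  have \<Lambda>: "(lam j)\<^sup>2 \<le> \<Lambda>" if "1 \<le> j" for j
    unfolding \<Lambda>_def using lam_pos[OF that] lam_decreasing[of 1 j] that by (intro power_mono) auto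
  have \<Lambda>0: "0 < \<Lambda>" using lam_pos[of 1] by (simp add: \<Lambda>_def)
  have tau2: "(tau lam d)\<^sup>2 = 2 * (\<Sum>j=1..d. 3 * (lam j)^4 + 2 * (lam j)\<^sup>2)" for d
    unfolding tau_def by (subst real_sqrt_pow2) (auto intro!: sum_nonneg)
  have tau_lim: "filterlim (tau lam) at_top sequentially"
  proof -
    have "(\<Sum>j=1..d. (lam j)\<^sup>2) \<le> (tau lam d)\<^sup>2" for d
      unfolding tau2 sum_distrib_left by (intro sum_mono) simp
    then have "filterlim (\<lambda>d. (tau lam d)\<^sup>2) at_top sequentially"
      by (intro filterlim_at_top_mono[OF lam_diverges]) simp
    then have "filterlim (\<lambda>d. sqrt ((tau lam d)\<^sup>2)) at_top sequentially"
      by (rule filterlim_compose[OF sqrt_at_top])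
    moreover have "sqrt ((tau lam d)\<^sup>2) = tau lam d" for d
      by (simp add: tau_def sum_nonneg)
    ultimately show ?thesis by simp
  qed
  \<comment> \<open>The factor \<open>ln d\<close> in the rate is at least 1 from \<open>d = 3\<close> on.\<close>
  have ratio: "(\<lambda>d. ln (real (n d)) / (tau lam d)\<^sup>2) \<longlonglongrightarrow> 0"
  proof (rule tendsto_sandwich[OF _ _ tendsto_const rate])
    have n1: "\<forall>\<^sub>F d in sequentially. 1 \<le> n d" using n_tendsto by (auto simp: filterlim_at_top)
    then show "\<forall>\<^sub>F d in sequentially. 0 \<le> ln (real (n d)) / (tau lam d)\<^sup>2"
      by eventually_elim simp
    show "\<forall>\<^sub>F d in sequentially. ln (real (n d)) / (tau lam d)\<^sup>2 \<le> ln (real (n d)) * ln (real d) / (tau lam d)\<^sup>2"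
      using n1 eventually_ge_at_top[of 3]
    proof eventually_elim
      case (elim d)
      have "exp 1 \<le> real d" using exp_le elim by linarith
      then have "1 \<le> ln (real d)" using elim by (subst ln_ge_iff) auto
      then have "ln (real (n d)) * 1 \<le> ln (real (n d)) * ln (real d)"
        using elim by (intro mult_left_mono) auto
      then show ?case by (intro divide_right_mono) auto
    qed
  qed
  define \<kappa> where "\<kappa> = \<epsilon>\<^sup>2 / (64 * (\<Lambda>\<^sup>2 + \<Lambda>))"
  have \<kappa>: "0 < \<kappa>" using \<epsilon> \<Lambda>0 by (simp add: \<kappa>_def add_pos_pos)
  have "0 \<le> 2 * \<Lambda>" using \<Lambda>0 by simp
  from softmin_excess_asymptotics[OF this \<epsilon>(1), where 'a = 'a]
  obtain N R \<rho> where \<rho>: "0 < \<rho>" and asym: "\<And>(M :: 'a measure) (X :: nat \<Rightarrow> 'a \<Rightarrow> real) n \<nu> s.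
    iid_sample M X {1..n} \<nu> \<Longrightarrow> gaussian_left_tail \<nu> s (2 * \<Lambda>) \<Longrightarrow> log_concave (cdf \<nu>) \<Longrightarrow>
    N \<le> n \<Longrightarrow> R \<le> s \<Longrightarrow> sqrt (2 * ln (real n)) \<le> \<rho> * s \<Longrightarrow>
    \<bar>prob_space.expectation M (\<lambda>\<omega>. softmin_excess (\<lambda>i. X i \<omega>) {1..n}) * (s / sqrt (2 * ln (real n))) - 1\<bar> \<le> \<epsilon>"
    by blast
  have ev_n: "\<forall>\<^sub>F d in sequentially. max 8 N \<le> n d"
    using n_tendsto unfolding filterlim_at_top by blast
  have ev_tau: "\<forall>\<^sub>F d in sequentially. max 0 (2 * R) \<le> tau lam d"
    using tau_lim unfolding filterlim_at_top by blast
  have ev_rate: "\<forall>\<^sub>F d in sequentially. ln (real (n d)) / (tau lam d)\<^sup>2 < min (\<rho>\<^sup>2 / 8) (\<kappa> / 2)"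
    using \<rho> \<kappa> by (intro order_tendstoD(2)[OF ratio]) auto
  have "((\<lambda>t. 2 * (exp (- (\<kappa> / 2 * t\<^sup>2)) * t + exp (- (\<kappa> * t\<^sup>2)))) \<longlongrightarrow> 0) at_top" using \<kappa> by real_asymp
  then have "(\<lambda>d. 2 * (exp (- (\<kappa> / 2 * (tau lam d)\<^sup>2)) * tau lam d + exp (- (\<kappa> * (tau lam d)\<^sup>2)))) \<longlonglongrightarrow> 0"
    by (rule filterlim_compose[OF _ tau_lim])
  then have ev_small: "\<forall>\<^sub>F d in sequentially. 2 * (exp (- (\<kappa> / 2 * (tau lam d)\<^sup>2)) * tau lam d + exp (- (\<kappa> * (tau lam d)\<^sup>2))) < \<epsilon>"
    using \<epsilon>(1) by (rule order_tendstoD(2))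
  have "\<forall>\<^sub>F d in sequentially. norm (tau lam d / sqrt (2 * ln (real (n d))) *
           prob_space.expectation (M d) (T lam (n d) d (V d) (e d) (U d)) - 1) < r"
    using ev_n ev_tau ev_rate ev_small eventually_ge_at_top[of 1]
  proof eventually_elim
    case (elim d)
    have d1: "1 \<le> d" and n8: "8 \<le> n d" "N \<le> n d" and t: "0 \<le> tau lam d" "2 * R \<le> tau lam d"
      using elim by auto
    have "prob_space (M d)" using normals[OF d1] by (simp add: indep_std_normals_def)
    then interpret particle_filter "M d" lam "n d" d "V d" "e d" "U d"
      using lam_pos d1 n8 normals[OF d1] by (simp add: particle_filter_def particle_filter_axioms_def)
    define \<theta> where "\<theta> = sqrt (2 * ln (real (n d)))"
    have tpos: "0 < tau lam d" by (rule tau_pos)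
    have ln_n: "1 \<le> ln (real (n d))"
    proof -
      have "exp 1 \<le> real (n d)" using exp_le n8 by linarith
      then show ?thesis using n8 by (subst ln_ge_iff) auto
    qed
    then have \<theta>: "1 \<le> \<theta>" by (simp add: \<theta>_def)
    \<comment> \<open>The first bound keeps \<open>\<theta> / s\<close> small for all \<open>s \<ge> tau / 2\<close>; the second one makes \<open>n\<close> smaller than
      the reciprocal of the probability of the exceptional event.\<close>
    have ln1: "ln (real (n d)) \<le> \<rho>\<^sup>2 / 8 * (tau lam d)\<^sup>2" and ln2: "ln (real (n d)) \<le> \<kappa> / 2 * (tau lam d)\<^sup>2"
      using elim(3) tpos by (simp_all add: pos_divide_less_eq)
    have "\<theta> \<le> sqrt ((\<rho> * (tau lam d / 2))\<^sup>2)"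
      unfolding \<theta>_def using ln1 by (intro real_sqrt_le_mono) (simp add: power_mult_distrib power_divide)
    then have \<theta>_le: "\<theta> \<le> \<rho> * (tau lam d / 2)" using \<rho> tpos by simp
    have "\<bar>tau lam d / \<theta> * expectation (T lam (n d) d (V d) (e d) (U d)) - 1\<bar>
      \<le> 4 * \<epsilon> + 2 * (real (n d) * tau lam d + 1) * exp (- (\<epsilon>\<^sup>2 * (tau lam d)\<^sup>2 / (64 * (\<Lambda>\<^sup>2 + \<Lambda>))))"
    proof (rule expectation_T_approx[OF \<Lambda> \<epsilon>(1,2) \<theta>])
      fix m assume le: "tau lam d / 2 \<le> cond_sd lam d m"
      have "\<rho> * (tau lam d / 2) \<le> \<rho> * cond_sd lam d m" using le \<rho> by (intro mult_left_mono) auto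
      then show "\<bar>expectation (\<lambda>\<omega>. softmin_excess (\<lambda>i. potential lam d m (\<lambda>j. U d i j \<omega>)) {1..n d}) *
          (cond_sd lam d m / \<theta>) - 1\<bar> \<le> \<epsilon>"
        unfolding \<theta>_def using \<theta>_le t le n8
        by (intro asym[OF iid_potentials[OF \<Lambda>] tail_potential_law(1,2)[OF \<Lambda>]]) (auto simp: \<theta>_def)
    qed
    also have "\<epsilon>\<^sup>2 * (tau lam d)\<^sup>2 / (64 * (\<Lambda>\<^sup>2 + \<Lambda>)) = \<kappa> * (tau lam d)\<^sup>2" by (simp add: \<kappa>_def)
    also have "2 * (real (n d) * tau lam d + 1) * exp (- (\<kappa> * (tau lam d)\<^sup>2)) \<le>
        2 * (exp (- (\<kappa> / 2 * (tau lam d)\<^sup>2)) * tau lam d + exp (- (\<kappa> * (tau lam d)\<^sup>2)))"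
    proof -
      have "real (n d) = exp (ln (real (n d)))" using n8 by simp
      also have "\<dots> \<le> exp (\<kappa> / 2 * (tau lam d)\<^sup>2)" using ln2 by simp
      finally have "real (n d) * exp (- (\<kappa> * (tau lam d)\<^sup>2)) \<le> exp (\<kappa> / 2 * (tau lam d)\<^sup>2) * exp (- (\<kappa> * (tau lam d)\<^sup>2))"
        by (intro mult_right_mono) auto
      also have "\<dots> = exp (- (\<kappa> / 2 * (tau lam d)\<^sup>2))" by (simp add: exp_add[symmetric])
      finally have "real (n d) * exp (- (\<kappa> * (tau lam d)\<^sup>2)) * tau lam d \<le> exp (- (\<kappa> / 2 * (tau lam d)\<^sup>2)) * tau lam d"
        using tpos by (intro mult_right_mono) auto
      then show ?thesis by (simp add: algebra_simps)
    qed
    also have "4 * \<epsilon> + 2 * (exp (- (\<kappa> / 2 * (tau lam d)\<^sup>2)) * tau lam d + exp (- (\<kappa> * (tau lam d)\<^sup>2))) < r"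
      using elim(4) \<epsilon> by linarith
    finally show ?case by (simp add: \<theta>_def)
  qed
  then show "\<exists>d0. \<forall>d\<ge>d0. norm (tau lam d / sqrt (2 * ln (real (n d))) *
           prob_space.expectation (M d) (T lam (n d) d (V d) (e d) (U d)) - 1) < r"
    by (simp add: eventually_sequentially)
qed

end
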